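(* Let $X$ be a connected finite polyhedron and let $f:X\to D_n(X)$ be an $n$-valued map with chosen reference lift $\bar f:\tilde X\to F_n(\tilde X,\pi)$. Suppose $\psi_f(\pi_1(X))\subset J_n(\bar f)$ and $f$ is irreducible. Then all fixed point classes of $f$ have the same index.
   Context: For a space $Y$, $D_n(Y)$ is the space of unordered $n$-element subsets of $Y$, topologized as the quotient by $\Sigma_n$ of $F_n(Y)=\{(y_1,\dots,y_n)\in Y^n\mid y_i\ne y_j\text{ for } i\neq j\}$. An $n$-valued map is a continuous function $f:X\to D_n(Y)$. A submap of $f$ is a $k$-valued map $g:X\to D_k(Y)$ ($1\le k\le n$) with $g(x)\subseteq f(x)$ for all $x$; it is proper if $k<n$; $f$ is irreducible if it has no proper submap. For $f:X\to D_n(X)$, $\mathrm{Fix}(f)=\{x\in X\mid x\in f(x)\}$. Let $p:\tilde X\to X$ be the universal covering, with $\pi_1(X)$ acting by covering transformations. Let $F_n(\tilde X,\pi)=\{(\tilde x_1,\dots,\tilde x_n)\in\tilde X^n\mid p(\tilde x_i)\neq p(\tilde x_j)\text{ for }i\neq j\}$, with covering map $p^n:F_n(\tilde X,\pi)\to D_n(X)$ applying $p$ to each coordinate. Its covering group is $\pi_1(X)^n\rtimes\Sigma_n$, acting by $(\alpha_1,\dots,\alpha_n;\eta)(\tilde x_1,\dots,\tilde x_n)=(\alpha_1\tilde x_{\eta^{-1}(1)},\dots,\alpha_n\tilde x_{\eta^{-1}(n)})$. A reference lift of $f$ is a continuous map $\bar f=(\bar f_1,\dots,\bar f_n):\tilde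 X\to F_n(\tilde X,\pi)$ with $p^n\circ\bar f=f\circ p$. The homomorphism $\psi_f:\pi_1(X)\to\pi_1(X)^n\rtimes\Sigma_n$ is determined by $\psi_f(\alpha)\circ\bar f=\bar f\circ\alpha$. A cyclic homotopy of $f$ is a homotopy (continuous map) $h:X\times I\to D_n(X)$ with $h(x,0)=h(x,1)=f(x)$ for all $x$. It lifts to a homotopy $\bar h:\tilde X\times I\to F_n(\tilde X,\pi)$ with $\bar h(\tilde x,0)=\bar f(\tilde x)$ and $\bar h(\tilde x,1)=(\alpha;\eta)\bar f(\tilde x)$ for some $(\alpha;\eta)\in\pi_1(X)^n\rtimes\Sigma_n$. The Jiang subgroup $J_n(\bar f)\subseteq\pi_1(X)^n\rtimes\Sigma_n$ is the set of all elements $(\alpha;\eta)$ obtained in this way from cyclic homotopies of $f$. A fixed point class of $f$ is a set of the form $p(\mathrm{Fix}(\alpha\bar f_i))$ with $\alpha\in\pi_1(X)$ and $1\le i\le n$, where $\mathrm{Fix}(\alpha\bar f_i)=\{\tilde x\in\tilde X\mid\alpha\bar f_i(\tilde x)=\tilde x\}$. Nonempty fixed point classes are compact, open in $\mathrm{Fix}(f)$, and pairwise equal or disjoint. The index of a fixed point class $C$ is the usual (Schirmer) fixed point index for $n$-valued maps, which can be described as follows: there are an open neighborhood $W$ of $C$ in $X$ with $\mathrm{Fix}(f)\cap W=C$ and a continuous single-valued $\varphi:W\to X$ with $\varphi(x)\in f(x)$ for $x\in W$ and $\varphi(x)=x$ for $x\in C$; the index of $C$ is the classical fixed point index of $\varphi$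 on $W$ (independent of choices). The empty class has index $0$. *)

theory Defs
  imports "HOL-Analysis.Analysis" "HOL-Homology.Homology" "HOL-Combinatorics.Permutations"
begin

section \<open>Configuration spaces\<close>

definition quotient_topology :: "'a topology \<Rightarrow> ('a \<Rightarrow> 'b) \<Rightarrow> 'b topology" where
  "quotient_topology X q =
     topology (\<lambda>U. U \<subseteq> q ` topspace X \<and> openin X {x \<in> topspace X. q x \<in> U})"

lemma openin_quotient_topology:
  "openin (quotient_topology X q) U \<longleftrightarrow>
     U \<subseteq> q ` topspace X \<and> openin X {x \<in> topspace X. q x \<in> U}"
proof -
  have *: "{x \<in> topspace X. q x \<in> S \<inter> T} =
      {x \<in> topspace X. q x \<in> S} \<inter> {x \<in> topspace X. q x \<in> T}" for S T
    by blast
  have **: "{x \<in> topspace X. q x \<in> \<Union>\<K>} = (\<Union>K\<in>\<K>. {x \<in> topspace X. q x \<in> K})" for \<K>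
    by blast
  have "istopology (\<lambda>U. U \<subseteq> q ` topspace X \<and> openin X {x \<in> topspace X. q x \<in> U})"
    unfolding istopology_def * ** by (blast intro: openin_Int openin_Union)
  then show ?thesis
    by (simp add: quotient_topology_def topology_inverse')
qed

lemma topspace_quotient_topology [simp]: "topspace (quotient_topology X q) = q ` topspace X"
proof
  show "topspace (quotient_topology X q) \<subseteq> q ` topspace X"
    using openin_quotient_topology by (metis openin_topspace)
  have "{x \<in> topspace X. q x \<in> q ` topspace X} = topspace X"
    by auto
  then show "q ` topspace X \<subseteq> topspace (quotient_topology X q)"
    by (intro openin_subset) (simp add: openin_quotient_topology)
qed

lemma quotient_map_quotient_topology: "quotient_map X (quotient_topology X q) q"
  by (auto simp: quotient_map_def openin_quotient_topology)

definition ordered_conf :: "nat \<Rightarrow> 'a topology \<Rightarrow> (nat \<Rightarrow> 'a) topology" where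
  "ordered_conf n Y = subtopology (product_topology (\<lambda>_. Y) {1..n}) {y. inj_on y {1..n}}"

text \<open>Two tuples of distinct points have the same underlying set iff they differ by a
  permutation, so the quotient by the symmetric group is formed with
  \<open>y \<mapsto> {y 1, \<dots>, y n}\<close>.\<close>

definition unordered_conf :: "nat \<Rightarrow> 'a topology \<Rightarrow> 'a set topology" where
  "unordered_conf n Y = quotient_topology (ordered_conf n Y) (\<lambda>y. y ` {1..n})"

text \<open>The space \<open>F\<^sub>n(Xt, \<pi>)\<close>, and the map \<open>p\<^sup>n\<close> from it to the unordered configurations.\<close>

definition orbit_conf :: "nat \<Rightarrow> 'b::topological_space set \<Rightarrow> ('b \<Rightarrow> 'a) \<Rightarrow> (nat \<Rightarrow> 'b) topology" where
  "orbit_conf n Xt p =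
     subtopology (product_topology (\<lambda>_. top_of_set Xt) {1..n}) {y. inj_on (p \<circ> y) {1..n}}"

definition conf_proj :: "nat \<Rightarrow> ('b \<Rightarrow> 'a) \<Rightarrow> (nat \<Rightarrow> 'b) \<Rightarrow> 'a set" where
  "conf_proj n p y = (p \<circ> y) ` {1..n}"


section \<open>Multivalued maps\<close>

definition n_valued_map :: "nat \<Rightarrow> 'c topology \<Rightarrow> 'a topology \<Rightarrow> ('c \<Rightarrow> 'a set) \<Rightarrow> bool" where
  "n_valued_map n X Y f \<longleftrightarrow> continuous_map X (unordered_conf n Y) f"

definition irreducible_map :: "nat \<Rightarrow> 'c topology \<Rightarrow> 'a topology \<Rightarrow> ('c \<Rightarrow> 'a set) \<Rightarrow> bool" where
  "irreducible_map n X Y f \<longleftrightarrow>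
     \<not> (\<exists>k g. 1 \<le> k \<and> k < n \<and> n_valued_map k X Y g \<and> (\<forall>x \<in> topspace X. g x \<subseteq> f x))"

definition Fix :: "'a set \<Rightarrow> ('a \<Rightarrow> 'a set) \<Rightarrow> 'a set" where
  "Fix X f = {x \<in> X. x \<in> f x}"


section \<open>Universal coverings and lifts\<close>

definition universal_covering ::
    "'b::topological_space set \<Rightarrow> ('b \<Rightarrow> 'a::topological_space) \<Rightarrow> 'a set \<Rightarrow> bool" where
  "universal_covering Xt p X \<longleftrightarrow> covering_space Xt p X \<and> simply_connected Xt"

text \<open>The fundamental group of the base enters only through its action on the universal
  covering, hence as the group of covering transformations. Requiring extensionality makes
  each covering transformation a unique HOL function.\<close>

definition deck :: "'b::topological_space set \<Rightarrow> ('b \<Rightarrow> 'a) \<Rightarrow> ('b \<Rightarrow> 'b) set" where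
  "deck Xt p = {\<alpha> \<in> extensional Xt.
     homeomorphic_map (top_of_set Xt) (top_of_set Xt) \<alpha> \<and> (\<forall>x \<in> Xt. p (\<alpha> x) = p x)}"

text \<open>The elements of \<open>\<pi>\<^sup>n \<rtimes> \<Sigma>\<^sub>n\<close>, where \<open>\<pi>\<close> is the group of covering transformations, and
  their action on \<open>n\<close>-tuples. The group multiplication is never needed.\<close>

definition wreath :: "nat \<Rightarrow> 'b::topological_space set \<Rightarrow> ('b \<Rightarrow> 'a) \<Rightarrow>
    ((nat \<Rightarrow> 'b \<Rightarrow> 'b) \<times> (nat \<Rightarrow> nat)) set" where
  "wreath n Xt p = ({1..n} \<rightarrow>\<^sub>E deck Xt p) \<times> {\<eta>. \<eta> permutes {1..n}}"

definition wreath_act :: "nat \<Rightarrow> (nat \<Rightarrow> 'b \<Rightarrow> 'b) \<times> (nat \<Rightarrow> nat) \<Rightarrow> (nat \<Rightarrow> 'b) \<Rightarrow> (nat \<Rightarrow> 'b)" where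
  "wreath_act n g y = (\<lambda>i\<in>{1..n}. fst g i (y (inv_into UNIV (snd g) i)))"

definition reference_lift :: "nat \<Rightarrow> 'b::topological_space set \<Rightarrow> ('b \<Rightarrow> 'a) \<Rightarrow>
    ('a \<Rightarrow> 'a set) \<Rightarrow> ('b \<Rightarrow> nat \<Rightarrow> 'b) \<Rightarrow> bool" where
  "reference_lift n Xt p f fb \<longleftrightarrow>
     continuous_map (top_of_set Xt) (orbit_conf n Xt p) fb \<and>
     (\<forall>x \<in> Xt. conf_proj n p (fb x) = f (p x))"

definition lift_hom :: "nat \<Rightarrow> 'b::topological_space set \<Rightarrow> ('b \<Rightarrow> 'a) \<Rightarrow>
    ('b \<Rightarrow> nat \<Rightarrow> 'b) \<Rightarrow> ('b \<Rightarrow> 'b) \<Rightarrow> (nat \<Rightarrow> 'b \<Rightarrow> 'b) \<times> (nat \<Rightarrow> nat)" where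
  "lift_hom n Xt p fb \<alpha> =
     (THE g. g \<in> wreath n Xt p \<and> (\<forall>x \<in> Xt. wreath_act n g (fb x) = fb (\<alpha> x)))"

definition cyclic_homotopy :: "nat \<Rightarrow> 'a::topological_space set \<Rightarrow> ('a \<Rightarrow> 'a set) \<Rightarrow>
    ('a \<times> real \<Rightarrow> 'a set) \<Rightarrow> bool" where
  "cyclic_homotopy n X f h \<longleftrightarrow>
     continuous_map (top_of_set (X \<times> {0..1})) (unordered_conf n (top_of_set X)) h \<and>
     (\<forall>x \<in> X. h (x, 0) = f x \<and> h (x, 1) = f x)"

definition lifts_homotopy :: "nat \<Rightarrow> 'b::topological_space set \<Rightarrow> ('b \<Rightarrow> 'a) \<Rightarrow>
    ('a \<times> real \<Rightarrow> 'a set) \<Rightarrow> ('b \<times> real \<Rightarrow> nat \<Rightarrow> 'b) \<Rightarrow> bool" where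
  "lifts_homotopy n Xt p h hb \<longleftrightarrow>
     continuous_map (top_of_set (Xt \<times> {0..1})) (orbit_conf n Xt p) hb \<and>
     (\<forall>x \<in> Xt. \<forall>t \<in> {0..1}. conf_proj n p (hb (x, t)) = h (p x, t))"

definition Jiang_subgroup :: "nat \<Rightarrow> 'b::topological_space set \<Rightarrow>
    ('b \<Rightarrow> 'a::topological_space) \<Rightarrow> 'a set \<Rightarrow> ('a \<Rightarrow> 'a set) \<Rightarrow> ('b \<Rightarrow> nat \<Rightarrow> 'b) \<Rightarrow>
    ((nat \<Rightarrow> 'b \<Rightarrow> 'b) \<times> (nat \<Rightarrow> nat)) set" where
  "Jiang_subgroup n Xt p X f fb = {g \<in> wreath n Xt p.
     \<exists>h hb. cyclic_homotopy n X f h \<and> lifts_homotopy n Xt p h hb \<and>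
       (\<forall>x \<in> Xt. hb (x, 0) = fb x \<and> hb (x, 1) = wreath_act n g (fb x))}"

definition fixed_point_classes :: "nat \<Rightarrow> 'b::topological_space set \<Rightarrow> ('b \<Rightarrow> 'a) \<Rightarrow>
    ('b \<Rightarrow> nat \<Rightarrow> 'b) \<Rightarrow> 'a set set" where
  "fixed_point_classes n Xt p fb =
     {p ` {x \<in> Xt. \<alpha> (fb x i) = x} |\<alpha> i. \<alpha> \<in> deck Xt p \<and> i \<in> {1..n}}"


section \<open>The fixed point index\<close>

text \<open>Dold's definition. For \<open>V\<close> open in \<open>E = \<real>\<^sup>N\<close> and \<open>g : V \<rightarrow> E\<close> with compact fixed point
  set \<open>K\<close>, the index is the integer \<open>k\<close> with \<open>(id - g)\<^sub>* o\<^sub>K = k \<cdot> o\<^sub>0\<close>, where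
  \<open>o\<^sub>K \<in> H\<^sub>N(V, V - K)\<close> is the fundamental class around \<open>K\<close> and \<open>o\<^sub>0 \<in> H\<^sub>N(E, E - 0)\<close>.
  Both classes come from one generator of the infinite cyclic group \<open>H\<^sub>N(E, E - B)\<close>, with \<open>B\<close> a
  ball about \<open>0\<close> containing \<open>K\<close>: \<open>o\<^sub>0\<close> by inclusion, \<open>o\<^sub>K\<close> by inclusion into \<open>H\<^sub>N(E, E - K)\<close>
  followed by the inverse of the excision isomorphism from \<open>H\<^sub>N(V, V - K)\<close>. The condition is
  linear in the generator and therefore stated for all elements \<open>z\<close> of \<open>H\<^sub>N(E, E - B)\<close>; below,
  \<open>w\<close> is the excised image of \<open>z\<close>. Homology groups are written multiplicatively.\<close>

definition has_euclidean_fixed_point_index ::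
    "'a::euclidean_space set \<Rightarrow> ('a \<Rightarrow> 'a) \<Rightarrow> int \<Rightarrow> bool" where
  "has_euclidean_fixed_point_index V g k \<longleftrightarrow>
     (let N = int DIM('a); K = {x \<in> V. g x = x} in
       open V \<and> continuous_on V g \<and> compact K \<and>
       (\<exists>r>0. K \<subseteq> cball 0 r \<and>
         (\<forall>z \<in> carrier (relative_homology_group N (euclidean :: 'a topology) (- cball 0 r)).
            \<exists>w \<in> carrier (relative_homology_group N (top_of_set V) (V - K)).
              hom_induced N (top_of_set V) (V - K) euclidean (- K) id w =
                hom_induced N euclidean (- cball 0 r) euclidean (- K) id z \<and>
              hom_induced N (top_of_set V) (V - K) euclidean (- {0}) (\<lambda>x. x - g x) w =
                hom_induced N euclidean (- cball 0 r) euclidean (- {0}) id z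
                  [^]\<^bsub>relative_homology_group N (euclidean :: 'a topology) (- {0})\<^esub> k)))"

text \<open>For a compact polyhedron \<open>X\<close> in Euclidean space, \<open>W\<close> open in \<open>X\<close> and \<open>\<phi> : W \<rightarrow> X\<close>, precompose
  with a retraction \<open>\<rho>\<close> of an open neighbourhood \<open>U\<close> onto \<open>X\<close>; this does not change the fixed
  point set, and the index does not depend on the retraction.\<close>

definition has_fixed_point_index ::
    "'a::euclidean_space set \<Rightarrow> 'a set \<Rightarrow> ('a \<Rightarrow> 'a) \<Rightarrow> int \<Rightarrow> bool" where
  "has_fixed_point_index X W \<phi> k \<longleftrightarrow>
     (\<exists>U \<rho>. open U \<and> retraction U X \<rho> \<and>
        has_euclidean_fixed_point_index (U \<inter> \<rho> -` W) (\<phi> \<circ> \<rho>) k)"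

definition class_index :: "'a::euclidean_space set \<Rightarrow> ('a \<Rightarrow> 'a set) \<Rightarrow> 'a set \<Rightarrow> int" where
  "class_index X f C =
     (if C = {} then 0
      else THE k. \<exists>W \<phi>. openin (top_of_set X) W \<and> C \<subseteq> W \<and> Fix X f \<inter> W = C \<and>
             continuous_on W \<phi> \<and> \<phi> ` W \<subseteq> X \<and>
             (\<forall>x \<in> W. \<phi> x \<in> f x) \<and> (\<forall>x \<in> C. \<phi> x = x) \<and>
             has_fixed_point_index X W \<phi> k)"

end

theory Submission
  imports Defs "HOL-Probability.Discrete_Topology"
begin

text \<open>A covering transformation \<open>\<alpha>\<close> gives, by the hypothesis on \<open>\<psi>\<^sub>f\<close>, a cyclic homotopy whose lift
  starts at \<open>fb\<close> and ends at \<open>fb \<circ> \<alpha>\<close>. The index is constant along a homotopy, so the class of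
  \<open>\<beta> \<circ> fb\<^sub>i\<close> has the same index as \<open>p (Fix (\<beta> \<circ> fb\<^sub>i \<circ> \<alpha>))\<close>. Conjugating by \<open>\<alpha>\<close>, the latter is the class
  of \<open>\<alpha> \<circ> \<beta> \<circ> fb\<^sub>i\<close>, so the index does not depend on \<open>\<beta>\<close>; writing \<open>fb\<^sub>i \<circ> \<alpha> = \<epsilon> \<circ> fb\<^sub>j\<close>, it is the class of
  \<open>\<beta> \<circ> \<epsilon> \<circ> fb\<^sub>j\<close>, so the index is constant on the orbits of the permutation action on the
  coordinates. An orbit that is not everything would split off a proper submap.\<close>

section \<open>The fixed point index in Euclidean space\<close>

text \<open>Constancy of the index along a homotopy is the step that shapes the development. The
  index belongs to a single-valued map, but a homotopy of n-valued maps has in general no continuous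
  selection, and the neighbourhoods on which one exists around a moving fixed point class vary with
  the time. The remedy is to treat the fixed pairs (x, t) as a whole. Over the compact set X
  \<times> [0,1] distinct values stay a uniform distance apart, so the value close to x is a
  continuous selection on an open set of pairs, and the pairs belonging to one lift are compact and
  open among all fixed pairs. What remains is homotopy invariance for a map on an open set of pairs
  whose time slices may vary; it follows from local constancy in t, since over a short time interval
  the compact set of fixed pairs lies in a product inside the domain. Both
  \<open>class_index\<close> and \<open>lift_hom\<close> are definite descriptions, so existence and
  uniqueness must be settled before a value can be read off. Hence the homological index is
  developed up to independence of ball, neighbourhood, retraction and selection.\<close>

lemma iso_inclusion_punctured:
  fixes r :: real
  assumes "r > 0"
  shows "hom_induced p (euclidean :: 'a::euclidean_space topology) (- cball 0 r) euclidean (- {0}) id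
    \<in> iso (relative_homology_group p (euclidean :: 'a topology) (- cball 0 r)) (relative_homology_group p (euclidean :: 'a topology) (- {0}))"
proof -
  let ?E = "euclidean :: 'a topology"
  let ?A = "- cball (0::'a) r" and ?B = "- {0::'a}"
  let ?j = "hom_induced p ?E ?A ?E ?B id"
  let ?i = "hom_induced (p - 1) (top_of_set ?A) {} (top_of_set ?B) {} id"
  \<comment> \<open>Radial push by \<open>r + 1\<close>: the norm becomes norm x + r + 1, which
    exceeds r for every x \<noteq> 0. Along the segment from x to its image the norm never drops
    below norm x, so linear homotopies stay inside either complement and \<open>?c\<close> is a
    homotopy inverse of the inclusion. Contractibility of E turns the relative groups into reduced
    homology of the complements.\<close>
  let ?c = "\<lambda>x::'a. (1 + (r + 1) / norm x) *\<^sub>R x"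
  have con: "contractible_space ?E"
    by (metis UNIV_I contractible_UNIV contractible_space_top_of_set subtopology_UNIV)
  obtain v :: 'a where v: "norm v = r + 1"
    using vector_choose_size[of "r + 1"] assms by auto
  have neA: "topspace ?E \<inter> ?A \<noteq> {}" and neB: "topspace ?E \<inter> ?B \<noteq> {}"
    proof -
    have "v \<in> topspace ?E \<inter> ?A" "v \<in> topspace ?E \<inter> ?B"
      using v assms by auto
    then show "topspace ?E \<inter> ?A \<noteq> {}" "topspace ?E \<inter> ?B \<noteq> {}"
      by blast+
  qed
  have bA: "hom_boundary p ?E ?A \<in> iso (relative_homology_group p ?E ?A) (reduced_homology_group (p - 1) (top_of_set ?A))"
    using iso_relative_homology_of_contractible[OF con neA] .
  have bB: "hom_boundary p ?E ?B \<in> iso (relative_homology_group p ?E ?B) (reduced_homology_group (p - 1) (top_of_set ?B))"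
    using iso_relative_homology_of_contractible[OF con neB] .
  have nc: "norm (?c x) = norm x + (r + 1)" if "x \<noteq> 0" for x
    using that assms by (simp add: field_simps)
  have cc: "continuous_on (-{0}) ?c"
    by (intro continuous_intros) auto
  have seg: "closed_segment x (?c x) \<subseteq> {y. norm x \<le> norm y}" if "x \<noteq> 0" for x
  proof (clarsimp simp: closed_segment_def)
    fix u :: real assume u: "0 \<le> u" "u \<le> 1"
    have "(1 - u) *\<^sub>R x + u *\<^sub>R ?c x = (1 + u * (r + 1) / norm x) *\<^sub>R x"
      by (simp add: algebra_simps)
    moreover have "norm ((1 + u * (r + 1) / norm x) *\<^sub>R x) \<ge> 1 * norm x"
      unfolding norm_scaleR using u assms by (intro mult_right_mono) auto
    ultimately show "norm x \<le> norm ((1 - u) *\<^sub>R x + (u * (1 + (r + 1) / norm x)) *\<^sub>R x)"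
      by simp
  qed
  have hA: "homotopic_with (\<lambda>_. True) (top_of_set ?A) (top_of_set ?A) (?c \<circ> id) id"
  proof (rule homotopic_with_symD, rule homotopic_with_linear)
    show "continuous_on ?A (?c \<circ> id)"
      by (simp, rule continuous_on_subset[OF cc]) (use assms in auto)
    show "closed_segment (id x) ((?c \<circ> id) x) \<subseteq> ?A" if "x \<in> ?A" for x
      using seg[of x] that assms by force
  qed (simp add: id_def continuous_on_id)
  have hB: "homotopic_with (\<lambda>_. True) (top_of_set ?B) (top_of_set ?B) (id \<circ> ?c) id"
  proof (rule homotopic_with_symD, rule homotopic_with_linear)
    show "continuous_on ?B (id \<circ> ?c)"
      using cc by simp
    show "closed_segment (id x) ((id \<circ> ?c) x) \<subseteq> ?B" if "x \<in> ?B" for x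
      using seg[of x] that assms by force
  qed (simp add: id_def continuous_on_id)
  have i: "?i \<in> iso (reduced_homology_group (p - 1) (top_of_set ?A)) (reduced_homology_group (p - 1) (top_of_set ?B))"
  proof (rule homotopy_equivalence_reduced_homology_group_isomorphism[OF _ _ hA hB])
    show "continuous_map (top_of_set ?A) (top_of_set ?B) id"
      using assms by (auto simp: continuous_on_id)
    show "continuous_map (top_of_set ?B) (top_of_set ?A) ?c"
      unfolding continuous_map_in_subtopology
    proof
      show "continuous_map (top_of_set ?B) euclidean ?c"
        using cc by simp
      have "\<not> norm (?c x) \<le> r" if "x \<noteq> 0" for x
        unfolding nc[OF that] using norm_ge_zero[of x] by linarith
      then show "?c \<in> topspace (top_of_set ?B) \<rightarrow> ?A"
        by (intro Pi_I) (simp only: topspace_euclidean_subtopology Compl_iff mem_cball dist_norm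
            diff_0 norm_minus_cancel singleton_iff not_False_eq_True)
    qed
  qed
  have AB: "?A \<subseteq> ?B"
    using assms by auto
  \<comment> \<open>Three sides of this naturality square are bijections, hence so is the
    fourth.\<close>
  have comm: "hom_boundary p ?E ?B \<circ> ?j = ?i \<circ> hom_boundary p ?E ?A"
    by (rule naturality_hom_induced) (use AB in auto)
  have bb: "bij_betw (?i \<circ> hom_boundary p ?E ?A) (carrier (relative_homology_group p ?E ?A)) (carrier (reduced_homology_group (p - 1) (top_of_set ?B)))"
    using bA i unfolding iso_def by (auto intro: bij_betw_trans)
  have "bij_betw (hom_boundary p ?E ?B) (carrier (relative_homology_group p ?E ?B)) (carrier (reduced_homology_group (p - 1) (top_of_set ?B)))"
    using bB by (auto simp: iso_def)
  moreover have "?j ` carrier (relative_homology_group p ?E ?A) \<subseteq> carrier (relative_homology_group p ?E ?B)"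
    by (auto simp: hom_induced_carrier)
  ultimately have "bij_betw ?j (carrier (relative_homology_group p ?E ?A)) (carrier (relative_homology_group p ?E ?B))"
    by (subst bij_betw_comp_iff2) (auto simp only: comm bb)
  then show ?thesis
    by (simp add: iso_def hom_induced_hom)
qed

text \<open>For a contractible space the boundary map lowers the degree by one, and the punctured
  space is homotopy equivalent to the unit sphere, whose dimension is also one less than that of E.
  What is left is the top reduced homology of a sphere.\<close>

lemma integer_relative_homology_punctured:
  "relative_homology_group (int DIM('a)) (euclidean :: 'a::euclidean_space topology) (- {0}) \<cong> integer_group"
proof -
  let ?E = "euclidean :: 'a topology"
  have con: "contractible_space ?E"
    by (metis UNIV_I contractible_UNIV contractible_space_top_of_set subtopology_UNIV)
  obtain b :: 'a where b: "b \<in> Basis"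
    using nonempty_Basis by blast
  have "relative_homology_group (int DIM('a)) ?E (- {0}) \<cong> reduced_homology_group (int DIM('a) - 1) (top_of_set (- {0::'a}))"
    using isomorphic_group_relative_homology_of_contractible[OF con, of "- {0}"] b
    by force
  also have "\<dots> \<cong> reduced_homology_group (int DIM('a) - 1) (top_of_set (sphere (0::'a) 1))"
  proof (rule homotopy_equivalent_space_imp_isomorphic_reduced_homology_groups)
    have "sphere (0::'a) 1 homotopy_eqv (- {0::'a})"
      using homotopy_eqv_rel_frontier_punctured_affine_hull[of "cball (0::'a) 1" 0]
      by (simp add: Compl_eq_Diff_UNIV rel_frontier_nonempty_interior rel_interior_nonempty_interior affine_hull_nonempty_interior)
    then show "top_of_set (- {0::'a}) homotopy_equivalent_space top_of_set (sphere (0::'a) 1)"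
      by (subst homotopy_equivalent_space_sym)
  qed
  also have "\<dots> \<cong> reduced_homology_group (int DIM('a) - 1) (nsphere (DIM('a) - 1))"
  proof (rule homeomorphic_space_imp_isomorphic_reduced_homology_groups)
    obtain f :: "(nat \<Rightarrow> real) \<Rightarrow> 'a" and g where "homeomorphic_maps (nsphere(DIM('a) - 1)) (top_of_set (sphere 0 1 \<inter> span Basis)) f g"
      by (rule homeomorphic_maps_nsphere_euclidean_sphere[of "Basis :: 'a set" "DIM('a)"])
        (auto simp: independent_Basis orthogonal_Basis)
    then show "top_of_set (sphere (0::'a) 1) homeomorphic_space nsphere (DIM('a) - 1)"
      by (subst homeomorphic_space_sym) (auto simp: homeomorphic_space_def)
  qed
  also have "\<dots> \<cong> integer_group"
    using reduced_homology_group_nsphere(1)[of "DIM('a) - 1"] by (simp add: of_nat_diff)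
  finally show ?thesis .
qed

text \<open>A homomorphism out of an infinite cyclic group is fixed by its value at a generator,
  here the element \<open>a\<close> that \<open>i \<circ> j\<close> sends to 1; the exponent is the
  coordinate of \<open>\<theta> a\<close>. This is why the linear condition in the definition of the
  index singles out one integer.\<close>

lemma unique_multiple_infinite_cyclic:
  assumes H: "H \<cong> integer_group" "group G" "group H"
    and j: "j \<in> iso G H" and \<theta>: "\<theta> \<in> hom G H"
  shows "\<exists>!k::int. \<forall>z\<in>carrier G. \<theta> z = j z [^]\<^bsub>H\<^esub> k"
proof -
  interpret G: group G by fact
  interpret H: group H by fact
  interpret \<theta>: group_hom G H \<theta> by (simp add: group_hom_def group_hom_axioms_def assms)
  interpret j: group_hom G H j using j by (simp add: group_hom_def group_hom_axioms_def assms iso_def)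
  obtain i where i: "i \<in> iso H integer_group"
    using H(1) by (auto simp: is_iso_def)
  interpret i: group_hom H integer_group i
    using i by (simp add: group_hom_def group_hom_axioms_def assms iso_def)
  have bi: "bij_betw i (carrier H) UNIV" and bj: "bij_betw j (carrier G) (carrier H)"
    using i j by (auto simp: iso_def)
  have pw: "i (b [^]\<^bsub>H\<^esub> k) = k * i b" if "b \<in> carrier H" for b and k :: int
    unfolding i.hom_int_pow[OF that] by (rule group_int_pow_integer_group)
  have "1 \<in> i ` carrier H" "carrier H = j ` carrier G"
    using bi bj by (simp_all add: bij_betw_def)
  then obtain a where a: "a \<in> carrier G" "i (j a) = 1"
    by (metis imageE)
  have gen: "z = a [^]\<^bsub>G\<^esub> i (j z)" if "z \<in> carrier G" for z
  proof -
    have "i (j (a [^]\<^bsub>G\<^esub> i (j z))) = i (j z)"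
      using a that by (simp add: j.hom_int_pow pw)
    then have "j (a [^]\<^bsub>G\<^esub> i (j z)) = j z"
      by (rule inj_onD[OF bij_betw_imp_inj_on[OF bi]]) (use a that in auto)
    then show ?thesis
      by (rule inj_onD[OF bij_betw_imp_inj_on[OF bj], symmetric]) (use a that in auto)
  qed
  show ?thesis
  proof (rule ex1I[of _ "i (\<theta> a)"], intro ballI)
    fix z assume z: "z \<in> carrier G"
    have "i (\<theta> z) = i (j z) * i (\<theta> a)"
      by (subst gen[OF z]) (simp add: a \<theta>.hom_int_pow pw)
    then have "i (\<theta> z) = i (j z [^]\<^bsub>H\<^esub> i (\<theta> a))"
      using z by (simp add: pw)
    then show "\<theta> z = j z [^]\<^bsub>H\<^esub> i (\<theta> a)"
      by (rule inj_onD[OF bij_betw_imp_inj_on[OF bi]]) (use z in auto)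
  next
    fix k :: int assume "\<forall>z\<in>carrier G. \<theta> z = j z [^]\<^bsub>H\<^esub> k"
    then have "i (\<theta> a) = i (j a [^]\<^bsub>H\<^esub> k)"
      using a by auto
    then show "k = i (\<theta> a)"
      using a by (simp add: pw)
  qed
qed

text \<open>The homological condition of the index with the compact set and the radius as free
  parameters. Comparison along a homotopy needs one \<open>K\<close> that contains the fixed points
  of all stages, so \<open>K\<close> must be allowed to exceed the fixed point set of
  \<open>g\<close>.\<close>

definition fp_degree :: "'a::euclidean_space set \<Rightarrow> 'a set \<Rightarrow> real \<Rightarrow> ('a \<Rightarrow> 'a) \<Rightarrow> int \<Rightarrow> bool" where
  "fp_degree V K r g k \<longleftrightarrow>
     (\<forall>z \<in> carrier (relative_homology_group (int DIM('a)) (euclidean :: 'a topology) (- cball 0 r)).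
        \<exists>w \<in> carrier (relative_homology_group (int DIM('a)) (top_of_set V) (V - K)).
          hom_induced (int DIM('a)) (top_of_set V) (V - K) euclidean (- K) id w =
            hom_induced (int DIM('a)) euclidean (- cball 0 r) euclidean (- K) id z \<and>
          hom_induced (int DIM('a)) (top_of_set V) (V - K) euclidean (- {0}) (\<lambda>x. x - g x) w =
            hom_induced (int DIM('a)) euclidean (- cball 0 r) euclidean (- {0}) id z
              [^]\<^bsub>relative_homology_group (int DIM('a)) (euclidean :: 'a topology) (- {0})\<^esub> k)"

lemma has_euclidean_fixed_point_index_alt:
  fixes V :: "'a::euclidean_space set"
  shows "has_euclidean_fixed_point_index V g k \<longleftrightarrow>
     open V \<and> continuous_on V g \<and> compact {x \<in> V. g x = x} \<and>
       (\<exists>r>0. {x \<in> V. g x = x} \<subseteq> cball 0 r \<and> fp_degree V {x \<in> V. g x = x} r g k)"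
  by (simp add: has_euclidean_fixed_point_index_def fp_degree_def Let_def)

lemma iso_excision_compact:
  fixes V :: "'a::euclidean_space set"
  assumes "open V" "compact K" "K \<subseteq> V"
  shows "hom_induced p (top_of_set V) (V - K) euclidean (- K) id
    \<in> iso (relative_homology_group p (top_of_set V) (V - K)) (relative_homology_group p (euclidean :: 'a topology) (- K))"
proof -
  have "closure (- V) \<subseteq> interior (- K)"
    using assms(3) interior_open[OF open_Compl[OF compact_imp_closed[OF assms(2)]]] closure_closed[OF closed_Compl[OF assms(1)]]
    by auto
  then show ?thesis
    using homology_excision_axiom[of euclidean "- V" "- K" UNIV p] assms(3)
    by (simp add: Compl_eq_Diff_UNIV[symmetric] Diff_eq Int_commute)
qed

text \<open>Excision is an isomorphism, so only one \<open>w\<close> can occur in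
  \<open>fp_degree\<close>, and the existential collapses to an equation between homomorphisms on an
  infinite cyclic group.\<close>

lemma fp_degree_ex1:
  fixes V :: "'a::euclidean_space set"
  assumes V: "open V" "compact K" "K \<subseteq> V" and r: "r > 0" "K \<subseteq> cball 0 r"
    and g: "continuous_on V g" "\<And>x. x \<in> V \<Longrightarrow> g x = x \<Longrightarrow> x \<in> K"
  shows "\<exists>!k. fp_degree V K r g k"
proof -
  let ?N = "int DIM('a)" and ?E = "euclidean :: 'a topology"
  let ?A = "relative_homology_group ?N ?E (- cball 0 r)"
  let ?B = "relative_homology_group ?N ?E (- K)"
  let ?W = "relative_homology_group ?N (top_of_set V) (V - K)"
  let ?H = "relative_homology_group ?N ?E (- {0})"
  let ?e = "hom_induced ?N (top_of_set V) (V - K) ?E (- K) id"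
  let ?l = "hom_induced ?N ?E (- cball 0 r) ?E (- K) id"
  let ?d = "hom_induced ?N (top_of_set V) (V - K) ?E (- {0}) (\<lambda>x. x - g x)"
  let ?j = "hom_induced ?N ?E (- cball 0 r) ?E (- {0}) id"
  have e: "?e \<in> iso ?W ?B"
    by (rule iso_excision_compact[OF V])
  then have be: "bij_betw ?e (carrier ?W) (carrier ?B)"
    by (simp add: iso_def)
  define \<theta> where "\<theta> = ?d \<circ> (inv_into (carrier ?W) ?e \<circ> ?l)"
  have "inv_into (carrier ?W) ?e \<in> iso ?B ?W"
    using e group.iso_set_sym group_relative_homology_group by blast
  then have \<theta>: "\<theta> \<in> hom ?A ?H"
    unfolding \<theta>_def by (intro hom_compose[where H="?W"] hom_compose[where H="?B"]) (auto simp: iso_def hom_induced_hom)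
  have "fp_degree V K r g k \<longleftrightarrow> (\<forall>z\<in>carrier ?A. \<theta> z = ?j z [^]\<^bsub>?H\<^esub> k)" for k
    unfolding fp_degree_def
  proof (intro ball_cong refl)
    fix z assume "z \<in> carrier ?A"
    have lz: "?l z \<in> carrier ?B"
      by (rule hom_induced_carrier)
    define w0 where "w0 = inv_into (carrier ?W) ?e (?l z)"
    have w0: "w0 \<in> carrier ?W" "?e w0 = ?l z"
      using lz bij_betw_imp_surj_on[OF be] by (simp_all add: w0_def inv_into_into f_inv_into_f)
    have "w = w0" if "w \<in> carrier ?W" "?e w = ?l z" for w
      by (rule inj_onD[OF bij_betw_imp_inj_on[OF be]]) (simp_all only: that w0)
    then have "(\<exists>w\<in>carrier ?W. ?e w = ?l z \<and> ?d w = x) \<longleftrightarrow> ?d w0 = x" for x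
      using w0 by blast
    then show "(\<exists>w\<in>carrier ?W. ?e w = ?l z \<and> ?d w = ?j z [^]\<^bsub>?H\<^esub> k) \<longleftrightarrow> \<theta> z = ?j z [^]\<^bsub>?H\<^esub> k"
      by (simp only: \<theta>_def w0_def o_def)
  qed
  then show ?thesis
    by (simp only:) (rule unique_multiple_infinite_cyclic[OF integer_relative_homology_punctured
          group_relative_homology_group group_relative_homology_group iso_inclusion_punctured[OF r(1)] \<theta>])
qed

text \<open>Pure naturality: send \<open>z'\<close> to the complement of the smaller ball, take the
  \<open>w\<close> given there, and push it forward along the inclusion of pairs. This covers a
  larger domain, a smaller compact set and a larger ball at once; shrinking the domain is left to
  existence and uniqueness.\<close>

lemma fp_degree_transfer:
  fixes V :: "'a::euclidean_space set"
  assumes deg: "fp_degree V' K' r g' k"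
    and sub: "V' \<subseteq> V" "K \<subseteq> K'" "K' \<subseteq> cball 0 r" "0 < r" "r \<le> r'"
    and g: "continuous_on V g" "\<And>x. x \<in> V \<Longrightarrow> g x = x \<Longrightarrow> x \<in> K"
    and eq: "\<And>x. x \<in> V' \<Longrightarrow> g x = g' x"
  shows "fp_degree V K r' g k"
  unfolding fp_degree_def
proof
  let ?N = "int DIM('a)" and ?E = "euclidean :: 'a topology"
  let ?H = "relative_homology_group ?N ?E (- {0})"
  fix z' assume "z' \<in> carrier (relative_homology_group ?N ?E (- cball 0 r'))"
  let ?z = "hom_induced ?N ?E (- cball 0 r') ?E (- cball 0 r) id z'"
  obtain w where w: "w \<in> carrier (relative_homology_group ?N (top_of_set V') (V' - K'))"
      "hom_induced ?N (top_of_set V') (V' - K') ?E (- K') id w = hom_induced ?N ?E (- cball 0 r) ?E (- K') id ?z"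
      "hom_induced ?N (top_of_set V') (V' - K') ?E (- {0}) (\<lambda>x. x - g' x) w
        = hom_induced ?N ?E (- cball 0 r) ?E (- {0}) id ?z [^]\<^bsub>?H\<^esub> k"
    using bspec[OF deg[unfolded fp_degree_def] hom_induced_carrier[of ?N ?E "- cball 0 r'" ?E "- cball 0 r" id z']]
    by blast
  let ?w = "hom_induced ?N (top_of_set V') (V' - K') (top_of_set V) (V - K) id w"
  have rr: "id \<in> - cball (0::'a) r' \<rightarrow> - cball 0 r" "id \<in> - cball 0 r \<rightarrow> - K'" "id \<in> - cball (0::'a) r \<rightarrow> - {0}"
      "id \<in> - K' \<rightarrow> - K" "id \<in> V' - K' \<rightarrow> V - K" "id \<in> V' - K' \<rightarrow> - K'" "id \<in> V - K \<rightarrow> - K" "id \<in> - cball 0 r \<rightarrow> - K"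
    and c: "continuous_map (top_of_set V') ?E id" "continuous_map (top_of_set V) ?E id"
      "continuous_map (top_of_set V') (top_of_set V) id"
    using sub by (auto simp: continuous_on_id)
  have gg: "(\<lambda>x. x - g x) \<in> V - K \<rightarrow> - {0}" and cg: "continuous_map (top_of_set V) ?E (\<lambda>x. x - g x)"
    using g by (auto intro!: continuous_intros)
  show "\<exists>w\<in>carrier (relative_homology_group ?N (top_of_set V) (V - K)).
      hom_induced ?N (top_of_set V) (V - K) ?E (- K) id w = hom_induced ?N ?E (- cball 0 r') ?E (- K) id z' \<and>
      hom_induced ?N (top_of_set V) (V - K) ?E (- {0}) (\<lambda>x. x - g x) w
        = hom_induced ?N ?E (- cball 0 r') ?E (- {0}) id z' [^]\<^bsub>?H\<^esub> k"
  proof (intro bexI[of _ ?w] conjI)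
    have "hom_induced ?N (top_of_set V) (V - K) ?E (- K) id ?w
        = hom_induced ?N (top_of_set V') (V' - K') ?E (- K) id w"
      using hom_induced_compose'[OF c(3) rr(5) c(2) rr(7)] by simp
    also have "\<dots> = hom_induced ?N ?E (- K') ?E (- K) id (hom_induced ?N (top_of_set V') (V' - K') ?E (- K') id w)"
      using hom_induced_compose'[OF c(1) rr(6) continuous_map_id rr(4)] by simp
    also have "\<dots> = hom_induced ?N ?E (- cball 0 r) ?E (- K) id ?z"
      unfolding w(2) using hom_induced_compose'[OF continuous_map_id rr(2) continuous_map_id rr(4)] by simp
    also have "\<dots> = hom_induced ?N ?E (- cball 0 r') ?E (- K) id z'"
      using hom_induced_compose'[OF continuous_map_id rr(1) continuous_map_id rr(8)] by simp
    finally show "hom_induced ?N (top_of_set V) (V - K) ?E (- K) id ?w = hom_induced ?N ?E (- cball 0 r') ?E (- K) id z'" .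
    have "hom_induced ?N (top_of_set V) (V - K) ?E (- {0}) (\<lambda>x. x - g x) ?w
        = hom_induced ?N (top_of_set V') (V' - K') ?E (- {0}) (\<lambda>x. x - g x) w"
      using hom_induced_compose'[OF c(3) rr(5) cg gg] by simp
    also have "\<dots> = hom_induced ?N (top_of_set V') (V' - K') ?E (- {0}) (\<lambda>x. x - g' x) w"
      by (rule fun_cong[OF hom_induced_eq]) (simp add: eq)
    also have "\<dots> = hom_induced ?N ?E (- cball 0 r') ?E (- {0}) id z' [^]\<^bsub>?H\<^esub> k"
      unfolding w(3) using hom_induced_compose'[OF continuous_map_id rr(1) continuous_map_id rr(3)] by simp
    finally show "hom_induced ?N (top_of_set V) (V - K) ?E (- {0}) (\<lambda>x. x - g x) ?w
        = hom_induced ?N ?E (- cball 0 r') ?E (- {0}) id z' [^]\<^bsub>?H\<^esub> k" .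
  qed (rule hom_induced_carrier)
qed

text \<open>Since \<open>K\<close> contains the fixed points of every stage, x - G (t, x) is a
  homotopy of maps of pairs from (V, V - K) to (E, E - 0), and its two ends induce the same map in
  homology.\<close>

lemma fp_degree_homotopic:
  fixes V :: "'a::euclidean_space set"
  assumes deg: "fp_degree V K r (\<lambda>x. G (0, x)) k"
    and G: "continuous_on ({0..1::real} \<times> V) G"
    and K: "\<And>t x. t \<in> {0..1} \<Longrightarrow> x \<in> V \<Longrightarrow> G (t, x) = x \<Longrightarrow> x \<in> K"
  shows "fp_degree V K r (\<lambda>x. G (1, x)) k"
proof -
  have "homotopic_with (\<lambda>h. h \<in> V - K \<rightarrow> - {0}) (top_of_set V) euclidean (\<lambda>x. x - G (0, x)) (\<lambda>x. x - G (1, x))"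
    unfolding homotopic_with_def
  proof (intro exI conjI allI ballI)
    have "continuous_on ({0..1} \<times> V) (\<lambda>z. snd z - G z)"
      by (intro continuous_intros G)
    then show "continuous_map (prod_topology (top_of_set {0..1}) (top_of_set V)) euclidean (\<lambda>z. snd z - G z)"
      by (simp add: flip: subtopology_Times euclidean_product_topology)
  qed (use K in auto)
  then have "hom_induced p (top_of_set V) (V - K) euclidean (- {0}) (\<lambda>x. x - G (0, x))
      = hom_induced p (top_of_set V) (V - K) euclidean (- {0}) (\<lambda>x. x - G (1, x))" for p
    by (rule homology_homotopy_axiom)
  then show ?thesis
    using deg by (simp add: fp_degree_def)
qed

section \<open>Uniqueness, locality and homotopy invariance of the Euclidean index\<close>

lemma has_euclidean_fixed_point_index_unique:
  fixes V :: "'a::euclidean_space set"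
  assumes "has_euclidean_fixed_point_index V g k" "has_euclidean_fixed_point_index V g k'"
  shows "k = k'"
proof -
  let ?K = "{x \<in> V. g x = x}"
  have V: "open V" "continuous_on V g" "compact ?K"
    using assms by (auto simp: has_euclidean_fixed_point_index_alt)
  obtain r r' where r: "r > 0" "?K \<subseteq> cball 0 r" "fp_degree V ?K r g k"
    and r': "r' > 0" "?K \<subseteq> cball 0 r'" "fp_degree V ?K r' g k'"
    using assms unfolding has_euclidean_fixed_point_index_alt by blast
  \<comment> \<open>Both degrees are moved to the larger of the two balls, where only one integer
    qualifies.\<close>
  have "fp_degree V ?K (max r r') g k" "fp_degree V ?K (max r r') g k'"
    by (rule fp_degree_transfer[OF r(3)], use r V in auto) (rule fp_degree_transfer[OF r'(3)], use r' V in auto)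
  moreover have "\<exists>!k. fp_degree V ?K (max r r') g k"
    using V r by (intro fp_degree_ex1) auto
  ultimately show ?thesis by blast
qed

lemma has_euclidean_fixed_point_index_exists:
  fixes V :: "'a::euclidean_space set"
  assumes V: "open V" "continuous_on V g" "compact {x \<in> V. g x = x}"
  shows "\<exists>k. has_euclidean_fixed_point_index V g k"
proof -
  let ?K = "{x \<in> V. g x = x}"
  obtain r where r: "r > 0" "?K \<subseteq> cball 0 r"
    using compact_imp_bounded[OF V(3)] bounded_subset_ballD[of ?K 0] ball_subset_cball[of 0] by blast
  then have "\<exists>!k. fp_degree V ?K r g k"
    using V by (intro fp_degree_ex1) auto
  then show ?thesis
    using V r unfolding has_euclidean_fixed_point_index_alt by blast
qed

lemma has_euclidean_fixed_point_index_extend: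
  fixes V :: "'a::euclidean_space set"
  assumes i: "has_euclidean_fixed_point_index V' g' k"
    and V: "open V" "V' \<subseteq> V" "continuous_on V g"
    and g: "\<And>x. x \<in> V' \<Longrightarrow> g x = g' x" "\<And>x. x \<in> V \<Longrightarrow> g x = x \<Longrightarrow> x \<in> V'"
  shows "has_euclidean_fixed_point_index V g k"
proof -
  have K: "{x \<in> V. g x = x} = {x \<in> V'. g' x = x}"
    by (intro Collect_cong) (metis V(2) g subsetD)
  obtain r where r: "r > 0" "{x \<in> V'. g' x = x} \<subseteq> cball 0 r" "fp_degree V' {x \<in> V'. g' x = x} r g' k"
    using i unfolding has_euclidean_fixed_point_index_alt by blast
  have fx: "x \<in> {x \<in> V'. g' x = x}" if "x \<in> V" "g x = x" for x
    using K that by blast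
  have "fp_degree V {x \<in> V'. g' x = x} r g k"
    by (rule fp_degree_transfer[OF r(3)]) (use r V g(1) fx in auto)
  then show ?thesis
    using r V i unfolding has_euclidean_fixed_point_index_alt K by blast
qed

text \<open>Inclusions carry degrees only to larger domains. The small domain has some index
  \<open>k'\<close> by existence; extending it gives \<open>k'\<close> on the large domain, where
  uniqueness forces \<open>k' = k\<close>.\<close>

lemma has_euclidean_fixed_point_index_restrict:
  fixes V :: "'a::euclidean_space set"
  assumes i: "has_euclidean_fixed_point_index V g k"
    and V: "open V'" "V' \<subseteq> V"
    and g: "\<And>x. x \<in> V' \<Longrightarrow> g x = g' x" "\<And>x. x \<in> V \<Longrightarrow> g x = x \<Longrightarrow> x \<in> V'"
  shows "has_euclidean_fixed_point_index V' g' k"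
proof -
  have "continuous_on V' g'"
    using i V g continuous_on_subset[of V g V'] unfolding has_euclidean_fixed_point_index_alt
    by (simp cong: continuous_on_cong)
  moreover have "{x \<in> V'. g' x = x} = {x \<in> V. g x = x}"
    by (intro Collect_cong) (metis V(2) g subsetD)
  ultimately obtain k' where k': "has_euclidean_fixed_point_index V' g' k'"
    using has_euclidean_fixed_point_index_exists[of V' g'] i V unfolding has_euclidean_fixed_point_index_alt by auto
  then have "has_euclidean_fixed_point_index V g k'"
    by (rule has_euclidean_fixed_point_index_extend) (use i V g in \<open>auto simp: has_euclidean_fixed_point_index_alt\<close>)
  then show ?thesis
    using has_euclidean_fixed_point_index_unique[OF i] k' by simp
qed

lemma has_euclidean_fixed_point_index_homotopic:
  fixes V :: "'a::euclidean_space set"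
  assumes V: "open V" and G: "continuous_on ({0..1::real} \<times> V) G"
    and K: "compact {x \<in> V. \<exists>t\<in>{0..1}. G (t, x) = x}"
    and i: "has_euclidean_fixed_point_index V (\<lambda>x. G (0, x)) k"
  shows "has_euclidean_fixed_point_index V (\<lambda>x. G (1, x)) k"
proof -
  let ?K = "{x \<in> V. \<exists>t\<in>{0..1}. G (t, x) = x}"
  have G': "continuous_on V (\<lambda>x. G (t, x))" if "t \<in> {0..1}" for t
    by (rule continuous_on_compose2[OF G]) (use that in \<open>auto intro!: continuous_intros\<close>)
  have cK: "compact {x \<in> V. G (t, x) = x}" if "t \<in> {0..1}" for t
  proof -
    have "closedin (top_of_set ?K) {x \<in> ?K. G (t, x) - x = 0}"
      by (intro continuous_closedin_preimage_constant continuous_intros continuous_on_subset[OF G'[OF that]]) auto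
    moreover have "{x \<in> ?K. G (t, x) - x = 0} = {x \<in> V. G (t, x) = x}"
      using that by auto
    ultimately show ?thesis
      by (intro closedin_compact[OF K]) simp
  qed
  obtain r where r: "r > 0" "?K \<subseteq> cball 0 r"
    using compact_imp_bounded[OF K] bounded_subset_ballD[of ?K 0] ball_subset_cball[of 0] by blast
  have 01: "0 \<in> {0..1::real}" "1 \<in> {0..1::real}" by auto
  have "\<exists>!k. fp_degree V ?K r (\<lambda>x. G (0, x)) k"
    using V K r G'[OF 01(1)] 01 by (intro fp_degree_ex1) auto
  then obtain k' where k': "fp_degree V ?K r (\<lambda>x. G (0, x)) k'"
    by blast
  have k'': "fp_degree V ?K r (\<lambda>x. G (1, x)) k'"
    by (rule fp_degree_homotopic[OF k' G]) auto
  \<comment> \<open>Shrinks the common set \<open>?K\<close> to the fixed points of a single stage,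
    as the definition of the index demands.\<close>
  have "fp_degree V {x \<in> V. G (t, x) = x} r (\<lambda>x. G (t, x)) k'"
    if "fp_degree V ?K r (\<lambda>x. G (t, x)) k'" "t \<in> {0..1}" for t
    by (rule fp_degree_transfer[OF that(1)]) (use that(2) r G'[OF that(2)] in auto)
  then have "has_euclidean_fixed_point_index V (\<lambda>x. G (t, x)) k'"
    if "fp_degree V ?K r (\<lambda>x. G (t, x)) k'" "t \<in> {0..1}" for t
    using that V r cK[OF that(2)] G'[OF that(2)] unfolding has_euclidean_fixed_point_index_alt by blast
  then have "has_euclidean_fixed_point_index V (\<lambda>x. G (0, x)) k'" "has_euclidean_fixed_point_index V (\<lambda>x. G (1, x)) k'"
    using k' k'' 01 by blast+
  with i show ?thesis
    using has_euclidean_fixed_point_index_unique by blast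
qed

text \<open>Relative homology of E modulo itself is trivial, so the neutral element serves as
  \<open>w\<close> for every class, and the exponent 0 fits. Any positive radius would do.\<close>

lemma has_euclidean_fixed_point_index_empty:
  fixes V :: "'a::euclidean_space set"
  assumes "open V" "continuous_on V g" "\<And>x. x \<in> V \<Longrightarrow> g x \<noteq> x"
  shows "has_euclidean_fixed_point_index V g 0"
proof -
  let ?N = "int DIM('a)" and ?E = "euclidean :: 'a topology"
  have K: "{x \<in> V. g x = x} = {}"
    using assms by auto
  have "trivial_group (relative_homology_group ?N ?E (- {}))"
    using trivial_relative_homology_group_topspace[of ?N ?E] by simp
  then have tw: "x = y" if "x \<in> carrier (relative_homology_group ?N ?E (- {}))"
      "y \<in> carrier (relative_homology_group ?N ?E (- {}))" for x y
    using that unfolding trivial_group_def by blast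
  have "fp_degree V {} 1 g 0"
    unfolding fp_degree_def
  proof
    fix z assume "z \<in> carrier (relative_homology_group ?N ?E (- cball 0 1))"
    let ?W = "relative_homology_group ?N (top_of_set V) (V - {})"
    show "\<exists>w\<in>carrier ?W.
          hom_induced ?N (top_of_set V) (V - {}) ?E (- {}) id w = hom_induced ?N ?E (- cball 0 1) ?E (- {}) id z \<and>
          hom_induced ?N (top_of_set V) (V - {}) ?E (- {0}) (\<lambda>x. x - g x) w =
          hom_induced ?N ?E (- cball 0 1) ?E (- {0}) id z [^]\<^bsub>relative_homology_group ?N ?E (- {0})\<^esub> (0::int)"
    proof (intro bexI conjI)
      show one: "\<one>\<^bsub>?W\<^esub> \<in> carrier ?W"
        using group.is_monoid[OF group_relative_homology_group] by (rule monoid.one_closed)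
      show "hom_induced ?N (top_of_set V) (V - {}) ?E (- {}) id \<one>\<^bsub>?W\<^esub> = hom_induced ?N ?E (- cball 0 1) ?E (- {}) id z"
        by (intro tw hom_induced_carrier)
      show "hom_induced ?N (top_of_set V) (V - {}) ?E (- {0}) (\<lambda>x. x - g x) \<one>\<^bsub>?W\<^esub> =
          hom_induced ?N ?E (- cball 0 1) ?E (- {0}) id z [^]\<^bsub>relative_homology_group ?N ?E (- {0})\<^esub> (0::int)"
        by (simp only: int_pow_0 hom_one[OF hom_induced_hom group_relative_homology_group group_relative_homology_group])
    qed
  qed
  with assms show ?thesis
    unfolding has_euclidean_fixed_point_index_alt K by (auto intro: exI[of _ 1])
qed

text \<open>Homotopy invariance when the domain moves with the time. Compactness of the set of all
  fixed pairs makes the index locally constant in t, and [0,1] is connected.\<close>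

lemma has_euclidean_fixed_point_index_slices:
  fixes G :: "'a::euclidean_space \<times> real \<Rightarrow> 'a"
  assumes Q: "open Q" and G: "continuous_on (Q \<inter> UNIV \<times> {0..1}) G"
    and K: "compact {z \<in> Q \<inter> UNIV \<times> {0..1}. G z = fst z}"
    and i: "has_euclidean_fixed_point_index {x. (x, 0) \<in> Q} (\<lambda>x. G (x, 0)) k"
  shows "has_euclidean_fixed_point_index {x. (x, 1) \<in> Q} (\<lambda>x. G (x, 1)) k"
proof -
  define \<K> where "\<K> = {z \<in> Q \<inter> UNIV \<times> {0..1}. G z = fst z}"
  have cK: "compact \<K>"
    using K by (simp add: \<K>_def)
  have \<K>: "(x, t) \<in> \<K> \<longleftrightarrow> (x, t) \<in> Q \<and> t \<in> {0..1} \<and> G (x, t) = x" for x t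
    by (auto simp: \<K>_def)
  let ?P = "\<lambda>t. has_euclidean_fixed_point_index {x. (x, t) \<in> Q} (\<lambda>x. G (x, t))"
  have slice_open: "open {x. (x, t) \<in> Q}" for t
  proof -
    have "open ((\<lambda>x. (x, t)) -` Q)"
      by (rule open_vimage[OF Q]) (intro continuous_intros)
    then show ?thesis by (simp add: vimage_def)
  qed
  have slice_cont: "continuous_on A (\<lambda>x. G (x, t))" if "t \<in> {0..1}" "A \<subseteq> {x. (x, t) \<in> Q}" for t A
    by (rule continuous_on_compose2[OF G]) (use that in \<open>auto intro!: continuous_intros\<close>)
  have slice_compact: "compact {x. (x, t) \<in> \<K>}" for t
  proof -
    have "{x. (x, t) \<in> \<K>} = fst ` (\<K> \<inter> UNIV \<times> {t})"
      by force
    moreover have "compact (\<K> \<inter> UNIV \<times> {t})"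
      by (intro compact_Int_closed cK closed_Times closed_UNIV closed_singleton)
    ultimately show ?thesis
      by (simp add: compact_continuous_image continuous_on_fst)
  qed
  have slice_exists: "\<exists>k. ?P t k" if "t \<in> {0..1}" for t
  proof (rule has_euclidean_fixed_point_index_exists[OF slice_open slice_cont[OF that order_refl]])
    show "compact {x \<in> {x. (x, t) \<in> Q}. G (x, t) = x}"
      using slice_compact[of t] that by (simp add: \<K>)
  qed
  \<comment> \<open>Around the time t the fixed pairs sit in a product of \<open>W\<close> and an
    interval inside \<open>Q\<close>. The index passes from the slice at t to \<open>W\<close> by
    restriction, along a straight path of times by homotopy, and to the slice at s by
    extension.\<close>
  have local: "\<exists>\<delta>>0. \<forall>s\<in>{0..1}. \<bar>s - t\<bar> < \<delta> \<longrightarrow> (\<forall>k. ?P t k \<longrightarrow> ?P s k)" if t: "t \<in> {0..1}" for t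
  proof -
    let ?Kt = "{x. (x, t) \<in> \<K>}"
    have "compact (?Kt \<times> {t})"
      by (intro compact_Times slice_compact compact_sing)
    moreover have "?Kt \<times> {t} \<subseteq> Q"
      by (auto simp: \<K>)
    ultimately obtain \<epsilon> where \<epsilon>: "\<epsilon> > 0" "(\<Union>z\<in>?Kt \<times> {t}. ball z \<epsilon>) \<subseteq> Q"
      using compact_subset_open_imp_ball_epsilon_subset[OF _ Q] by metis
    \<comment> \<open>Half of \<epsilon> is spent on the space coordinate and half on the time
      coordinate, so the two distances together stay below \<epsilon> and the pair remains in
      \<open>Q\<close>.\<close>
    define W where "W = (\<Union>x\<in>?Kt. ball x (\<epsilon> / 2))"
    have oW: "open W"
      by (auto simp: W_def)
    have KW: "x \<in> W" if "(x, t) \<in> \<K>" for x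
      using that \<epsilon>(1) by (auto simp: W_def intro!: bexI[of _ x])
    have WO: "(x, s) \<in> Q" if x: "x \<in> W" and s: "\<bar>s - t\<bar> < \<epsilon> / 2" for x s
    proof -
      obtain c where c: "(c, t) \<in> \<K>" "dist c x < \<epsilon> / 2"
        using x by (auto simp: W_def)
      have "dist (c, t) (x, s) \<le> dist c x + dist t s"
        unfolding dist_Pair_Pair by (rule sqrt_sum_squares_le_sum) auto
      also have "\<dots> < \<epsilon>"
      proof -
        have "dist t s < \<epsilon> / 2"
          using s by (simp add: dist_real_def abs_minus_commute)
        with c(2) show ?thesis by simp
      qed
      finally show ?thesis
        using \<epsilon>(2) c(1) by (intro subsetD[OF \<epsilon>(2)]) auto
    qed
    \<comment> \<open>Tube argument: the times of fixed pairs outside \<open>W\<close> form a closed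
      set that misses t, hence misses a whole interval about t.\<close>
    have "compact (snd ` (\<K> - W \<times> UNIV))"
      by (intro compact_continuous_image compact_diff cK open_Times oW open_UNIV continuous_on_snd continuous_on_id)
    moreover have "t \<notin> snd ` (\<K> - W \<times> UNIV)"
      using KW by auto
    ultimately obtain \<delta> where \<delta>: "\<delta> > 0" "ball t \<delta> \<subseteq> - snd ` (\<K> - W \<times> UNIV)"
      using open_contains_ball[of "- snd ` (\<K> - W \<times> UNIV)"] compact_imp_closed by blast
    have \<delta>W: "x \<in> W" if "(x, s) \<in> \<K>" "\<bar>s - t\<bar> < \<delta>" for x s
    proof (rule ccontr)
      assume "x \<notin> W"
      with that have "s \<in> snd ` (\<K> - W \<times> UNIV)"
        by (force simp: image_iff)
      moreover have "s \<in> ball t \<delta>"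
        using that(2) by (simp add: dist_real_def abs_minus_commute)
      ultimately show False
        using \<delta>(2) by blast
    qed
    show ?thesis
    proof (intro exI[of _ "min \<delta> (\<epsilon> / 2)"] conjI ballI impI allI)
      fix s k assume s: "s \<in> {0..1}" "\<bar>s - t\<bar> < min \<delta> (\<epsilon> / 2)" and k: "?P t k"
      let ?u = "\<lambda>\<tau>. t + \<tau> * (s - t)"
      have u: "?u \<tau> \<in> {0..1}" "\<bar>?u \<tau> - t\<bar> < min \<delta> (\<epsilon> / 2)" if "\<tau> \<in> {0..1}" for \<tau>
      proof -
        have "?u \<tau> = (1 - \<tau>) *\<^sub>R t + \<tau> *\<^sub>R s"
          by (simp add: algebra_simps)
        then show "?u \<tau> \<in> {0..1}"
          using convexD_alt[OF convex_real_interval(5)[of 0 1] t s(1), of \<tau>] that by auto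
        have "\<bar>?u \<tau> - t\<bar> \<le> \<bar>s - t\<bar>"
          using that by (simp add: abs_mult mult_left_le_one_le)
        then show "\<bar>?u \<tau> - t\<bar> < min \<delta> (\<epsilon> / 2)"
          using s(2) by linarith
      qed
      define H where "H = (\<lambda>(\<tau>, x). G (x, ?u \<tau>))"
      have Ws: "W \<subseteq> {x. (x, s) \<in> Q}" "W \<subseteq> {x. (x, t) \<in> Q}"
        using WO s \<epsilon>(1) by auto
      have "has_euclidean_fixed_point_index W (\<lambda>x. H (0, x)) k"
        by (rule has_euclidean_fixed_point_index_restrict[OF k oW Ws(2)])
          (use t KW in \<open>auto simp: H_def \<K>\<close>)
      then have "has_euclidean_fixed_point_index W (\<lambda>x. H (1, x)) k"
      proof (rule has_euclidean_fixed_point_index_homotopic[OF oW, rotated -1])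
        show "continuous_on ({0..1} \<times> W) H"
          unfolding H_def case_prod_unfold
          by (rule continuous_on_compose2[OF G]) (use u WO in \<open>force intro!: continuous_intros\<close>)+
        \<comment> \<open>The fixed points met on the way are the projection of the part of the
          compact set \<open>\<K>\<close> that lies over the times between t and s.\<close>
        have "{x \<in> W. \<exists>\<tau>\<in>{0..1}. H (\<tau>, x) = x} = fst ` (\<K> \<inter> UNIV \<times> closed_segment t s)"
        proof (intro equalityI subsetI)
          fix x assume "x \<in> {x \<in> W. \<exists>\<tau>\<in>{0..1}. H (\<tau>, x) = x}"
          then obtain \<tau> where \<tau>: "x \<in> W" "\<tau> \<in> {0..1}" "G (x, ?u \<tau>) = x"
            by (auto simp: H_def)
          then have "(x, ?u \<tau>) \<in> \<K>"
            using u[OF \<tau>(2)] WO by (auto simp: \<K>)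
          moreover have "?u \<tau> \<in> closed_segment t s"
            using \<tau>(2) by (auto simp: closed_segment_def algebra_simps intro!: exI[of _ \<tau>])
          ultimately show "x \<in> fst ` (\<K> \<inter> UNIV \<times> closed_segment t s)"
            by force
        next
          fix x assume "x \<in> fst ` (\<K> \<inter> UNIV \<times> closed_segment t s)"
          then obtain v where v: "(x, v) \<in> \<K>" "v \<in> closed_segment t s"
            by auto
          then obtain \<tau> where \<tau>: "\<tau> \<in> {0..1}" "v = ?u \<tau>"
            by (auto simp: closed_segment_def algebra_simps)
          have "x \<in> W"
            using \<delta>W[OF v(1)] u[OF \<tau>(1)] \<tau>(2) by auto
          then show "x \<in> {x \<in> W. \<exists>\<tau>\<in>{0..1}. H (\<tau>, x) = x}"
            using \<tau> v(1) by (auto simp: H_def \<K>)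
        qed
        moreover have "compact (fst ` (\<K> \<inter> UNIV \<times> closed_segment t s))"
          by (intro compact_continuous_image compact_Int_closed cK closed_Times closed_UNIV closed_segment
              continuous_on_fst continuous_on_id)
        ultimately show "compact {x \<in> W. \<exists>\<tau>\<in>{0..1}. H (\<tau>, x) = x}"
          by simp
      qed
      then show "?P s k"
        by (rule has_euclidean_fixed_point_index_extend[OF _ slice_open Ws(1) slice_cont[OF s(1) order_refl]])
          (use s \<delta>W in \<open>auto simp: H_def \<K>\<close>)
    qed (use \<delta>(1) \<epsilon>(1) in auto)
  qed
  have "?P 1 k"
  proof (rule connected_induction_simple[of "{0..1::real}" 0 1 "\<lambda>t. ?P t k"])
    fix t :: real assume t: "t \<in> {0..1}"
    obtain \<delta> where \<delta>: "\<delta> > 0" "\<And>s k. s \<in> {0..1} \<Longrightarrow> \<bar>s - t\<bar> < \<delta> \<Longrightarrow> ?P t k \<Longrightarrow> ?P s k"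
      using local[OF t] by blast
    \<comment> \<open>The fact \<open>local\<close> only carries indices away from t. For the
      converse, an index at t exists, is carried to s, and agrees there by uniqueness.\<close>
    have iff: "?P s k \<longleftrightarrow> ?P t k" if "s \<in> {0..1}" "\<bar>s - t\<bar> < \<delta>" for s k
      using \<delta>(2)[OF that] slice_exists[OF t] has_euclidean_fixed_point_index_unique by metis
    show "\<exists>T. openin (top_of_set {0..1}) T \<and> t \<in> T \<and> (\<forall>x\<in>T. \<forall>y\<in>T. ?P x k \<longrightarrow> ?P y k)"
    proof (intro exI[of _ "{0..1} \<inter> ball t \<delta>"] conjI ballI impI)
      fix x y assume "x \<in> {0..1} \<inter> ball t \<delta>" "y \<in> {0..1} \<inter> ball t \<delta>" "?P x k"
      then show "?P y k"
        using iff[of x k] iff[of y k] by (auto simp: dist_real_def abs_minus_commute)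
    qed (use t \<delta>(1) in auto)
  qed (use i in auto)
  then show ?thesis .
qed

section \<open>The fixed point index of Euclidean neighbourhood retracts\<close>

text \<open>A fixed point of \<open>\<phi> \<circ> \<rho>\<close> lies in X because \<phi> has its
  values there, and on X the retraction is the identity; so precomposition creates no fixed
  points.\<close>

lemma has_fixed_point_index_euclidean:
  fixes X :: "'a::euclidean_space set"
  assumes U: "open U" "retraction U X \<rho>"
    and W: "openin (top_of_set X) W" "continuous_on W \<phi>" "\<phi> ` W \<subseteq> X"
  shows "open (U \<inter> \<rho> -` W)" "continuous_on (U \<inter> \<rho> -` W) (\<phi> \<circ> \<rho>)"
    "{x \<in> U \<inter> \<rho> -` W. (\<phi> \<circ> \<rho>) x = x} = {x \<in> W. \<phi> x = x}"
proof -
  have \<rho>: "X \<subseteq> U" "continuous_on U \<rho>" "\<rho> ` U \<subseteq> X" "\<And>x. x \<in> X \<Longrightarrow> \<rho> x = x"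
    using U(2) by (auto simp: retraction_def)
  have WX: "W \<subseteq> X"
    using W(1) by (rule openin_imp_subset)
  obtain Q where Q: "open Q" "W = X \<inter> Q"
    using W(1) by (auto simp: openin_open)
  have "U \<inter> \<rho> -` W = U \<inter> \<rho> -` Q"
    using Q \<rho>(3) by auto
  then show "open (U \<inter> \<rho> -` W)"
    using continuous_open_preimage[OF \<rho>(2) U(1) Q(1)] by simp
  show "continuous_on (U \<inter> \<rho> -` W) (\<phi> \<circ> \<rho>)"
    by (rule continuous_on_compose[OF continuous_on_subset[OF \<rho>(2)] continuous_on_subset[OF W(2)]]) auto
  show "{x \<in> U \<inter> \<rho> -` W. (\<phi> \<circ> \<rho>) x = x} = {x \<in> W. \<phi> x = x}"
  proof (intro equalityI subsetI)
    fix x assume x: "x \<in> {x \<in> U \<inter> \<rho> -` W. (\<phi> \<circ> \<rho>) x = x}"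
    then have "x \<in> X"
      using W(3) by force
    with x show "x \<in> {x \<in> W. \<phi> x = x}"
      using \<rho>(4)[of x] by simp
  next
    fix x assume "x \<in> {x \<in> W. \<phi> x = x}"
    then show "x \<in> {x \<in> U \<inter> \<rho> -` W. (\<phi> \<circ> \<rho>) x = x}"
      using \<rho>(1) \<rho>(4)[of x] WX by auto
  qed
qed

text \<open>Two retractions \<open>\<rho>\<close>, \<open>\<rho>'\<close> onto \<open>X\<close> give the same index: near \<open>X\<close> the homotopy
  \<open>\<phi> (\<rho> ((1 - t) \<rho> x + t \<rho>' x))\<close> joins \<open>\<phi> \<circ> \<rho>\<close> to \<open>\<phi> \<circ> \<rho>'\<close> without moving the fixed points.\<close>

lemma has_fixed_point_index_unique:
  fixes X :: "'a::euclidean_space set"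
  assumes W: "openin (top_of_set X) W" "continuous_on W \<phi>" "\<phi> ` W \<subseteq> X"
    and k: "has_fixed_point_index X W \<phi> k" and k': "has_fixed_point_index X W \<phi> k'"
  shows "k = k'"
proof -
  obtain U \<rho> where U: "open U" "retraction U X \<rho>" and i: "has_euclidean_fixed_point_index (U \<inter> \<rho> -` W) (\<phi> \<circ> \<rho>) k"
    using k by (auto simp: has_fixed_point_index_def)
  obtain U' \<rho>' where U': "open U'" "retraction U' X \<rho>'" and i': "has_euclidean_fixed_point_index (U' \<inter> \<rho>' -` W) (\<phi> \<circ> \<rho>') k'"
    using k' by (auto simp: has_fixed_point_index_def)
  note V = has_fixed_point_index_euclidean[OF U W] and V' = has_fixed_point_index_euclidean[OF U' W]
  have \<rho>: "X \<subseteq> U" "continuous_on U \<rho>" "\<rho> ` U \<subseteq> X" "\<And>x. x \<in> X \<Longrightarrow> \<rho> x = x"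
    using U(2) by (auto simp: retraction_def)
  have \<rho>': "X \<subseteq> U'" "continuous_on U' \<rho>'" "\<rho>' ` U' \<subseteq> X" "\<And>x. x \<in> X \<Longrightarrow> \<rho>' x = x"
    using U'(2) by (auto simp: retraction_def)
  define V where "V = U \<inter> \<rho> -` W"
  define C where "C = {x \<in> W. \<phi> x = x}"
  have CV: "c \<in> V" if "c \<in> C" for c
    using V(3) that by (auto simp: V_def C_def)
  have WX: "W \<subseteq> X"
    using W(1) by (rule openin_imp_subset)
  \<comment> \<open>These are the points that both retractions send into one ball about c. Balls are
    convex, so for a ball inside \<open>V\<close> the whole segment from \<rho> x to \<rho>' x stays
    in \<open>V\<close>, where \<open>\<phi> \<circ> \<rho>\<close> is defined.\<close>
  define A where "A c \<epsilon> = (U \<inter> \<rho> -` ball c \<epsilon>) \<inter> (U' \<inter> \<rho>' -` ball c \<epsilon>)" for c \<epsilon>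
  define N where "N = (\<Union>(c, \<epsilon>)\<in>{(c, \<epsilon>). c \<in> C \<and> ball c \<epsilon> \<subseteq> V}. A c \<epsilon>)"
  have "open (A c \<epsilon>)" for c \<epsilon>
    unfolding A_def by (intro open_Int continuous_open_preimage \<rho>(2) \<rho>'(2) U U' open_ball)
  then have oN: "open N"
    unfolding N_def by auto
  have segV: "closed_segment (\<rho> x) (\<rho>' x) \<subseteq> V" if x: "x \<in> N" for x
  proof -
    obtain c \<epsilon> where c: "c \<in> C" "ball c \<epsilon> \<subseteq> V" "x \<in> A c \<epsilon>"
      using x by (auto simp: N_def)
    then have "closed_segment (\<rho> x) (\<rho>' x) \<subseteq> ball c \<epsilon>"
      by (intro closed_segment_subset) (auto simp: A_def)
    with c show ?thesis by blast
  qed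
  have NU: "N \<subseteq> U" "N \<subseteq> U'"
    by (auto simp: N_def A_def)
  have NV: "N \<subseteq> U \<inter> \<rho> -` W" "N \<subseteq> U' \<inter> \<rho>' -` W"
  proof -
    show "N \<subseteq> U \<inter> \<rho> -` W"
    proof
      fix x assume x: "x \<in> N"
      have "\<rho> x \<in> V" "\<rho> x \<in> X"
        using segV[OF x] NU x \<rho>(3) by blast+
      then show "x \<in> U \<inter> \<rho> -` W"
        using x NU \<rho>(4) by (auto simp: V_def)
    qed
    show "N \<subseteq> U' \<inter> \<rho>' -` W"
    proof
      fix x assume x: "x \<in> N"
      have "\<rho>' x \<in> V" "\<rho>' x \<in> X"
        using segV[OF x] NU x \<rho>'(3) by blast+
      then show "x \<in> U' \<inter> \<rho>' -` W"
        using x NU \<rho>(4) by (auto simp: V_def)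
    qed
  qed
  have CN: "C \<subseteq> N"
  proof
    fix c assume c: "c \<in> C"
    then obtain \<epsilon> where \<epsilon>: "\<epsilon> > 0" "ball c \<epsilon> \<subseteq> V"
      using open_contains_ball[of V] V(1) CV unfolding V_def by blast
    have "c \<in> X"
      using c WX by (auto simp: C_def)
    then have "c \<in> A c \<epsilon>"
      using \<rho>(1,4) \<rho>'(1,4) \<epsilon> by (auto simp: A_def)
    then show "c \<in> N"
      using c \<epsilon> by (auto simp: N_def)
  qed
  define H where "H = (\<lambda>(t, x). \<phi> (\<rho> (\<rho> x + t *\<^sub>R (\<rho>' x - \<rho> x))))"
  have seg: "\<rho> x + t *\<^sub>R (\<rho>' x - \<rho> x) \<in> V" if "x \<in> N" "t \<in> {0..1}" for x and t :: real
  proof -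
    have "\<rho> x + t *\<^sub>R (\<rho>' x - \<rho> x) \<in> closed_segment (\<rho> x) (\<rho>' x)"
      using that(2) by (auto simp: closed_segment_def algebra_simps intro!: exI[of _ t])
    then show ?thesis
      using segV[OF that(1)] by blast
  qed
  have H0: "H (0, x) = \<phi> (\<rho> x)" and H1: "H (1, x) = \<phi> (\<rho>' x)" if "x \<in> N" for x
  proof -
    have "\<rho> x \<in> X" "\<rho>' x \<in> X"
      using that NU \<rho>(3) \<rho>'(3) by blast+
    then show "H (0, x) = \<phi> (\<rho> x)" "H (1, x) = \<phi> (\<rho>' x)"
      using \<rho>(4) by (auto simp: H_def)
  qed
  have "has_euclidean_fixed_point_index N (\<lambda>x. H (0, x)) k"
    by (rule has_euclidean_fixed_point_index_restrict[OF i oN NV(1)])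
      (use H0 V(3) CN in \<open>auto simp: C_def\<close>)
  then have "has_euclidean_fixed_point_index N (\<lambda>x. H (1, x)) k"
  proof (rule has_euclidean_fixed_point_index_homotopic[OF oN, rotated -1])
    have cont: "continuous_on ({0..1} \<times> N) (\<lambda>z. \<rho> (snd z))" "continuous_on ({0..1} \<times> N) (\<lambda>z. \<rho>' (snd z))"
      by (rule continuous_on_compose2[OF \<rho>(2)], use NU in \<open>auto intro!: continuous_intros\<close>)
        (rule continuous_on_compose2[OF \<rho>'(2)], use NU in \<open>auto intro!: continuous_intros\<close>)
    show "continuous_on ({0..1} \<times> N) H"
      unfolding H_def case_prod_unfold
    proof (rule continuous_on_compose2[OF W(2)], rule continuous_on_compose2[OF \<rho>(2)])
      show "continuous_on ({0..1} \<times> N) (\<lambda>z. \<rho> (snd z) + fst z *\<^sub>R (\<rho>' (snd z) - \<rho> (snd z)))"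
        by (intro continuous_intros cont)
    qed (use seg in \<open>auto simp: V_def\<close>)
    \<comment> \<open>A fixed point of any stage is a value of \<phi>, hence in X, where both
      retractions are the identity and the segment degenerates to the point x.\<close>
    have "{x \<in> N. \<exists>t\<in>{0..1}. H (t, x) = x} = C"
    proof (intro equalityI subsetI)
      fix x assume "x \<in> {x \<in> N. \<exists>t\<in>{0..1}. H (t, x) = x}"
      then obtain t where t: "x \<in> N" "t \<in> {0..1}" "H (t, x) = x"
        by auto
      have w: "\<rho> (\<rho> x + t *\<^sub>R (\<rho>' x - \<rho> x)) \<in> W"
        using seg[OF t(1,2)] by (auto simp: V_def)
      then have "x \<in> X"
        using W(3) t(3) by (auto simp: H_def)
      then have "\<rho> x = x" "\<rho>' x = x"
        using \<rho>(4) \<rho>'(4) by auto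
      then show "x \<in> C"
        using w t(3) by (simp add: H_def C_def)
    next
      fix x assume x: "x \<in> C"
      then have "x \<in> N" "\<rho> x = x" "\<phi> x = x"
        using CN WX \<rho>(4) by (auto simp: C_def)
      then show "x \<in> {x \<in> N. \<exists>t\<in>{0..1}. H (t, x) = x}"
        using H0[of x] by (auto intro!: bexI[of _ 0])
    qed
    then show "compact {x \<in> N. \<exists>t\<in>{0..1}. H (t, x) = x}"
      using i V(3) by (simp add: has_euclidean_fixed_point_index_alt C_def)
  qed
  then have "has_euclidean_fixed_point_index (U' \<inter> \<rho>' -` W) (\<phi> \<circ> \<rho>') k"
    by (rule has_euclidean_fixed_point_index_extend[OF _ V'(1) NV(2) V'(2)])
      (use H1 V'(3) CN in \<open>auto simp: C_def\<close>)
  then show ?thesis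
    using i' by (rule has_euclidean_fixed_point_index_unique)
qed

lemma has_fixed_point_index_restrict:
  fixes X :: "'a::euclidean_space set"
  assumes W: "openin (top_of_set X) W" "continuous_on W \<phi>" "\<phi> ` W \<subseteq> X"
    and W': "openin (top_of_set X) W'" "W' \<subseteq> W"
    and eq: "\<And>x. x \<in> W' \<Longrightarrow> \<phi> x = \<phi>' x" and fp: "\<And>x. x \<in> W \<Longrightarrow> \<phi> x = x \<Longrightarrow> x \<in> W'"
    and k: "has_fixed_point_index X W \<phi> k"
  shows "has_fixed_point_index X W' \<phi>' k"
proof -
  obtain U \<rho> where U: "open U" "retraction U X \<rho>" and i: "has_euclidean_fixed_point_index (U \<inter> \<rho> -` W) (\<phi> \<circ> \<rho>) k"
    using k by (auto simp: has_fixed_point_index_def)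
  note V = has_fixed_point_index_euclidean[OF U W]
  have \<rho>: "\<And>x. x \<in> X \<Longrightarrow> \<rho> x = x"
    using U(2) by (auto simp: retraction_def)
  have W'X: "W' \<subseteq> X"
    using W'(1) by (rule openin_imp_subset)
  have "continuous_on W' \<phi>" "\<phi> ` W' \<subseteq> X"
    using W W' continuous_on_subset by blast+
  then have oV: "open (U \<inter> \<rho> -` W')"
    using has_fixed_point_index_euclidean(1)[OF U W'(1)] by blast
  have "has_euclidean_fixed_point_index (U \<inter> \<rho> -` W') (\<phi>' \<circ> \<rho>) k"
  proof (rule has_euclidean_fixed_point_index_restrict[OF i oV])
    show "x \<in> U \<inter> \<rho> -` W'" if "x \<in> U \<inter> \<rho> -` W" "(\<phi> \<circ> \<rho>) x = x" for x
    proof -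
      have "x \<in> W'"
        using that V(3) fp by blast
      then show ?thesis
        using that(1) \<rho> W'X by auto
    qed
  qed (use W'(2) eq in auto)
  with U show ?thesis
    by (auto simp: has_fixed_point_index_def)
qed

text \<open>The retraction acts on the space coordinate alone, so pulling \<Omega> back along (x, t)
  \<mapsto> (\<rho> x, t) reduces the claim to moving domains in Euclidean space, with one
  retraction for both ends. Fixed pairs are unchanged because \<Phi> has values in X.\<close>

lemma has_fixed_point_index_slices:
  fixes X :: "'a::euclidean_space set" and \<Phi> :: "'a \<times> real \<Rightarrow> 'a"
  assumes X: "ENR X" and \<Omega>: "openin (top_of_set (X \<times> {0..1})) \<Omega>"
    and \<Phi>: "continuous_on \<Omega> \<Phi>" "\<Phi> ` \<Omega> \<subseteq> X" and K: "compact {z \<in> \<Omega>. \<Phi> z = fst z}"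
  obtains k where "has_fixed_point_index X {x. (x, 0) \<in> \<Omega>} (\<lambda>x. \<Phi> (x, 0)) k"
    "has_fixed_point_index X {x. (x, 1) \<in> \<Omega>} (\<lambda>x. \<Phi> (x, 1)) k"
proof -
  obtain U \<rho> where U: "open U" "retraction U X \<rho>"
    using X by (auto simp: ENR_def retract_of_def)
  then have \<rho>: "X \<subseteq> U" "continuous_on U \<rho>" "\<rho> ` U \<subseteq> X" "\<And>x. x \<in> X \<Longrightarrow> \<rho> x = x"
    by (auto simp: retraction_def)
  obtain P where P: "open P" "\<Omega> = X \<times> {0..1} \<inter> P"
    using \<Omega> by (auto simp: openin_open)
  let ?R = "\<lambda>z. (\<rho> (fst z), snd z) :: 'a \<times> real"
  define Q where "Q = (U \<times> UNIV) \<inter> ?R -` P"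
  have cR: "continuous_on (U \<times> UNIV) ?R"
    by (intro continuous_intros continuous_on_compose2[OF \<rho>(2)]) auto
  have oO: "open Q"
    unfolding Q_def by (rule continuous_open_preimage[OF cR _ P(1)]) (intro open_Times U open_UNIV)
  define G where "G = \<Phi> \<circ> ?R"
  have Q\<Omega>: "(x, t) \<in> Q \<longleftrightarrow> x \<in> U \<and> (\<rho> x, t) \<in> \<Omega>" if "t \<in> {0..1}" for x t
    using that \<rho>(3) P(2) by (auto simp: Q_def)
  have cG: "continuous_on (Q \<inter> UNIV \<times> {0..1}) G"
    unfolding G_def
  proof (rule continuous_on_compose[OF continuous_on_subset[OF cR] continuous_on_subset[OF \<Phi>(1)]])
    show "Q \<inter> UNIV \<times> {0..1} \<subseteq> U \<times> UNIV"
      by (auto simp: Q_def)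
    show "?R ` (Q \<inter> UNIV \<times> {0..1}) \<subseteq> \<Omega>"
      using Q\<Omega> by auto
  qed
  have "{z \<in> Q \<inter> UNIV \<times> {0..1}. G z = fst z} = {z \<in> \<Omega>. \<Phi> z = fst z}"
  proof (intro equalityI subsetI)
    fix z assume z: "z \<in> {z \<in> Q \<inter> UNIV \<times> {0..1}. G z = fst z}"
    obtain x t where xt: "z = (x, t)" by force
    have t: "t \<in> {0..1}"
      using z by (simp add: xt)
    have x: "(\<rho> x, t) \<in> \<Omega>" "\<Phi> (\<rho> x, t) = x"
    proof -
      have "(x, t) \<in> Q" "G (x, t) = x"
        using z by (simp_all add: xt)
      then show "(\<rho> x, t) \<in> \<Omega>" "\<Phi> (\<rho> x, t) = x"
        unfolding Q\<Omega>[OF t] G_def by (blast, simp only: o_def fst_conv snd_conv)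
    qed
    have "\<Phi> (\<rho> x, t) \<in> X"
      using x(1) \<Phi>(2) by blast
    then have "x \<in> X"
      by (simp only: x(2))
    then have "\<rho> x = x"
      by (rule \<rho>(4))
    then show "z \<in> {z \<in> \<Omega>. \<Phi> z = fst z}"
      using x by (simp add: xt)
  next
    fix z assume z: "z \<in> {z \<in> \<Omega>. \<Phi> z = fst z}"
    obtain x t where xt: "z = (x, t)" by force
    have x: "x \<in> X" "x \<in> U" "\<rho> x = x" and t: "t \<in> {0..1}"
      using z P(2) \<rho>(1,4) by (auto simp: xt)
    then show "z \<in> {z \<in> Q \<inter> UNIV \<times> {0..1}. G z = fst z}"
      using z unfolding xt mem_Collect_eq Int_iff Q\<Omega>[OF t] G_def o_def fst_conv snd_conv
      by (simp only: x) simp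
  qed
  then have K': "compact {z \<in> Q \<inter> UNIV \<times> {0..1}. G z = fst z}"
    using K by simp
  have slice: "{x. (x, t) \<in> Q} = U \<inter> \<rho> -` {x. (x, t) \<in> \<Omega>}" "(\<lambda>x. G (x, t)) = (\<lambda>x. \<Phi> (x, t)) \<circ> \<rho>"
    if "t \<in> {0..1}" for t
    using Q\<Omega>[OF that] by (auto simp: G_def)
  have oW: "openin (top_of_set X) {x. (x, t) \<in> \<Omega>}" if t: "t \<in> {0..1}" for t
  proof -
    have "{x. (x, t) \<in> \<Omega>} = X \<inter> (\<lambda>x. (x, t)) -` P"
      using t P(2) by auto
    moreover have "open ((\<lambda>x. (x, t)) -` P)"
      by (rule open_vimage[OF P(1)]) (intro continuous_intros)
    ultimately show ?thesis by (auto simp: openin_open)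
  qed
  have c\<Phi>: "continuous_on {x. (x, t) \<in> \<Omega>} (\<lambda>x. \<Phi> (x, t))" "(\<lambda>x. \<Phi> (x, t)) ` {x. (x, t) \<in> \<Omega>} \<subseteq> X" for t
    using \<Phi>(2) by (auto intro!: continuous_on_compose2[OF \<Phi>(1)] continuous_intros)
  have 0: "0 \<in> {0..1::real}" and 1: "1 \<in> {0..1::real}" by auto
  have "compact {x \<in> {x. (x, 0) \<in> Q}. G (x, 0) = x}"
  proof -
    have "{x \<in> {x. (x, 0) \<in> Q}. G (x, 0) = x} = fst ` ({z \<in> Q \<inter> UNIV \<times> {0..1}. G z = fst z} \<inter> UNIV \<times> {0})"
      by force
    then show ?thesis
      using compact_Int_closed[OF K' closed_Times[OF closed_UNIV closed_singleton[of 0]]]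
      by (simp add: compact_continuous_image continuous_on_fst)
  qed
  then obtain k where k: "has_euclidean_fixed_point_index {x. (x, 0) \<in> Q} (\<lambda>x. G (x, 0)) k"
    using has_euclidean_fixed_point_index_exists[of "{x. (x, 0) \<in> Q}" "\<lambda>x. G (x, 0)"]
      has_fixed_point_index_euclidean(1,2)[OF U oW[OF 0] c\<Phi>] unfolding slice[OF 0] by blast
  then have "has_euclidean_fixed_point_index {x. (x, 1) \<in> Q} (\<lambda>x. G (x, 1)) k"
    by (rule has_euclidean_fixed_point_index_slices[OF oO cG K'])
  with k U show thesis
    unfolding slice[OF 0] slice[OF 1] by (intro that) (auto simp: has_fixed_point_index_def)
qed

lemma has_fixed_point_index_empty:
  fixes X :: "'a::euclidean_space set"
  assumes W: "openin (top_of_set X) W" "continuous_on W \<phi>" "\<phi> ` W \<subseteq> X"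
    and fp: "\<And>x. x \<in> W \<Longrightarrow> \<phi> x \<noteq> x" and k: "has_fixed_point_index X W \<phi> k"
  shows "k = 0"
proof -
  obtain U \<rho> where U: "open U" "retraction U X \<rho>" and i: "has_euclidean_fixed_point_index (U \<inter> \<rho> -` W) (\<phi> \<circ> \<rho>) k"
    using k by (auto simp: has_fixed_point_index_def)
  note V = has_fixed_point_index_euclidean[OF U W]
  have "has_euclidean_fixed_point_index (U \<inter> \<rho> -` W) (\<phi> \<circ> \<rho>) 0"
    by (rule has_euclidean_fixed_point_index_empty[OF V(1,2)]) (use V(3) fp in blast)
  with i show ?thesis
    by (rule has_euclidean_fixed_point_index_unique)
qed

section \<open>Covering spaces\<close>

lemma covering_space_evenly_covered:
  assumes "covering_space C p X" "x \<in> X"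
  obtains T v where "x \<in> T" "openin (top_of_set X) T" "\<Union>v = C \<inter> p -` T"
    "\<And>u. u \<in> v \<Longrightarrow> openin (top_of_set C) u" "pairwise disjnt v"
    "\<And>u. u \<in> v \<Longrightarrow> \<exists>q. homeomorphism u T p q"
proof -
  have "\<exists>T. x \<in> T \<and> openin (top_of_set X) T \<and> (\<exists>v. \<Union>v = C \<inter> p -` T \<and>
      (\<forall>u\<in>v. openin (top_of_set C) u) \<and> pairwise disjnt v \<and> (\<forall>u\<in>v. \<exists>q. homeomorphism u T p q))"
    using assms unfolding covering_space_def by (elim conjE) (erule bspec)
  then show thesis
    by (elim exE conjE) (rule that, assumption+, erule (1) bspec, assumption, erule (1) bspec)
qed

text \<open>Near a point two lifts each stay in one sheet. In a common sheet they agree, since p is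
  injective there; in different sheets they differ, since sheets are disjoint. Either way agreement
  is locally constant, and \<open>Z\<close> is connected.\<close>

lemma covering_space_lift_unique_topological:
  fixes p :: "'b::topological_space \<Rightarrow> 'a::topological_space" and g1 g2 :: "'c::topological_space \<Rightarrow> 'b"
  assumes cov: "covering_space C p X" and Z: "connected Z"
    and g1: "continuous_on Z g1" "g1 ` Z \<subseteq> C" and g2: "continuous_on Z g2" "g2 ` Z \<subseteq> C"
    and eq: "\<And>z. z \<in> Z \<Longrightarrow> p (g1 z) = p (g2 z)" and a: "a \<in> Z" "g1 a = g2 a" and z: "z \<in> Z"
  shows "g1 z = g2 z"
proof -
  have local: "\<exists>T. openin (top_of_set Z) T \<and> x \<in> T \<and> (\<forall>w\<in>T. (g1 w = g2 w) = (g1 x = g2 x))" if x: "x \<in> Z" for x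
  proof -
    have "p (g1 x) \<in> X"
      using cov g1 x covering_space_imp_surjective by blast
    then obtain T v where v: "p (g1 x) \<in> T" "openin (top_of_set X) T" "\<Union>v = C \<inter> p -` T" "\<And>u. u \<in> v \<Longrightarrow> openin (top_of_set C) u"
        "pairwise disjnt v" "\<And>u. u \<in> v \<Longrightarrow> \<exists>q. homeomorphism u T p q"
      by (rule covering_space_evenly_covered[OF cov]) (rule that)
    have "g1 x \<in> \<Union>v" "g2 x \<in> \<Union>v"
      unfolding v(3) using g1(2) g2(2) x eq[OF x] v(1) by auto
    then obtain u1 u2 where u1: "u1 \<in> v" "g1 x \<in> u1" and u2: "u2 \<in> v" "g2 x \<in> u2"
      by (elim UnionE) (rule that)
    show ?thesis
    proof (intro exI[of _ "(Z \<inter> g1 -` u1) \<inter> (Z \<inter> g2 -` u2)"] conjI ballI)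
      show "openin (top_of_set Z) ((Z \<inter> g1 -` u1) \<inter> (Z \<inter> g2 -` u2))"
        using g1 g2 v(4)[OF u1(1)] v(4)[OF u2(1)]
        by (intro openin_Int continuous_openin_preimage[of _ g1 C] continuous_openin_preimage[of _ g2 C]) auto
      show "x \<in> (Z \<inter> g1 -` u1) \<inter> (Z \<inter> g2 -` u2)"
        using x u1 u2 by auto
      fix w assume w: "w \<in> (Z \<inter> g1 -` u1) \<inter> (Z \<inter> g2 -` u2)"
      have inj: "inj_on p u1"
        using v(6)[OF u1(1)] by (metis homeomorphism_apply1 inj_onI)
      show "(g1 w = g2 w) = (g1 x = g2 x)"
      proof (cases "u1 = u2")
        case True
        then show ?thesis
          using w u1(2) u2(2) inj_onD[OF inj] eq x by auto
      next
        case False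
        then have "disjnt u1 u2"
          using v(5) u1 u2 by (auto simp: pairwise_def)
        then show ?thesis
          using w u1(2) u2(2) by (auto simp: disjnt_iff)
      qed
    qed
  qed
  show ?thesis
  proof (rule connected_induction_simple[OF Z a(1) z, of "\<lambda>w. g1 w = g2 w"])
    fix x assume "x \<in> Z"
    then show "\<exists>T. openin (top_of_set Z) T \<and> x \<in> T \<and> (\<forall>x\<in>T. \<forall>y\<in>T. g1 x = g2 x \<longrightarrow> g1 y = g2 y)"
      using local[of x] by metis
  qed (rule a)
qed

text \<open>The library proves the lifting criterion only for total spaces inside a normed space. A covering
  space of a compact set embeds into one: record the point of the base and, for every sheet over
  the finitely many balls of a cover, a bump function supported on that sheet.\<close>

lemma covering_space_embedding:
  fixes p :: "'b::topological_space \<Rightarrow> 'a::real_normed_vector"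
  assumes cov: "covering_space C p X" and X: "compact X"
  obtains e :: "'b \<Rightarrow> 'a \<times> (('a \<times> 'b set) discrete \<Rightarrow>\<^sub>C real)" and e'
  where "homeomorphism C (e ` C) e e'" "\<And>x. x \<in> C \<Longrightarrow> fst (e x) = p x"
proof -
  have cp: "continuous_on C p" "p ` C = X"
    using cov by (auto simp: covering_space_def)
  let ?P = "\<lambda>y r T v. r > (0::real) \<and> X \<inter> ball y r \<subseteq> T \<and> openin (top_of_set X) T \<and> \<Union>v = C \<inter> p -` T \<and>
      (\<forall>u\<in>v. openin (top_of_set C) u) \<and> pairwise disjnt v \<and> (\<forall>u\<in>v. \<exists>q. homeomorphism u T p q)"
  have "\<forall>y\<in>X. \<exists>r T v. ?P y r T v"
  proof
    fix y assume y: "y \<in> X"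
    obtain T v where v: "y \<in> T" "openin (top_of_set X) T" "\<Union>v = C \<inter> p -` T"
      "\<And>u. u \<in> v \<Longrightarrow> openin (top_of_set C) u" "pairwise disjnt v" "\<And>u. u \<in> v \<Longrightarrow> \<exists>q. homeomorphism u T p q"
      by (rule covering_space_evenly_covered[OF cov y]) (rule that)
    obtain r where r: "r > 0" "ball y r \<inter> X \<subseteq> T"
      using v(1,2) unfolding openin_contains_ball by blast
    then have "X \<inter> ball y r \<subseteq> T"
      by blast
    then show "\<exists>r T v. ?P y r T v"
      by (intro exI[of _ r] exI[of _ T] exI[of _ v] conjI ballI v r(1))
  qed
  from bchoice[OF this] obtain r where "\<forall>y\<in>X. \<exists>T v. ?P y (r y) T v" ..
  from bchoice[OF this] obtain T where "\<forall>y\<in>X. \<exists>v. ?P y (r y) (T y) v" ..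
  from bchoice[OF this] obtain v where "\<forall>y\<in>X. ?P y (r y) (T y) (v y)" ..
  then have P: "?P y (r y) (T y) (v y)" if "y \<in> X" for y
    using that by (rule bspec)
  have rTv: "\<And>y. y \<in> X \<Longrightarrow> r y > 0" "\<And>y. y \<in> X \<Longrightarrow> X \<inter> ball y (r y) \<subseteq> T y"
      "\<And>y. y \<in> X \<Longrightarrow> openin (top_of_set X) (T y)"
      "\<And>y. y \<in> X \<Longrightarrow> \<Union>(v y) = C \<inter> p -` T y" "\<And>y u. y \<in> X \<Longrightarrow> u \<in> v y \<Longrightarrow> openin (top_of_set C) u"
      "\<And>y. y \<in> X \<Longrightarrow> pairwise disjnt (v y)" "\<And>y u. y \<in> X \<Longrightarrow> u \<in> v y \<Longrightarrow> \<exists>q. homeomorphism u (T y) p q"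
    by (drule P, elim conjE, assumption | drule P, elim conjE, erule (1) bspec)+
  obtain Y where Y: "Y \<subseteq> X" "finite Y" "X \<subseteq> (\<Union>y\<in>Y. ball y (r y))"
  proof (rule compactE_image[OF X, of X "\<lambda>y. ball y (r y)"])
    show "X \<subseteq> (\<Union>y\<in>X. ball y (r y))"
    proof
      fix x assume "x \<in> X"
      then show "x \<in> (\<Union>y\<in>X. ball y (r y))"
        using rTv(1)[of x] by (intro UN_I[of x]) auto
    qed
  qed (use that in auto)
  \<comment> \<open>A tent function on the base, positive exactly on the ball of radius
    \<open>r y\<close>. The coordinates \<open>\<phi> x\<close> are indexed by sheets (y, u); the
    discrete topology on the index set makes every bounded family a bounded continuous function, and
    distances become suprema over possibly infinitely many sheets.\<close>
  define b where "b y z = max 0 (r y - dist y z)" for y z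
  define \<phi> where "\<phi> x i = (case of_discrete i of (y, u) \<Rightarrow> if y \<in> Y \<and> u \<in> v y \<and> x \<in> u then b y (p x) else 0)" for x i
  obtain R where R: "\<And>y. y \<in> Y \<Longrightarrow> r y \<le> R" "R \<ge> 0"
  proof
    fix y assume "y \<in> Y"
    then have "\<bar>r y\<bar> \<le> (\<Sum>y\<in>Y. \<bar>r y\<bar>)"
      using Y(2) by (intro member_le_sum) auto
    then show "r y \<le> (\<Sum>y\<in>Y. \<bar>r y\<bar>)" by simp
  qed (simp add: sum_nonneg)
  have bR: "0 \<le> b y z" for y z
    by (simp add: b_def)
  have bR': "b y z \<le> R" if "y \<in> Y" for y z
    unfolding b_def using R(1)[OF that] R(2) zero_le_dist[of y z] by (intro max.boundedI) linarith+
  have \<phi>b: "\<phi> x \<in> bcontfun" for x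
  proof (rule bcontfun_normI)
    show "continuous_on UNIV (\<phi> x)"
      by (auto simp: continuous_on_open_vimage open_discrete)
    show "norm (\<phi> x i) \<le> R" for i
      using bR bR' R(2) by (auto simp: \<phi>_def split: prod.splits)
  qed
  define e where "e x = (p x, Bcontfun (\<phi> x))" for x
  have \<phi>e: "apply_bcontfun (snd (e x)) i = \<phi> x i" for x i
    by (simp add: e_def Bcontfun_inverse[OF \<phi>b])
  have sheet: "\<phi> x (discrete (y, u)) = b y (p x)" if "y \<in> Y" "u \<in> v y" "x \<in> u" for x y u
    using that by (simp add: \<phi>_def discrete_inverse)
  have off: "\<phi> x (discrete (y, u)) = 0" if "\<not> (y \<in> Y \<and> u \<in> v y \<and> x \<in> u)" for x y u
    using that by (auto simp: \<phi>_def discrete_inverse)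
  have ce: "continuous_on C e"
    unfolding e_def
  proof (intro continuous_on_Pair cp(1))
    show "continuous_on C (\<lambda>x. Bcontfun (\<phi> x))"
      unfolding continuous_on_def tendsto_iff
    proof (intro ballI allI impI)
      fix x and \<epsilon> :: real assume x: "x \<in> C" and \<epsilon>: "\<epsilon> > 0"
      \<comment> \<open>The estimate must be uniform in the sheet u. If p x lies in
        \<open>T y\<close>, one sheet \<open>u0\<close> contains x and all other coordinates for y
        vanish on it; otherwise the tent vanishes at p x and is small nearby, on every sheet
        alike.\<close>
      have "\<exists>N. openin (top_of_set C) N \<and> x \<in> N \<and> (\<forall>z\<in>N. \<forall>u. \<bar>\<phi> z (discrete (y, u)) - \<phi> x (discrete (y, u))\<bar> \<le> \<epsilon> / 2)"
        if y: "y \<in> Y" for y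
      proof -
        have yX: "y \<in> X" using y Y by auto
        let ?N = "C \<inter> (\<lambda>z. b y (p z)) -` ball (b y (p x)) (\<epsilon> / 2)"
        have cb: "continuous_on C (\<lambda>z. b y (p z))"
          unfolding b_def by (intro continuous_intros cp(1))
        have N: "openin (top_of_set C) ?N" "x \<in> ?N"
          using continuous_openin_preimage_gen[OF cb open_ball] x \<epsilon> by auto
        show ?thesis
        proof (cases "p x \<in> T y")
          case True
          then have "x \<in> \<Union>(v y)"
            unfolding rTv(4)[OF yX] using x by simp
          then obtain u0 where u0: "u0 \<in> v y" "x \<in> u0" ..
          have diff: "\<bar>\<phi> z (discrete (y, u)) - \<phi> x (discrete (y, u))\<bar> \<le> \<epsilon> / 2" if z: "z \<in> ?N \<inter> u0" for z u
          proof (cases "u = u0")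
            case True
            have "z \<in> u0" "\<bar>b y (p z) - b y (p x)\<bar> < \<epsilon> / 2"
              using z by (auto simp: dist_real_def abs_minus_commute)
            then show ?thesis
              using sheet[OF y u0(1)] u0(2) True by simp
          next
            case False
            have "\<not> (y \<in> Y \<and> u \<in> v y \<and> w \<in> u)" if "w \<in> u0" for w
              using rTv(6)[OF yX] u0(1) False that unfolding pairwise_def disjnt_iff by blast
            then show ?thesis
              using off u0(2) z \<epsilon> by simp
          qed
          then show ?thesis
            using N u0 rTv(5)[OF yX u0(1)] by (intro exI[of _ "?N \<inter> u0"]) auto
        next
          case False
          have "p x \<in> X" using x cp by auto
          then have "b y (p x) = 0"
            using False rTv(2)[OF yX] by (auto simp: b_def)
          then have "\<bar>\<phi> z (discrete (y, u)) - \<phi> x (discrete (y, u))\<bar> \<le> \<epsilon> / 2" if "z \<in> ?N" for z u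
            using that \<epsilon> bR[of y "p z"] by (auto simp: \<phi>_def discrete_inverse dist_real_def)
          then show ?thesis
            using N by blast
        qed
      qed
      then obtain N where N: "\<And>y. y \<in> Y \<Longrightarrow> openin (top_of_set C) (N y) \<and> x \<in> N y"
        "\<And>y z u. y \<in> Y \<Longrightarrow> z \<in> N y \<Longrightarrow> \<bar>\<phi> z (discrete (y, u)) - \<phi> x (discrete (y, u))\<bar> \<le> \<epsilon> / 2"
        by metis
      have oN: "openin (top_of_set C) (C \<inter> (\<Inter>y\<in>Y. N y))"
      proof (cases "Y = {}")
        case False
        then have "openin (top_of_set C) (\<Inter>y\<in>Y. N y)"
          using Y(2) N(1) by (intro openin_INT2) auto
        then show ?thesis by (intro openin_Int openin_subtopology_self)
      qed simp
      have "dist (Bcontfun (\<phi> z)) (Bcontfun (\<phi> x)) < \<epsilon>" if z: "z \<in> C \<inter> (\<Inter>y\<in>Y. N y)" for z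
      proof -
        have "dist (Bcontfun (\<phi> z)) (Bcontfun (\<phi> x)) \<le> \<epsilon> / 2"
        proof (rule dist_bound)
          fix i :: "('a \<times> 'b set) discrete"
          obtain y u where i: "i = discrete (y, u)"
            by (metis of_discrete_inverse surj_pair)
          show "dist (apply_bcontfun (Bcontfun (\<phi> z)) i) (apply_bcontfun (Bcontfun (\<phi> x)) i) \<le> \<epsilon> / 2"
          proof (cases "y \<in> Y")
            case True
            then show ?thesis
              using N(2)[OF True, of z u] z by (simp add: Bcontfun_inverse[OF \<phi>b] i dist_real_def)
          qed (use \<epsilon> in \<open>simp add: Bcontfun_inverse[OF \<phi>b] i off\<close>)
        qed
        with \<epsilon> show ?thesis by simp
      qed
      moreover obtain Q where "open Q" "C \<inter> (\<Inter>y\<in>Y. N y) = C \<inter> Q"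
        using oN by (auto simp: openin_open)
      moreover have "x \<in> C \<inter> (\<Inter>y\<in>Y. N y)"
        using x N(1) by auto
      ultimately show "\<forall>\<^sub>F z in at x within C. dist (Bcontfun (\<phi> z)) (Bcontfun (\<phi> x)) < \<epsilon>"
        unfolding eventually_at_topological by blast
    qed
  qed
  \<comment> \<open>Injectivity and continuity of the inverse both come from here. The coordinate of
    the sheet of x has value \<open>a\<close> > 0 at x, so a point whose image is closer than
    \<open>a\<close> has a nonzero coordinate there and lies in the same sheet, on which p is a
    homeomorphism.\<close>
  have near: "\<exists>\<delta>>0. \<forall>z\<in>C. dist (e z) (e x) < \<delta> \<longrightarrow> z \<in> N" if x: "x \<in> N" and N: "openin (top_of_set C) N" for x N
  proof -
    have xC: "x \<in> C" using x N openin_imp_subset by blast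
    then obtain y where y: "y \<in> Y" "p x \<in> ball y (r y)"
      using Y(3) cp(2) by blast
    then have yX: "y \<in> X"
      using Y(1) by auto
    have pT: "p x \<in> T y"
      using rTv(2)[OF yX] y(2) cp(2) xC by blast
    have "x \<in> \<Union>(v y)"
      unfolding rTv(4)[OF yX] using pT xC by simp
    then obtain u0 where u0: "u0 \<in> v y" "x \<in> u0" ..
    obtain q where q: "homeomorphism u0 (T y) p q"
      using rTv(7)[OF yX u0(1)] by blast
    have "openin (top_of_set u0) (u0 \<inter> N)"
      using N openin_imp_subset[OF rTv(5)[OF yX u0(1)]] unfolding openin_open by blast
    then have "openin (top_of_set (T y)) (p ` (u0 \<inter> N))"
      using homeomorphism_imp_open_map[OF q] by simp
    then have "openin (top_of_set X) (p ` (u0 \<inter> N))"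
      using rTv(3)[OF yX] openin_trans by blast
    then obtain \<delta> where \<delta>: "\<delta> > 0" "ball (p x) \<delta> \<inter> X \<subseteq> p ` (u0 \<inter> N)"
      using x u0(2) unfolding openin_contains_ball by (metis IntI imageI)
    define a where "a = b y (p x)"
    have a: "a > 0"
      using y(2) by (simp add: a_def b_def)
    have "z \<in> N" if z: "z \<in> C" "dist (e z) (e x) < min \<delta> a" for z
    proof -
      have d: "dist (p z) (p x) < \<delta>" "dist (snd (e z)) (snd (e x)) < a"
        using z(2) dist_fst_le[of "e z" "e x"] dist_snd_le[of "e z" "e x"] by (auto simp: e_def)
      have "dist (\<phi> z (discrete (y, u0))) (\<phi> x (discrete (y, u0))) < a"
        using d(2) dist_bounded[of "snd (e z)" "discrete (y, u0)" "snd (e x)"] by (simp add: \<phi>e)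
      then have "\<phi> z (discrete (y, u0)) \<noteq> 0"
        using sheet[OF y(1) u0] a by (auto simp: a_def dist_real_def)
      then have zu: "z \<in> u0"
        using off by metis
      have "p z \<in> p ` (u0 \<inter> N)"
        using \<delta>(2) d(1) z(1) cp(2) by (auto simp: dist_commute)
      then show "z \<in> N"
        using zu u0 homeomorphism_apply1[OF q] by (metis IntE imageE)
    qed
    then show ?thesis
      using \<delta>(1) a by (intro exI[of _ "min \<delta> a"]) auto
  qed
  have inj: "inj_on e C"
  proof (rule inj_onI)
    fix x z assume xz: "x \<in> C" "z \<in> C" "e x = e z"
    obtain y where y: "y \<in> Y" "p x \<in> ball y (r y)"
      using Y(3) cp(2) xz(1) by blast
    then have yX: "y \<in> X"
      using Y(1) by auto
    have pT: "p x \<in> T y"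
      using rTv(2)[OF yX] y(2) cp(2) xz(1) by blast
    have "x \<in> \<Union>(v y)"
      unfolding rTv(4)[OF yX] using pT xz(1) by simp
    then obtain u0 where u0: "u0 \<in> v y" "x \<in> u0" ..
    then have "z \<in> u0"
      using near[OF u0(2) rTv(5)[OF yX u0(1)]] xz by auto
    moreover have "p x = p z"
      using xz(3) by (simp add: e_def)
    ultimately show "x = z"
      using rTv(7)[OF yX u0(1)] u0(2) by (metis homeomorphism_apply1)
  qed
  have "homeomorphism C (e ` C) e (inv_into C e)"
  proof (rule homeomorphismI)
    show "continuous_on (e ` C) (inv_into C e)"
      unfolding continuous_on_def
    proof (intro ballI topological_tendstoI)
      fix y S assume y: "y \<in> e ` C" and S: "open S" "inv_into C e y \<in> S"
      obtain x where x: "x \<in> C" "y = e x"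
        using y by blast
      have "x \<in> C \<inter> S"
        using x S(2) by (simp add: inv_into_f_f[OF inj])
      moreover have "openin (top_of_set C) (C \<inter> S)"
        using S(1) by (auto simp: openin_open)
      ultimately have "\<exists>\<delta>>0. \<forall>z\<in>C. dist (e z) (e x) < \<delta> \<longrightarrow> z \<in> C \<inter> S"
        by (rule near)
      then obtain \<delta> where \<delta>: "\<delta> > 0" "\<And>z. z \<in> C \<Longrightarrow> dist (e z) (e x) < \<delta> \<Longrightarrow> z \<in> C \<inter> S"
        by blast
      have "inv_into C e w \<in> S" if "w \<in> e ` C" "dist w y < \<delta>" for w
        using that \<delta>(2) by (auto simp: inv_into_f_f[OF inj] x(2))
      then show "\<forall>\<^sub>F w in at y within e ` C. inv_into C e w \<in> S"
        unfolding eventually_at using \<delta>(1) by blast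
    qed
  qed (use ce inj in \<open>auto simp: inv_into_f_f\<close>)
  then show thesis
    by (rule that) (simp add: e_def)
qed

lemma covering_space_homeomorphism:
  fixes p :: "'b::topological_space \<Rightarrow> 'a::topological_space" and e :: "'b \<Rightarrow> 'c::topological_space"
  assumes cov: "covering_space C p X" and e: "homeomorphism C D e e'"
  shows "covering_space D (p \<circ> e') X"
proof
  have E: "continuous_on D e'" "e' ` D = C" "e ` C = D" "\<And>x. x \<in> C \<Longrightarrow> e' (e x) = x" "\<And>y. y \<in> D \<Longrightarrow> e (e' y) = y"
    using e by (auto simp: homeomorphism_def)
  have cp: "continuous_on C p" "p ` C = X"
    using cov by (auto simp: covering_space_def)
  show "continuous_on D (p \<circ> e')"
    by (rule continuous_on_compose[OF E(1)]) (simp add: E(2) cp)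
  show "(p \<circ> e') ` D = X"
    by (simp only: image_comp[symmetric] E(2) cp(2))
  fix x assume "x \<in> X"
  then obtain T v where v: "x \<in> T" "openin (top_of_set X) T" "\<Union>v = C \<inter> p -` T"
      "\<And>u. u \<in> v \<Longrightarrow> openin (top_of_set C) u"
        "pairwise disjnt v" "\<And>u. u \<in> v \<Longrightarrow> \<exists>q. homeomorphism u T p q"
    by (rule covering_space_evenly_covered[OF cov]) (rule that)
  have vC: "u \<subseteq> C" if "u \<in> v" for u
    using v(3) that by blast
  show "\<exists>T. x \<in> T \<and> openin (top_of_set X) T \<and> (\<exists>v. \<Union>v = D \<inter> (p \<circ> e') -` T \<and> (\<forall>u\<in>v. openin (top_of_set D) u) \<and>
      pairwise disjnt v \<and> (\<forall>u\<in>v. \<exists>q. homeomorphism u T (p \<circ> e') q))"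
  proof (intro exI[of _ T] conjI exI[of _ "(`) e ` v"] v(1,2) ballI)
    have "e ` (C \<inter> p -` T) = D \<inter> (p \<circ> e') -` T"
    proof (intro equalityI subsetI)
      fix y assume "y \<in> e ` (C \<inter> p -` T)"
      then obtain c where "y = e c" "c \<in> C" "p c \<in> T"
        by blast
      then show "y \<in> D \<inter> (p \<circ> e') -` T"
        using E(3) E(4)[of c] by auto
    next
      fix y assume y: "y \<in> D \<inter> (p \<circ> e') -` T"
      then have "e' y \<in> C \<inter> p -` T" "e (e' y) = y"
        using E(2) E(5)[of y] by auto
      then show "y \<in> e ` (C \<inter> p -` T)"
        by (metis imageI)
    qed
    then show "\<Union>((`) e ` v) = D \<inter> (p \<circ> e') -` T"
      by (simp only: image_Union[symmetric] v(3))
    show "pairwise disjnt ((`) e ` v)"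
      unfolding pairwise_def disjnt_def
    proof (intro ballI impI)
      fix U U' assume U: "U \<in> (`) e ` v" "U' \<in> (`) e ` v" "U \<noteq> U'"
      then obtain u u' where u: "u \<in> v" "U = e ` u" "u' \<in> v" "U' = e ` u'" "u \<noteq> u'"
        by auto
      then have "u \<inter> u' = {}"
        using v(5) by (auto simp: pairwise_def disjnt_def)
      moreover have "inj_on e C"
        using E(4) by (metis inj_onI)
      ultimately show "U \<inter> U' = {}"
        using inj_on_image_Int[of e C u u'] vC[OF u(1)] vC[OF u(3)] u(2,4) by auto
    qed
    fix U assume "U \<in> (`) e ` v"
    then obtain u where u: "u \<in> v" "U = e ` u"
      by auto
    show "openin (top_of_set D) U"
      using homeomorphism_imp_open_map[OF e v(4)[OF u(1)]] u(2) by simp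
    obtain q where q: "homeomorphism u T p q"
      using v(6)[OF u(1)] by blast
    have "homeomorphism U u e' e"
    proof (rule homeomorphism_of_subsets[OF homeomorphism_symD[OF e]])
      show "U \<subseteq> D"
        unfolding u(2) E(3)[symmetric] by (rule image_mono[OF vC[OF u(1)]])
      have "(\<lambda>x. e' (e x)) ` u = (\<lambda>x. x) ` u"
        by (rule image_cong[OF refl], rule E(4), rule subsetD[OF vC[OF u(1)]])
      then show "e' ` U = u"
        by (simp add: u(2) image_image)
    qed (rule vC[OF u(1)])
    from homeomorphism_compose[OF this q] show "\<exists>q. homeomorphism U T (p \<circ> e') q"
      by blast
  qed
qed

lemma universal_covering_connected:
  fixes X :: "'a::real_normed_vector set" and p :: "'b::topological_space \<Rightarrow> 'a"
  assumes "universal_covering C p X" "compact X"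
  shows "connected C"
proof -
  have cov: "covering_space C p X" and sc: "simply_connected C"
    using assms by (auto simp: universal_covering_def)
  obtain e :: "'b \<Rightarrow> 'a \<times> (('a \<times> 'b set) discrete \<Rightarrow>\<^sub>C real)" and e' where e: "homeomorphism C (e ` C) e e'"
    by (rule covering_space_embedding[OF cov assms(2)]) (rule that)
  then have "simply_connected (e ` C)"
    using homeomorphic_simply_connected homeomorphic_def sc by blast
  then have "connected (e ` C)"
    by (rule simply_connected_imp_connected)
  moreover have "continuous_on (e ` C) e'" "e' ` e ` C = C"
    using e by (auto simp: homeomorphism_def)
  ultimately show ?thesis
    by (metis connected_continuous_image)
qed

text \<open>The map p is lifted through itself with a sent to b. Simple connectedness and local path
  connectedness of the covering space, both transported to its embedded copy, give the lifting
  criterion.\<close>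

lemma universal_covering_fibre_map:
  fixes X :: "'a::real_normed_vector set" and p :: "'b::topological_space \<Rightarrow> 'a"
  assumes uc: "universal_covering C p X" and X: "compact X" "locally path_connected X"
    and ab: "a \<in> C" "b \<in> C" "p a = p b"
  obtains g where "continuous_on C g" "g ` C \<subseteq> C" "g a = b" "\<And>x. x \<in> C \<Longrightarrow> p (g x) = p x"
proof -
  have cov: "covering_space C p X" and sc: "simply_connected C"
    using uc by (auto simp: universal_covering_def)
  obtain e :: "'b \<Rightarrow> 'a \<times> (('a \<times> 'b set) discrete \<Rightarrow>\<^sub>C real)" and e'
    where e: "homeomorphism C (e ` C) e e'" and pe: "\<And>x. x \<in> C \<Longrightarrow> fst (e x) = p x"
    by (rule covering_space_embedding[OF cov X(1)]) (rule that)
  have E: "continuous_on C e" "continuous_on (e ` C) e'" "\<And>x. x \<in> C \<Longrightarrow> e' (e x) = x"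
    using e by (auto simp: homeomorphism_def)
  let ?p = "p \<circ> e'"
  have cov': "covering_space (e ` C) ?p X"
    by (rule covering_space_homeomorphism[OF cov e])
  have sc': "simply_connected (e ` C)"
    using homeomorphic_simply_connected homeomorphic_def sc e by blast
  have lp: "locally path_connected (e ` C)"
    using covering_space_locally_path_connected_eq[OF cov'] X(2) by simp
  obtain g where g: "continuous_on (e ` C) g" "g \<in> e ` C \<rightarrow> e ` C" "g (e a) = e b" "\<And>y. y \<in> e ` C \<Longrightarrow> ?p (g y) = ?p y"
  proof (rule covering_space_lift_strong[OF cov', of "e b" "e a" "e ` C" ?p])
    show "continuous_on (e ` C) ?p" "?p \<in> e ` C \<rightarrow> X"
      using cov' by (auto simp: covering_space_def)
  qed (use ab sc' lp E in auto)
  show thesis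
  proof (rule that[of "e' \<circ> g \<circ> e"])
    show "continuous_on C (e' \<circ> g \<circ> e)"
      by (intro continuous_on_compose E(1) continuous_on_subset[OF g(1)] continuous_on_subset[OF E(2)])
        (use g(2) in \<open>auto simp: image_subset_iff\<close>)
    show "(e' \<circ> g \<circ> e) ` C \<subseteq> C"
      using g(2) E(3) by (auto simp: Pi_iff)
    show "(e' \<circ> g \<circ> e) a = b"
      using g(3) E(3) ab by simp
    show "p ((e' \<circ> g \<circ> e) x) = p x" if "x \<in> C" for x
      using g(4)[of "e x"] E(3)[OF that] that by simp
  qed
qed

section \<open>Finite families of open conditions, and local continuity\<close>

lemma openin_finite_Ball:
  assumes "finite I" "openin T S" "\<And>i. i \<in> I \<Longrightarrow> openin T {x \<in> S. P i x}"
  shows "openin T {x \<in> S. \<forall>i\<in>I. P i x}"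
  using assms
proof (induction I)
  case (insert i I)
  have "{x \<in> S. \<forall>j\<in>insert i I. P j x} = {x \<in> S. P i x} \<inter> {x \<in> S. \<forall>j\<in>I. P j x}"
    by blast
  then show ?case
    using insert by (simp add: openin_Int)
qed simp

lemma finite_uniform_lower_bound:
  fixes P :: "'i \<Rightarrow> real \<Rightarrow> bool"
  assumes "finite I" "\<And>i. i \<in> I \<Longrightarrow> \<exists>d>0. P i d" "\<And>i d d'. P i d \<Longrightarrow> d' \<le> d \<Longrightarrow> P i d'"
  shows "\<exists>d>0. \<forall>i\<in>I. P i d"
  using assms(1,2)
proof (induction I)
  case (insert i I)
  obtain d where d: "d > 0" "\<forall>i\<in>I. P i d"
    using insert.IH insert.prems by blast
  obtain d' where d': "d' > 0" "P i d'"
    using insert.prems by blast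
  have "\<forall>j\<in>insert i I. P j (min d d')"
  proof
    fix j assume "j \<in> insert i I"
    then consider "j = i" | "j \<in> I" by blast
    then show "P j (min d d')"
      using d d' assms(3)[of j d "min d d'"] assms(3)[of j d' "min d d'"] by cases auto
  qed
  then show ?case
    using d d' by (intro exI[of _ "min d d'"]) auto
qed (auto intro: exI[of _ 1])

lemma continuous_on_local:
  assumes "\<And>z. z \<in> S \<Longrightarrow> \<exists>N. openin (top_of_set S) N \<and> z \<in> N \<and> continuous_on N f"
  shows "continuous_on S f"
  unfolding continuous_on_topological
proof (intro ballI allI impI)
  fix x B assume x: "x \<in> S" and B: "open B" "f x \<in> B"
  obtain N where N: "openin (top_of_set S) N" "x \<in> N" "continuous_on N f"
    using assms[OF x] by blast
  obtain Q where Q: "open Q" "N = S \<inter> Q"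
    using N(1) by (auto simp: openin_open)
  obtain A where A: "open A" "x \<in> A" "\<forall>y\<in>N. y \<in> A \<longrightarrow> f y \<in> B"
    using N(2,3) B unfolding continuous_on_topological by blast
  show "\<exists>A. open A \<and> x \<in> A \<and> (\<forall>y\<in>S. y \<in> A \<longrightarrow> f y \<in> B)"
    using A Q N(2) by (intro exI[of _ "A \<inter> Q"]) auto
qed

lemma openin_Collect_neq:
  fixes f g :: "'c::topological_space \<Rightarrow> 'a::real_normed_vector"
  assumes "continuous_on S f" "continuous_on S g"
  shows "openin (top_of_set S) {x \<in> S. f x \<noteq> g x}"
proof -
  have "openin (top_of_set S) (S \<inter> (\<lambda>x. f x - g x) -` (- {0}))"
    by (intro continuous_openin_preimage_gen continuous_intros assms)
  moreover have "S \<inter> (\<lambda>x. f x - g x) -` (- {0}) = {x \<in> S. f x \<noteq> g x}"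
    by auto
  ultimately show ?thesis by simp
qed

lemma openin_Collect_less_continuous:
  fixes f g :: "'c::topological_space \<Rightarrow> real"
  assumes "continuous_on S f" "continuous_on S g"
  shows "openin (top_of_set S) {x \<in> S. f x < g x}"
proof -
  have "openin (top_of_set S) (S \<inter> (\<lambda>x. g x - f x) -` {0<..})"
    by (intro continuous_openin_preimage_gen continuous_intros assms)
  moreover have "S \<inter> (\<lambda>x. g x - f x) -` {0<..} = {x \<in> S. f x < g x}"
    by auto
  ultimately show ?thesis by simp
qed

section \<open>Covering transformations of the universal covering\<close>

locale universal_cover =
  fixes X :: "'a::euclidean_space set" and Xt :: "'b::topological_space set" and p :: "'b \<Rightarrow> 'a"
  assumes uc: "universal_covering Xt p X" and compact_X: "compact X" and lpc_X: "locally path_connected X"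
begin

lemma cov: "covering_space Xt p X"
  using uc by (simp add: universal_covering_def)

lemma p_cont: "continuous_on Xt p" and p_image: "p ` Xt = X"
  using cov by (simp_all add: covering_space_def)

lemma p_in: "x \<in> Xt \<Longrightarrow> p x \<in> X"
  using p_image by blast

lemma connected_Xt: "connected Xt"
  by (rule universal_covering_connected[OF uc compact_X])

lemmas lift_unique = covering_space_lift_unique_topological[OF cov]

lemma deck_homeomorphism: "\<alpha> \<in> deck Xt p \<longleftrightarrow>
    \<alpha> \<in> extensional Xt \<and> (\<exists>\<beta>. homeomorphism Xt Xt \<alpha> \<beta>) \<and> (\<forall>x\<in>Xt. p (\<alpha> x) = p x)"
  by (simp add: deck_def homeomorphic_map_maps)

lemma deck_cont: "\<alpha> \<in> deck Xt p \<Longrightarrow> continuous_on Xt \<alpha>"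
  and deck_in: "\<alpha> \<in> deck Xt p \<Longrightarrow> x \<in> Xt \<Longrightarrow> \<alpha> x \<in> Xt"
  and deck_p: "\<alpha> \<in> deck Xt p \<Longrightarrow> x \<in> Xt \<Longrightarrow> p (\<alpha> x) = p x"
  by (auto simp: deck_homeomorphism homeomorphism_def)

lemma deck_eqI:
  assumes "\<alpha> \<in> deck Xt p" "\<beta> \<in> deck Xt p" "x \<in> Xt" "\<alpha> x = \<beta> x"
  shows "\<alpha> = \<beta>"
proof (rule extensionalityI)
  show "\<alpha> \<in> extensional Xt" "\<beta> \<in> extensional Xt"
    using assms by (simp_all add: deck_homeomorphism)
  fix z assume "z \<in> Xt"
  show "\<alpha> z = \<beta> z"
    by (rule lift_unique[OF connected_Xt deck_cont[OF assms(1)] _ deck_cont[OF assms(2)] _ _ assms(3,4) \<open>z \<in> Xt\<close>])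
      (auto simp: assms deck_in deck_p)
qed

lemma deckI:
  assumes g: "continuous_on Xt g" "g ` Xt \<subseteq> Xt" "\<And>x. x \<in> Xt \<Longrightarrow> p (g x) = p x"
    and h: "continuous_on Xt h" "h ` Xt \<subseteq> Xt" "\<And>x. x \<in> Xt \<Longrightarrow> h (g x) = x" "\<And>x. x \<in> Xt \<Longrightarrow> g (h x) = x"
  shows "restrict g Xt \<in> deck Xt p"
  unfolding deck_homeomorphism
proof (intro conjI exI[of _ h])
  show "homeomorphism Xt Xt (restrict g Xt) h"
  proof (rule homeomorphismI)
    show "continuous_on Xt (restrict g Xt)"
      using g(1) by (simp cong: continuous_on_cong)
  qed (use g h in auto)
qed (use g in auto)

text \<open>The lifts taking a to b and b to a compose to self-maps over X with a fixed point;
  uniqueness of lifts makes these the identity, so the two lifts are mutually inverse.\<close>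

lemma deck_exists:
  assumes ab: "a \<in> Xt" "b \<in> Xt" "p a = p b"
  shows "\<exists>\<alpha>\<in>deck Xt p. \<alpha> a = b"
proof -
  obtain g where g: "continuous_on Xt g" "g ` Xt \<subseteq> Xt" "g a = b" "\<And>x. x \<in> Xt \<Longrightarrow> p (g x) = p x"
    by (rule universal_covering_fibre_map[OF uc compact_X lpc_X ab]) (rule that)
  obtain h where h: "continuous_on Xt h" "h ` Xt \<subseteq> Xt" "h b = a" "\<And>x. x \<in> Xt \<Longrightarrow> p (h x) = p x"
    by (rule universal_covering_fibre_map[OF uc compact_X lpc_X ab(2,1) ab(3)[symmetric]]) (rule that)
  have inv: "k' (k z) = z" if k: "continuous_on Xt k" "k ` Xt \<subseteq> Xt" "\<And>x. x \<in> Xt \<Longrightarrow> p (k x) = p x"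
    and k': "continuous_on Xt k'" "k' ` Xt \<subseteq> Xt" "\<And>x. x \<in> Xt \<Longrightarrow> p (k' x) = p x"
    and c: "c \<in> Xt" "k' (k c) = c" and z: "z \<in> Xt" for k k' :: "'b \<Rightarrow> 'b" and c z
  proof (rule lift_unique[where ?g1.0 = "\<lambda>z. k' (k z)" and ?g2.0 = "\<lambda>z. z" and Z = Xt and a = c])
    show "continuous_on Xt (\<lambda>z. k' (k z))"
      by (rule continuous_on_compose2[OF k'(1) k(1) k(2)])
    show "(\<lambda>z. k' (k z)) ` Xt \<subseteq> Xt"
      using k(2) k'(2) by auto
    show "p (k' (k z)) = p z" if "z \<in> Xt" for z
      using k(3)[OF that] k'(3)[of "k z"] k(2) that by auto
  qed (simp_all add: connected_Xt c z continuous_on_id)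
  have "restrict g Xt \<in> deck Xt p"
    by (rule deckI[OF g(1,2,4) h(1,2) inv[OF g(1,2,4) h(1,2,4) ab(1)] inv[OF h(1,2,4) g(1,2,4) ab(2)]])
      (use g(3) h(3) in auto)
  then show ?thesis
    using g(3) ab(1) by (intro bexI[of _ "restrict g Xt"]) auto
qed

lemma deck_inverse:
  assumes "\<alpha> \<in> deck Xt p"
  shows "\<exists>\<beta>\<in>deck Xt p. (\<forall>x\<in>Xt. \<beta> (\<alpha> x) = x) \<and> (\<forall>x\<in>Xt. \<alpha> (\<beta> x) = x)"
proof -
  obtain \<beta> where \<beta>: "homeomorphism Xt Xt \<alpha> \<beta>"
    using assms by (auto simp: deck_homeomorphism)
  have "restrict \<beta> Xt \<in> deck Xt p"
  proof (rule deckI[of _ \<alpha>])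
    show "p (\<beta> x) = p x" if "x \<in> Xt" for x
    proof -
      have "\<beta> x \<in> Xt" "\<alpha> (\<beta> x) = x"
        using \<beta> that by (auto simp: homeomorphism_def)
      then show ?thesis
        using deck_p[OF assms, of "\<beta> x"] by simp
    qed
  qed (use \<beta> in \<open>auto simp: homeomorphism_def\<close>)
  then show ?thesis
    using \<beta> deck_in[OF assms] by (intro bexI[of _ "restrict \<beta> Xt"]) (auto simp: homeomorphism_def)
qed

lemma deck_compose:
  assumes "\<alpha> \<in> deck Xt p" "\<beta> \<in> deck Xt p"
  shows "compose Xt \<alpha> \<beta> \<in> deck Xt p"
proof -
  obtain \<alpha>' \<beta>' where \<alpha>': "homeomorphism Xt Xt \<alpha> \<alpha>'" and \<beta>': "homeomorphism Xt Xt \<beta> \<beta>'"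
    using assms by (auto simp: deck_homeomorphism)
  have h: "homeomorphism Xt Xt (\<alpha> \<circ> \<beta>) (\<beta>' \<circ> \<alpha>')"
    by (rule homeomorphism_compose[OF \<beta>' \<alpha>'])
  have "restrict (\<alpha> \<circ> \<beta>) Xt \<in> deck Xt p"
    by (rule deckI[where h = "\<beta>' \<circ> \<alpha>'"])
      (use h assms in \<open>auto simp: homeomorphism_def deck_in deck_p\<close>)
  then show ?thesis
    by (simp add: compose_def comp_def)
qed

text \<open>The branch j is locally constant: where p (a z) equals one branch, it avoids the
  remaining finitely many on a neighbourhood. On the connected set \<open>Z\<close> it is therefore
  constant, and two lifts of one map differ by a single covering transformation. Applied to a
  coordinate of a lift composed with a covering transformation, this yields the permutation and the
  factors in \<open>lift_hom\<close>, and their analogue for homotopies.\<close>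

lemma multi_lift:
  fixes Z :: "'c::topological_space set"
  assumes Z: "connected Z" "z0 \<in> Z" and J: "finite J"
    and a: "continuous_on Z a" "a ` Z \<subseteq> Xt"
    and b: "\<And>j. j \<in> J \<Longrightarrow> continuous_on Z (b j)" "\<And>j. j \<in> J \<Longrightarrow> b j ` Z \<subseteq> Xt"
    and inj: "\<And>z i j. z \<in> Z \<Longrightarrow> i \<in> J \<Longrightarrow> j \<in> J \<Longrightarrow> p (b i z) = p (b j z) \<Longrightarrow> i = j"
    and sel: "\<And>z. z \<in> Z \<Longrightarrow> \<exists>j\<in>J. p (a z) = p (b j z)"
  shows "\<exists>j\<in>J. \<exists>\<epsilon>\<in>deck Xt p. \<forall>z\<in>Z. a z = \<epsilon> (b j z)"
proof -
  obtain j where j: "j \<in> J" "p (a z0) = p (b j z0)"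
    using sel[OF Z(2)] by blast
  have ca: "continuous_on Z (\<lambda>z. p (a z))"
    by (rule continuous_on_compose2[OF p_cont a])
  have cb: "continuous_on Z (\<lambda>z. p (b l z))" if "l \<in> J" for l
    by (rule continuous_on_compose2[OF p_cont b(1)[OF that] b(2)[OF that]])
  have eq: "p (a z) = p (b j z)" if z: "z \<in> Z" for z
  proof (rule connected_induction_simple[OF Z(1) Z(2) z, of "\<lambda>z. p (a z) = p (b j z)"])
    fix x assume x: "x \<in> Z"
    obtain i where i: "i \<in> J" "p (a x) = p (b i x)"
      using sel[OF x] by blast
    define N where "N = {w \<in> Z. \<forall>l\<in>J - {i}. p (a w) \<noteq> p (b l w)}"
    have "openin (top_of_set Z) N"
      unfolding N_def
      by (intro openin_finite_Ball openin_Collect_neq ca cb) (use J in auto)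
    moreover have "x \<in> N"
      using x i inj[OF x i(1)] by (auto simp: N_def)
    moreover have "p (a w) = p (b j w) \<longleftrightarrow> i = j" if "w \<in> N" for w
      using that sel[of w] j(1) by (auto simp: N_def)
    ultimately show "\<exists>T. openin (top_of_set Z) T \<and> x \<in> T \<and>
        (\<forall>x\<in>T. \<forall>y\<in>T. p (a x) = p (b j x) \<longrightarrow> p (a y) = p (b j y))"
      by (intro exI[of _ N]) auto
  qed (rule j(2))
  have "b j z0 \<in> Xt" "a z0 \<in> Xt"
    using a(2) b(2)[OF j(1)] Z(2) by auto
  then obtain \<epsilon> where \<epsilon>: "\<epsilon> \<in> deck Xt p" "\<epsilon> (b j z0) = a z0"
    using deck_exists[of "b j z0" "a z0"] j(2) by auto
  have "a z = \<epsilon> (b j z)" if z: "z \<in> Z" for z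
  proof (rule lift_unique[where ?g1.0 = a and ?g2.0 = "\<lambda>z. \<epsilon> (b j z)" and Z = Z and a = z0])
    show "continuous_on Z (\<lambda>z. \<epsilon> (b j z))"
      by (rule continuous_on_compose2[OF deck_cont[OF \<epsilon>(1)] b(1)[OF j(1)] b(2)[OF j(1)]])
    show "(\<lambda>z. \<epsilon> (b j z)) ` Z \<subseteq> Xt"
      using b(2)[OF j(1)] deck_in[OF \<epsilon>(1)] by auto
    show "p (a z) = p (\<epsilon> (b j z))" if "z \<in> Z" for z
      using eq[OF that] deck_p[OF \<epsilon>(1), of "b j z"] b(2)[OF j(1)] that by auto
  qed (use Z a \<epsilon>(2) z in auto)
  with j(1) \<epsilon>(1) show ?thesis by blast
qed

end

lemma continuous_map_orbit_confD:
  assumes "continuous_map (top_of_set S) (orbit_conf n Xt p) g"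
  shows "i \<in> {1..n} \<Longrightarrow> continuous_on S (\<lambda>x. g x i)" "i \<in> {1..n} \<Longrightarrow> x \<in> S \<Longrightarrow> g x i \<in> Xt"
    "x \<in> S \<Longrightarrow> g x \<in> extensional {1..n}" "x \<in> S \<Longrightarrow> inj_on (\<lambda>i. p (g x i)) {1..n}"
proof -
  have "continuous_map (top_of_set S) (product_topology (\<lambda>_. top_of_set Xt) {1..n}) g"
    and inj: "x \<in> S \<Longrightarrow> inj_on (\<lambda>i. p (g x i)) {1..n}"
    using assms by (auto simp: orbit_conf_def continuous_map_in_subtopology comp_def)
  then have ext: "g \<in> S \<rightarrow> extensional {1..n}"
    and c: "\<And>i. i \<in> {1..n} \<Longrightarrow> continuous_map (top_of_set S) (top_of_set Xt) (\<lambda>x. g x i)"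
    by (auto simp: continuous_map_componentwise)
  show "i \<in> {1..n} \<Longrightarrow> continuous_on S (\<lambda>x. g x i)" "i \<in> {1..n} \<Longrightarrow> x \<in> S \<Longrightarrow> g x i \<in> Xt"
    using c[of i] by auto
  show "x \<in> S \<Longrightarrow> g x \<in> extensional {1..n}"
    using ext by auto
  show "x \<in> S \<Longrightarrow> inj_on (\<lambda>i. p (g x i)) {1..n}"
    by (rule inj)
qed

section \<open>Multivalued maps with local splittings\<close>

text \<open>Continuity of an n-valued map phrased through n disjoint local branches. A map with a
  lift has such branches by composing with local sections of p, so this form is available without
  unpacking the quotient topology.\<close>

definition locally_splits :: "nat \<Rightarrow> 'c::topological_space set \<Rightarrow> ('c \<Rightarrow> 'a::topological_space set) \<Rightarrow> bool" where
  "locally_splits n S h \<longleftrightarrow> (\<forall>z\<in>S. \<exists>N a. openin (top_of_set S) N \<and> z \<in> N \<and>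
     (\<forall>i\<in>{1..n}. continuous_on N (a i)) \<and>
     (\<forall>w\<in>N. inj_on (\<lambda>i. a i w) {1..n} \<and> h w = (\<lambda>i. a i w) ` {1..n}))"

lemma locally_splitsE:
  assumes "locally_splits n S h" "z \<in> S"
  obtains N a where "openin (top_of_set S) N" "z \<in> N" "\<And>i. i \<in> {1..n} \<Longrightarrow> continuous_on N (a i)"
    "\<And>w i j. w \<in> N \<Longrightarrow> i \<in> {1..n} \<Longrightarrow> j \<in> {1..n} \<Longrightarrow> a i w = a j w \<Longrightarrow> i = j"
    "\<And>w. w \<in> N \<Longrightarrow> h w = (\<lambda>i. a i w) ` {1..n}"
proof -
  obtain N a where N: "openin (top_of_set S) N" "z \<in> N" "\<forall>i\<in>{1..n}. continuous_on N (a i)"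
    "\<forall>w\<in>N. inj_on (\<lambda>i. a i w) {1..n} \<and> h w = (\<lambda>i. a i w) ` {1..n}"
    using bspec[OF assms(1)[unfolded locally_splits_def] assms(2)] by (elim exE conjE)
  show thesis
  proof (rule that[OF N(1,2)])
    show "continuous_on N (a i)" if "i \<in> {1..n}" for i
      using N(3) that by (rule bspec)
    show "i = j" if "w \<in> N" "i \<in> {1..n}" "j \<in> {1..n}" "a i w = a j w" for w i j
      using bspec[OF N(4) that(1)] that(2-4) by (auto dest: inj_onD)
    show "h w = (\<lambda>i. a i w) ` {1..n}" if "w \<in> N" for w
      using bspec[OF N(4) that] by (rule conjunct2)
  qed
qed

text \<open>Near one point the finitely many branches keep their pairwise distances above a positive
  bound by continuity, and finitely many such neighbourhoods cover the compact set
  \<open>S\<close>.\<close>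

lemma locally_splits_separated:
  fixes h :: "'c::topological_space \<Rightarrow> 'a::real_normed_vector set"
  assumes h: "locally_splits n S h" and S: "compact S"
  shows "\<exists>\<epsilon>>0. \<forall>z\<in>S. \<forall>y\<in>h z. \<forall>y'\<in>h z. y \<noteq> y' \<longrightarrow> \<epsilon> \<le> dist y y'"
proof -
  define sep where "sep N d \<longleftrightarrow> (\<forall>z\<in>N. \<forall>y\<in>h z. \<forall>y'\<in>h z. y \<noteq> y' \<longrightarrow> d \<le> dist y y')" for N d
  define \<C> where "\<C> = {N. openin (top_of_set S) N \<and> (\<exists>d>0. sep N d)}"
  have "\<exists>N\<in>\<C>. z \<in> N" if z: "z \<in> S" for z
  proof -
    obtain N a where N: "openin (top_of_set S) N" "z \<in> N" "\<And>i. i \<in> {1..n} \<Longrightarrow> continuous_on N (a i)"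
      and inj: "\<And>w i j. w \<in> N \<Longrightarrow> i \<in> {1..n} \<Longrightarrow> j \<in> {1..n} \<Longrightarrow> a i w = a j w \<Longrightarrow> i = j"
      and ha: "\<And>w. w \<in> N \<Longrightarrow> h w = (\<lambda>i. a i w) ` {1..n}"
      by (rule locally_splitsE[OF h z]) (rule that)
    let ?I = "{(i, j). i \<in> {1..n} \<and> j \<in> {1..n} \<and> i \<noteq> j}"
    have fin: "finite ?I"
      by (rule finite_subset[of _ "{1..n} \<times> {1..n}"]) auto
    have "\<exists>d>0. \<forall>ij\<in>?I. d < dist (a (fst ij) z) (a (snd ij) z)"
    proof (rule finite_uniform_lower_bound[OF fin])
      fix ij assume "ij \<in> ?I"
      then have "a (fst ij) z \<noteq> a (snd ij) z"
        using inj[OF N(2), of "fst ij" "snd ij"] by auto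
      then show "\<exists>d>0. d < dist (a (fst ij) z) (a (snd ij) z)"
        by (intro exI[of _ "dist (a (fst ij) z) (a (snd ij) z) / 2"]) simp
    qed auto
    then obtain d where d: "d > 0" "\<forall>ij\<in>?I. d < dist (a (fst ij) z) (a (snd ij) z)"
      by blast
    define N' where "N' = {w \<in> N. \<forall>ij\<in>?I. d < dist (a (fst ij) w) (a (snd ij) w)}"
    have "openin (top_of_set N) N'"
      unfolding N'_def by (intro openin_finite_Ball fin openin_Collect_less_continuous continuous_intros N(3)) auto
    then have "openin (top_of_set S) N'"
      using N(1) openin_trans by blast
    moreover have "sep N' d"
      unfolding sep_def
    proof (intro ballI impI)
      fix w y y' assume w: "w \<in> N'" "y \<in> h w" "y' \<in> h w" "y \<noteq> y'"
      have "w \<in> N" using w(1) by (simp add: N'_def)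
      then obtain i j where ij: "i \<in> {1..n}" "j \<in> {1..n}" "y = a i w" "y' = a j w"
        using w(2,3) unfolding ha[OF \<open>w \<in> N\<close>] by blast
      have "(i, j) \<in> ?I"
        using ij w(4) by auto
      then have "d < dist (a (fst (i, j)) w) (a (snd (i, j)) w)"
        using w(1) unfolding N'_def by blast
      then show "d \<le> dist y y'"
        by (simp add: ij)
    qed
    moreover have "z \<in> N'"
      using N(2) d(2) by (simp add: N'_def)
    ultimately show ?thesis
      using d(1) unfolding \<C>_def by blast
  qed
  then have "S \<subseteq> \<Union>\<C>"
    by blast
  moreover have "\<forall>N\<in>\<C>. openin (top_of_set S) N"
    by (simp add: \<C>_def)
  ultimately have "\<exists>D\<subseteq>\<C>. finite D \<and> S \<subseteq> \<Union>D"
    using S[unfolded compact_eq_openin_cover, THEN spec, of \<C>] by (simp only:)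
  then obtain D where D: "D \<subseteq> \<C>" "finite D" "S \<subseteq> \<Union>D"
    by (elim exE conjE)
  have "\<exists>d>0. \<forall>N\<in>D. sep N d"
  proof (rule finite_uniform_lower_bound[OF D(2)])
    show "\<exists>d>0. sep N d" if "N \<in> D" for N
      using subsetD[OF D(1) that] by (simp add: \<C>_def)
    show "sep N d'" if "sep N d" "d' \<le> d" for N d d'
      using that unfolding sep_def by (meson order_trans)
  qed
  then obtain d where "d > 0" "\<forall>N\<in>D. sep N d"
    by blast
  then show ?thesis
    using D(3) unfolding sep_def by (intro exI[of _ d]) blast
qed

text \<open>Since distinct values stay at distance at least \<open>\<epsilon>\<close>, a value within \<open>\<epsilon> / 2\<close> of the argument is unique;
  choosing it gives a selection near the whole fixed point set.\<close>

lemma near_diagonal_selection: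
  fixes h :: "'c::topological_space \<Rightarrow> 'a::real_normed_vector set" and \<pi> :: "'c \<Rightarrow> 'a"
  assumes h: "locally_splits n S h" and S: "compact S" and \<pi>: "continuous_on S \<pi>"
  obtains \<Omega> \<Phi> where "openin (top_of_set S) \<Omega>" "continuous_on \<Omega> \<Phi>" "\<And>z. z \<in> \<Omega> \<Longrightarrow> \<Phi> z \<in> h z"
    "\<And>z. z \<in> S \<Longrightarrow> \<pi> z \<in> h z \<Longrightarrow> z \<in> \<Omega> \<and> \<Phi> z = \<pi> z"
proof -
  obtain \<epsilon> where \<epsilon>: "\<epsilon> > 0" "\<And>z y y'. z \<in> S \<Longrightarrow> y \<in> h z \<Longrightarrow> y' \<in> h z \<Longrightarrow> y \<noteq> y' \<Longrightarrow> \<epsilon> \<le> dist y y'"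
    using locally_splits_separated[OF h S] by metis
  define \<Omega> where "\<Omega> = {z \<in> S. \<exists>y\<in>h z. dist (\<pi> z) y < \<epsilon> / 2}"
  define \<Phi> where "\<Phi> z = (THE y. y \<in> h z \<and> dist (\<pi> z) y < \<epsilon> / 2)" for z
  have \<Phi>_eq: "\<Phi> z = y" if "z \<in> S" "y \<in> h z" "dist (\<pi> z) y < \<epsilon> / 2" for z y
    unfolding \<Phi>_def
  proof (rule the_equality)
    fix y' assume y': "y' \<in> h z \<and> dist (\<pi> z) y' < \<epsilon> / 2"
    have "dist y y' \<le> dist (\<pi> z) y + dist (\<pi> z) y'"
      by (rule dist_triangle3)
    then have "dist y y' < \<epsilon>"
      using that(3) y' by simp
    then show "y' = y"
      using \<epsilon>(2)[OF that(1) _ that(2), of y'] y' by (auto simp: dist_commute)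
  qed (use that in auto)
  have \<Omega>: "\<exists>N a. openin (top_of_set S) N \<and> z \<in> N \<and> continuous_on N a \<and> N \<subseteq> \<Omega> \<and> (\<forall>w\<in>N. \<Phi> w = a w)"
    if z: "z \<in> \<Omega>" for z
  proof -
    have zS: "z \<in> S" using z by (simp add: \<Omega>_def)
    obtain N a where N: "openin (top_of_set S) N" "z \<in> N" "\<And>i. i \<in> {1..n} \<Longrightarrow> continuous_on N (a i)"
      and ha: "\<And>w. w \<in> N \<Longrightarrow> h w = (\<lambda>i. a i w) ` {1..n}"
      by (rule locally_splitsE[OF h zS]) (rule that)
    have NS: "N \<subseteq> S"
      using N(1) by (rule openin_imp_subset)
    obtain j where j: "j \<in> {1..n}" "dist (\<pi> z) (a j z) < \<epsilon> / 2"
      using z unfolding \<Omega>_def ha[OF N(2)] mem_Collect_eq ha[OF N(2)] by blast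
    define N' where "N' = {w \<in> N. dist (\<pi> w) (a j w) < \<epsilon> / 2}"
    have "openin (top_of_set N) N'"
      unfolding N'_def
      by (intro openin_Collect_less_continuous continuous_intros continuous_on_subset[OF \<pi> NS] N(3) j)
    then have "openin (top_of_set S) N'"
      using N(1) openin_trans by blast
    moreover have "w \<in> \<Omega>" "\<Phi> w = a j w" if "w \<in> N'" for w
    proof -
      have w: "w \<in> S" "a j w \<in> h w" "dist (\<pi> w) (a j w) < \<epsilon> / 2"
        using that NS j(1) ha by (auto simp: N'_def)
      then show "w \<in> \<Omega>" "\<Phi> w = a j w"
        using \<Phi>_eq by (auto simp: \<Omega>_def)
    qed
    moreover have "continuous_on N' (a j)"
      by (rule continuous_on_subset[OF N(3)[OF j(1)]]) (auto simp: N'_def)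
    ultimately show ?thesis
      using N(2) j(2) by (intro exI[of _ N'] exI[of _ "a j"]) (auto simp: N'_def)
  qed
  show thesis
  proof (rule that)
    show "openin (top_of_set S) \<Omega>"
      using \<Omega> by (subst openin_subopen) meson
    show "continuous_on \<Omega> \<Phi>"
    proof (rule continuous_on_local)
      fix z assume "z \<in> \<Omega>"
      then obtain N a where N: "openin (top_of_set S) N" "z \<in> N" "continuous_on N a" "N \<subseteq> \<Omega>" "\<forall>w\<in>N. \<Phi> w = a w"
        using \<Omega> by meson
      have "\<Omega> \<subseteq> S"
        by (auto simp: \<Omega>_def)
      then have "openin (top_of_set \<Omega>) N"
        using N(1,4) by (meson openin_subset_trans)
      moreover have "continuous_on N \<Phi>"
        using N(3,5) by (simp cong: continuous_on_cong)
      ultimately show "\<exists>N. openin (top_of_set \<Omega>) N \<and> z \<in> N \<and> continuous_on N \<Phi>"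
        using N(2) by blast
    qed
    show "\<Phi> z \<in> h z" if "z \<in> \<Omega>" for z
      using that \<Phi>_eq by (auto simp: \<Omega>_def)
    show "z \<in> \<Omega> \<and> \<Phi> z = \<pi> z" if "z \<in> S" "\<pi> z \<in> h z" for z
      using that \<Phi>_eq[of z "\<pi> z"] \<epsilon>(1) by (auto simp: \<Omega>_def intro!: bexI[of _ "\<pi> z"])
  qed
qed

text \<open>If both selections take the branch i at x, they avoid the other finitely many branches
  on a neighbourhood and must both follow branch i there. This is what frees the index of a class
  from the choice of selection.\<close>

lemma openin_selections_agree:
  fixes f :: "'a::real_normed_vector \<Rightarrow> 'a set"
  assumes f: "locally_splits n X f"
    and W: "openin (top_of_set X) W" "continuous_on W \<phi>" "\<And>x. x \<in> W \<Longrightarrow> \<phi> x \<in> f x"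
    and W': "openin (top_of_set X) W'" "continuous_on W' \<phi>'" "\<And>x. x \<in> W' \<Longrightarrow> \<phi>' x \<in> f x"
  shows "openin (top_of_set X) {x \<in> W \<inter> W'. \<phi> x = \<phi>' x}"
proof (subst openin_subopen, intro ballI)
  fix x assume x: "x \<in> {x \<in> W \<inter> W'. \<phi> x = \<phi>' x}"
  then have "x \<in> X"
    using openin_imp_subset[OF W(1)] by blast
  then obtain N a where N: "openin (top_of_set X) N" "x \<in> N" "\<And>i. i \<in> {1..n} \<Longrightarrow> continuous_on N (a i)"
    and inj: "\<And>w i j. w \<in> N \<Longrightarrow> i \<in> {1..n} \<Longrightarrow> j \<in> {1..n} \<Longrightarrow> a i w = a j w \<Longrightarrow> i = j"
    and fa: "\<And>w. w \<in> N \<Longrightarrow> f w = (\<lambda>i. a i w) ` {1..n}"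
    by (rule locally_splitsE[OF f]) (rule that)
  have "\<phi> x \<in> f x"
    by (rule W(3)) (use x in simp)
  then obtain i where i: "i \<in> {1..n}" "\<phi> x = a i x"
    unfolding fa[OF N(2)] by blast
  define M where "M = N \<inter> (W \<inter> W')"
  define T where "T = {w \<in> M. \<forall>l\<in>{1..n} - {i}. \<phi> w \<noteq> a l w} \<inter> {w \<in> M. \<forall>l\<in>{1..n} - {i}. \<phi>' w \<noteq> a l w}"
  have M: "openin (top_of_set X) M"
    unfolding M_def by (intro openin_Int N W W')
  have "openin (top_of_set M) T"
    unfolding T_def
    by (intro openin_Int openin_finite_Ball openin_Collect_neq continuous_on_subset[OF W(2)]
        continuous_on_subset[OF W'(2)] continuous_on_subset[OF N(3)]) (auto simp: M_def)
  then have "openin (top_of_set X) T"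
    using M openin_trans by blast
  moreover have "x \<in> T"
  proof -
    have xW: "x \<in> W" "x \<in> W'" "\<phi>' x = \<phi> x"
      using x by simp_all
    have "a i x \<noteq> a l x" if "l \<in> {1..n} - {i}" for l
      using inj[OF N(2) i(1), of l] that by blast
    then show ?thesis
      unfolding T_def M_def Int_iff mem_Collect_eq xW(3) i(2) using N(2) xW(1,2) by blast
  qed
  moreover have "T \<subseteq> {x \<in> W \<inter> W'. \<phi> x = \<phi>' x}"
  proof
    fix w assume w: "w \<in> T"
    then have wM: "w \<in> N" "w \<in> W" "w \<in> W'"
      by (auto simp: T_def M_def)
    have "\<phi> w \<in> (\<lambda>i. a i w) ` {1..n}" "\<phi>' w \<in> (\<lambda>i. a i w) ` {1..n}"
      using W(3)[OF wM(2)] W'(3)[OF wM(3)] fa[OF wM(1)] by simp_all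
    then have "\<phi> w = a i w" "\<phi>' w = a i w"
      using w unfolding T_def by blast+
    then show "w \<in> {x \<in> W \<inter> W'. \<phi> x = \<phi>' x}"
      using wM by simp
  qed
  ultimately show "\<exists>T. openin (top_of_set X) T \<and> x \<in> T \<and> T \<subseteq> {x \<in> W \<inter> W'. \<phi> x = \<phi>' x}"
    by blast
qed

text \<open>Resolves the description in \<open>class_index\<close>. Two admissible selections agree
  on an open set \<open>V\<close> that still contains C, and the fixed points of either lie in C, so
  both indices restrict to \<open>V\<close>, where the index is unique.\<close>

lemma class_index_eqI:
  fixes X :: "'a::euclidean_space set"
  assumes f: "locally_splits n X f"
    and W: "openin (top_of_set X) W" "C \<subseteq> W" "Fix X f \<inter> W = C" "continuous_on W \<phi>" "\<phi> ` W \<subseteq> X"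
      "\<And>x. x \<in> W \<Longrightarrow> \<phi> x \<in> f x" "\<And>x. x \<in> C \<Longrightarrow> \<phi> x = x"
    and k: "has_fixed_point_index X W \<phi> k"
  shows "class_index X f C = k"
proof -
  have fp: "x \<in> C" if "x \<in> W" "\<phi> x = x" "openin (top_of_set X) W" "Fix X f \<inter> W = C" "\<And>x. x \<in> W \<Longrightarrow> \<phi> x \<in> f x" for x W \<phi>
  proof -
    have "x \<in> X" "x \<in> f x"
      using that(1,2) that(5)[OF that(1)] openin_imp_subset[OF that(3)] by auto
    with that(1,4) show ?thesis
      by (auto simp: Fix_def)
  qed
  show ?thesis
  proof (cases "C = {}")
    case True
    \<comment> \<open>The value that \<open>class_index\<close> assigns to the empty class agrees
      with the index of a map without fixed points.\<close>
    have "k = 0"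
      by (rule has_fixed_point_index_empty[OF W(1,4,5) _ k]) (use fp[OF _ _ W(1,3,6)] True in blast)
    with True show ?thesis
      by (simp add: class_index_def)
  next
    case False
    have "(THE k. \<exists>W \<phi>. openin (top_of_set X) W \<and> C \<subseteq> W \<and> Fix X f \<inter> W = C \<and> continuous_on W \<phi> \<and> \<phi> ` W \<subseteq> X \<and>
        (\<forall>x\<in>W. \<phi> x \<in> f x) \<and> (\<forall>x\<in>C. \<phi> x = x) \<and> has_fixed_point_index X W \<phi> k) = k"
    proof (rule the_equality)
      show "\<exists>W \<phi>. openin (top_of_set X) W \<and> C \<subseteq> W \<and> Fix X f \<inter> W = C \<and> continuous_on W \<phi> \<and> \<phi> ` W \<subseteq> X \<and>
        (\<forall>x\<in>W. \<phi> x \<in> f x) \<and> (\<forall>x\<in>C. \<phi> x = x) \<and> has_fixed_point_index X W \<phi> k"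
        by (intro exI[of _ W] exI[of _ \<phi>] conjI ballI W k)
      fix k' assume "\<exists>W \<phi>. openin (top_of_set X) W \<and> C \<subseteq> W \<and> Fix X f \<inter> W = C \<and> continuous_on W \<phi> \<and> \<phi> ` W \<subseteq> X \<and>
        (\<forall>x\<in>W. \<phi> x \<in> f x) \<and> (\<forall>x\<in>C. \<phi> x = x) \<and> has_fixed_point_index X W \<phi> k'"
      then obtain W' \<phi>' where W': "openin (top_of_set X) W'" "C \<subseteq> W'" "Fix X f \<inter> W' = C" "continuous_on W' \<phi>'" "\<phi>' ` W' \<subseteq> X"
          "\<forall>x\<in>W'. \<phi>' x \<in> f x" "\<forall>x\<in>C. \<phi>' x = x" "has_fixed_point_index X W' \<phi>' k'"
        by (elim exE conjE)
      note W6 = bspec[OF W'(6)] and W7 = bspec[OF W'(7)]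
      define V where "V = {x \<in> W \<inter> W'. \<phi> x = \<phi>' x}"
      have oV: "openin (top_of_set X) V"
        unfolding V_def by (rule openin_selections_agree[OF f W(1,4,6) W'(1,4) W6])
      have CV: "C \<subseteq> V"
        using W(2) W'(2) W(7) W7 by (auto simp: V_def)
      have "has_fixed_point_index X V \<phi> k"
      proof (rule has_fixed_point_index_restrict[OF W(1,4,5) oV _ refl _ k])
        show "x \<in> V" if "x \<in> W" "\<phi> x = x" for x
          by (rule subsetD[OF CV fp[OF that W(1,3,6)]])
      qed (auto simp: V_def)
      moreover have "has_fixed_point_index X V \<phi> k'"
      proof (rule has_fixed_point_index_restrict[OF W'(1,4,5) oV _ _ _ W'(8)])
        show "x \<in> V" if "x \<in> W'" "\<phi>' x = x" for x
          by (rule subsetD[OF CV fp[OF that W'(1,3) W6]])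
      qed (auto simp: V_def)
      moreover have "continuous_on V \<phi>" "\<phi> ` V \<subseteq> X"
        using W(5) by (auto simp: V_def intro: continuous_on_subset[OF W(4)])
      ultimately show "k' = k"
        using has_fixed_point_index_unique[OF oV] by blast
    qed
    with False show ?thesis
      by (simp add: class_index_def)
  qed
qed

section \<open>Invariance of the class index under lifted homotopies\<close>

lemma locally_splits_slice:
  assumes h: "locally_splits n (X \<times> {0..1::real}) h" and t: "t \<in> {0..1}" and f: "\<And>x. x \<in> X \<Longrightarrow> f x = h (x, t)"
  shows "locally_splits n X f"
  unfolding locally_splits_def
proof
  fix x assume x: "x \<in> X"
  then have "(x, t) \<in> X \<times> {0..1}"
    using t by simp
  then obtain N a where N: "openin (top_of_set (X \<times> {0..1})) N" "(x, t) \<in> N" "\<And>i. i \<in> {1..n} \<Longrightarrow> continuous_on N (a i)"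
      and inj: "\<And>w i j. w \<in> N \<Longrightarrow> i \<in> {1..n} \<Longrightarrow> j \<in> {1..n} \<Longrightarrow> a i w = a j w \<Longrightarrow> i = j"
      and ha: "\<And>w. w \<in> N \<Longrightarrow> h w = (\<lambda>i. a i w) ` {1..n}"
    by (rule locally_splitsE[OF h]) (rule that)
  define M where "M = X \<inter> (\<lambda>y. (y, t)) -` N"
  have c: "continuous_on A (\<lambda>y. (y, t))" for A
    by (intro continuous_intros)
  have M: "openin (top_of_set X) M"
    unfolding M_def by (rule continuous_openin_preimage[OF c _ N(1)]) (use t in auto)
  have MN: "(y, t) \<in> N" "y \<in> X" if "y \<in> M" for y
    using that by (auto simp: M_def)
  show "\<exists>N a. openin (top_of_set X) N \<and> x \<in> N \<and> (\<forall>i\<in>{1..n}. continuous_on N (a i)) \<and>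
      (\<forall>w\<in>N. inj_on (\<lambda>i. a i w) {1..n} \<and> f w = (\<lambda>i. a i w) ` {1..n})"
  proof (intro exI[of _ M] exI[of _ "\<lambda>i y. a i (y, t)"] conjI ballI M)
    show "x \<in> M"
      using x N(2) by (simp add: M_def)
    show "continuous_on M (\<lambda>y. a i (y, t))" if "i \<in> {1..n}" for i
      by (rule continuous_on_compose2[OF N(3)[OF that] c]) (use MN in auto)
    show "inj_on (\<lambda>i. a i (w, t)) {1..n}" if "w \<in> M" for w
      using inj[OF MN(1)[OF that]] by (intro inj_onI)
    show "f w = (\<lambda>i. a i (w, t)) ` {1..n}" if "w \<in> M" for w
      using f[OF MN(2)[OF that]] ha[OF MN(1)[OF that]] by (rule trans)
  qed
qed

locale lifted_homotopy = universal_cover X Xt p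
  for X :: "'a::euclidean_space set" and Xt :: "'b::topological_space set" and p +
  fixes n :: nat and h :: "'a \<times> real \<Rightarrow> 'a set" and hb :: "'b \<times> real \<Rightarrow> nat \<Rightarrow> 'b"
  assumes lift: "lifts_homotopy n Xt p h hb"
begin

lemma hb_cont: "i \<in> {1..n} \<Longrightarrow> continuous_on (Xt \<times> {0..1}) (\<lambda>z. hb z i)"
  and hb_in: "i \<in> {1..n} \<Longrightarrow> x \<in> Xt \<Longrightarrow> t \<in> {0..1} \<Longrightarrow> hb (x, t) i \<in> Xt"
  and hb_inj: "x \<in> Xt \<Longrightarrow> t \<in> {0..1} \<Longrightarrow> i \<in> {1..n} \<Longrightarrow> j \<in> {1..n} \<Longrightarrow> p (hb (x, t) i) = p (hb (x, t) j) \<Longrightarrow> i = j"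
  and h_eq: "x \<in> Xt \<Longrightarrow> t \<in> {0..1} \<Longrightarrow> h (p x, t) = (\<lambda>i. p (hb (x, t) i)) ` {1..n}"
proof -
  have c: "continuous_map (top_of_set (Xt \<times> {0..1})) (orbit_conf n Xt p) hb"
    and e: "\<And>x t. x \<in> Xt \<Longrightarrow> t \<in> {0..1} \<Longrightarrow> conf_proj n p (hb (x, t)) = h (p x, t)"
    using lift by (simp_all add: lifts_homotopy_def)
  note d = continuous_map_orbit_confD[OF c]
  show "i \<in> {1..n} \<Longrightarrow> continuous_on (Xt \<times> {0..1}) (\<lambda>z. hb z i)"
    "i \<in> {1..n} \<Longrightarrow> x \<in> Xt \<Longrightarrow> t \<in> {0..1} \<Longrightarrow> hb (x, t) i \<in> Xt"
    using d(1,2) by auto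
  show "x \<in> Xt \<Longrightarrow> t \<in> {0..1} \<Longrightarrow> i \<in> {1..n} \<Longrightarrow> j \<in> {1..n} \<Longrightarrow> p (hb (x, t) i) = p (hb (x, t) j) \<Longrightarrow> i = j"
    using d(4)[of "(x, t)"] by (auto dest: inj_onD)
  show "x \<in> Xt \<Longrightarrow> t \<in> {0..1} \<Longrightarrow> h (p x, t) = (\<lambda>i. p (hb (x, t) i)) ` {1..n}"
    using e[of x t] by (simp add: conf_proj_def comp_def)
qed

lemma h_subset:
  assumes "z \<in> X \<times> {0..1}"
  shows "h z \<subseteq> X"
proof -
  obtain x where x: "x \<in> Xt" "p x = fst z"
    using assms p_image by force
  then have "h z = (\<lambda>i. p (hb (x, snd z) i)) ` {1..n}"
    using h_eq[of x "snd z"] assms by auto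
  then show ?thesis
    using hb_in x assms p_in by auto
qed

lemma section_cont:
  assumes "homeomorphism T U p q" "T \<subseteq> Xt" "i \<in> {1..n}"
  shows "continuous_on (U \<times> {0..1}) (\<lambda>w. hb (q (fst w), snd w) i)"
proof (rule continuous_on_compose2[OF hb_cont[OF assms(3)]])
  have q: "continuous_on U q" "q ` U = T"
    using assms(1) by (auto simp: homeomorphism_def)
  show "continuous_on (U \<times> {0..1::real}) (\<lambda>w. (q (fst w), snd w))"
    by (intro continuous_intros continuous_on_compose2[OF q(1)]) auto
  show "(\<lambda>w. (q (fst w), snd w)) ` (U \<times> {0..1}) \<subseteq> Xt \<times> {0..1}"
    using q(2) assms(2) by auto
qed

lemma local_section:
  assumes "x \<in> Xt"
  obtains T U q where "x \<in> T" "openin (top_of_set Xt) T" "T \<subseteq> Xt" "openin (top_of_set X) U"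
    "homeomorphism T U p q" "q (p x) = x" "\<And>y. y \<in> U \<Longrightarrow> q y \<in> T" "\<And>y. y \<in> U \<Longrightarrow> p (q y) = y" "p x \<in> U"
    "openin (top_of_set (X \<times> {0..1::real})) (U \<times> {0..1})"
proof -
  obtain T U q where T: "x \<in> T" "openin (top_of_set Xt) T" "p x \<in> U" "openin (top_of_set X) U"
    "homeomorphism T U p q"
    by (rule covering_space_local_homeomorphism[OF cov assms]) (rule that)
  show thesis
  proof (rule that[OF T(1,2) _ T(4,5)])
    show "T \<subseteq> Xt"
      using T(2) by (rule openin_imp_subset)
    show "q (p x) = x"
      using T(5,1) by (rule homeomorphism_apply1)
    show "q y \<in> T" if "y \<in> U" for y
      using T(5) that by (auto simp: homeomorphism_def)
    show "p (q y) = y" if "y \<in> U" for y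
      using T(5) that by (rule homeomorphism_apply2)
    show "openin (top_of_set (X \<times> {0..1::real})) (U \<times> {0..1})"
      by (intro openin_Times T openin_subtopology_self)
  qed (rule T(3))
qed

text \<open>A section q of p over an open set U yields the branches p (hb (q x, t) i), valid for all
  times at once because U \<times> [0,1] is open in the product.\<close>

lemma h_splits: "locally_splits n (X \<times> {0..1}) h"
  unfolding locally_splits_def
proof
  fix z assume z: "z \<in> X \<times> {0..1::real}"
  then obtain x where x: "x \<in> Xt" "p x = fst z"
    using p_image by force
  obtain T U q where T: "T \<subseteq> Xt" "homeomorphism T U p q" "\<And>y. y \<in> U \<Longrightarrow> q y \<in> T" "\<And>y. y \<in> U \<Longrightarrow> p (q y) = y"
     "p x \<in> U" "openin (top_of_set (X \<times> {0..1::real})) (U \<times> {0..1})"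
    by (rule local_section[OF x(1)]) (rule that)
  show "\<exists>N a. openin (top_of_set (X \<times> {0..1})) N \<and> z \<in> N \<and> (\<forall>i\<in>{1..n}. continuous_on N (a i)) \<and>
      (\<forall>w\<in>N. inj_on (\<lambda>i. a i w) {1..n} \<and> h w = (\<lambda>i. a i w) ` {1..n})"
  proof (intro exI[of _ "U \<times> {0..1}"] exI[of _ "\<lambda>i w. p (hb (q (fst w), snd w) i)"] conjI ballI T(6))
    show "z \<in> U \<times> {0..1}"
      using z x(2) T(5) by auto
    show "continuous_on (U \<times> {0..1}) (\<lambda>w. p (hb (q (fst w), snd w) i))" if i: "i \<in> {1..n}" for i
      by (rule continuous_on_compose2[OF p_cont section_cont[OF T(2,1) i]])
        (use subsetD[OF T(1) T(3)] hb_in[OF i] in auto)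
    fix w assume "w \<in> U \<times> {0..1::real}"
    then have w: "q (fst w) \<in> Xt" "p (q (fst w)) = fst w" "snd w \<in> {0..1}"
      using T(1,3,4) by auto
    show "inj_on (\<lambda>i. p (hb (q (fst w), snd w) i)) {1..n}"
      using hb_inj[OF w(1,3)] by (intro inj_onI)
    show "h w = (\<lambda>i. p (hb (q (fst w), snd w) i)) ` {1..n}"
      using h_eq[OF w(1,3)] w(2) by simp
  qed
qed

text \<open>The fixed point class of the fat homotopy \<open>(x, t) \<mapsto> h (x, t) \<times> {t}\<close> determined by one lift; its slices
  are fixed point classes of the maps \<open>h (_, t)\<close>.\<close>

definition track :: "('b \<Rightarrow> 'b) \<Rightarrow> nat \<Rightarrow> ('a \<times> real) set" where
  "track \<beta> i = {z. snd z \<in> {0..1} \<and> (\<exists>x\<in>Xt. p x = fst z \<and> \<beta> (hb (x, snd z) i) = x)}"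

definition fixed_pairs :: "('a \<times> real) set" where
  "fixed_pairs = {z \<in> X \<times> {0..1}. fst z \<in> h z}"

lemma track_subset:
  assumes "\<beta> \<in> deck Xt p" "i \<in> {1..n}"
  shows "track \<beta> i \<subseteq> fixed_pairs"
proof
  fix z assume "z \<in> track \<beta> i"
  then obtain x where x: "x \<in> Xt" "p x = fst z" "\<beta> (hb (x, snd z) i) = x" and t: "snd z \<in> {0..1}"
    by (auto simp: track_def)
  have "p (hb (x, snd z) i) = fst z"
    using deck_p[OF assms(1) hb_in[OF assms(2) x(1) t]] x by simp
  moreover have "h z = (\<lambda>i. p (hb (x, snd z) i)) ` {1..n}"
    using h_eq[OF x(1) t] x(2) by simp
  ultimately have "fst z \<in> h z"
    using assms(2) by (metis imageI)
  then show "z \<in> fixed_pairs"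
    using t p_in[OF x(1)] x(2) by (auto simp: fixed_pairs_def mem_Times_iff)
qed

lemma hb_deck:
  assumes "\<delta> \<in> deck Xt p" "i \<in> {1..n}" "x0 \<in> Xt"
  shows "\<exists>j\<in>{1..n}. \<exists>\<epsilon>\<in>deck Xt p. \<forall>x\<in>Xt. \<forall>t\<in>{0..1}. hb (\<delta> x, t) i = \<epsilon> (hb (x, t) j)"
proof -
  have c: "continuous_on (Xt \<times> {0..1::real}) (\<lambda>z. (\<delta> (fst z), snd z))"
    by (intro continuous_intros continuous_on_compose2[OF deck_cont[OF assms(1)]]) auto
  have "\<exists>j\<in>{1..n}. \<exists>\<epsilon>\<in>deck Xt p. \<forall>z\<in>Xt \<times> {0..1}. hb (\<delta> (fst z), snd z) i = \<epsilon> (hb z j)"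
  proof (rule multi_lift[of _ "(x0, 0)"])
    show "connected (Xt \<times> {0..1::real})"
      by (intro connected_Times connected_Xt) simp
    show "continuous_on (Xt \<times> {0..1}) (\<lambda>z. hb (\<delta> (fst z), snd z) i)"
      by (rule continuous_on_compose2[OF hb_cont[OF assms(2)] c]) (use deck_in[OF assms(1)] in auto)
    show "(\<lambda>z. hb (\<delta> (fst z), snd z) i) ` (Xt \<times> {0..1}) \<subseteq> Xt"
      using hb_in[OF assms(2)] deck_in[OF assms(1)] by auto
    show "continuous_on (Xt \<times> {0..1}) (\<lambda>z. hb z j)" if "j \<in> {1..n}" for j
      using that by (rule hb_cont)
    show "(\<lambda>z. hb z j) ` (Xt \<times> {0..1}) \<subseteq> Xt" if "j \<in> {1..n}" for j
      using hb_in[OF that] by auto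
    show "i = j" if "z \<in> Xt \<times> {0..1}" "i \<in> {1..n}" "j \<in> {1..n}" "p (hb z i) = p (hb z j)" for z i j
      using hb_inj[of "fst z" "snd z" i j] that by auto
    show "\<exists>j\<in>{1..n}. p (hb (\<delta> (fst z), snd z) i) = p (hb z j)" if z: "z \<in> Xt \<times> {0..1}" for z
    proof -
      have x: "fst z \<in> Xt" "snd z \<in> {0..1}"
        using z by auto
      have "p (hb (\<delta> (fst z), snd z) i) \<in> h (p (\<delta> (fst z)), snd z)"
        unfolding h_eq[OF deck_in[OF assms(1) x(1)] x(2)] using assms(2) by (rule imageI)
      then have "p (hb (\<delta> (fst z), snd z) i) \<in> (\<lambda>j. p (hb (fst z, snd z) j)) ` {1..n}"
        unfolding deck_p[OF assms(1) x(1)] h_eq[OF x] .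
      then show ?thesis by auto
    qed
  qed (use assms(3) in auto)
  then show ?thesis
    by (metis SigmaI fst_conv snd_conv)
qed

text \<open>A common pair has fibre points x and \<delta> x, and \<open>hb_deck\<close> rewrites
  branch j after \<delta> as \<epsilon> applied to a branch l. Comparing projections gives l = i;
  then \<gamma> \<circ> \<epsilon> and \<delta> \<circ> \<beta> agree at one point, hence
  everywhere, and \<delta> carries fixed points of the first lift to fixed points of the second. By
  symmetry, tracks that meet are equal.\<close>

lemma track_eq:
  assumes \<beta>: "\<beta> \<in> deck Xt p" "i \<in> {1..n}" and \<gamma>: "\<gamma> \<in> deck Xt p" "j \<in> {1..n}"
    and z: "z \<in> track \<beta> i" "z \<in> track \<gamma> j"
  shows "track \<beta> i \<subseteq> track \<gamma> j"
proof -
  obtain x where x: "x \<in> Xt" "p x = fst z" "\<beta> (hb (x, snd z) i) = x" and t: "snd z \<in> {0..1}"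
    using z(1) by (auto simp: track_def)
  obtain x' where x': "x' \<in> Xt" "p x' = fst z" "\<gamma> (hb (x', snd z) j) = x'"
    using z(2) by (auto simp: track_def)
  obtain \<delta> where \<delta>: "\<delta> \<in> deck Xt p" "\<delta> x = x'"
    using deck_exists[OF x(1) x'(1)] x(2) x'(2) by auto
  obtain l \<epsilon> where l: "l \<in> {1..n}" "\<epsilon> \<in> deck Xt p" "\<And>x t. x \<in> Xt \<Longrightarrow> t \<in> {0..1} \<Longrightarrow> hb (\<delta> x, t) j = \<epsilon> (hb (x, t) l)"
    using hb_deck[OF \<delta>(1) \<gamma>(2) x(1)] by blast
  let ?w = "hb (x, snd z)"
  have w: "?w l \<in> Xt" "?w i \<in> Xt"
    using hb_in x(1) t l(1) \<beta>(2) by auto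
  have e: "\<gamma> (\<epsilon> (?w l)) = \<delta> (\<beta> (?w i))"
    using x'(3) l(3)[OF x(1) t] \<delta>(2) x(3) by simp
  have "p (?w l) = p (\<gamma> (\<epsilon> (?w l)))"
    using deck_p[OF l(2) w(1)] deck_p[OF \<gamma>(1) deck_in[OF l(2) w(1)]] by simp
  also have "\<dots> = p (?w i)"
    unfolding e using deck_p[OF \<beta>(1) w(2)] deck_p[OF \<delta>(1) deck_in[OF \<beta>(1) w(2)]] by simp
  finally have li: "l = i"
    by (rule hb_inj[OF x(1) t l(1) \<beta>(2)])
  have comp: "compose Xt \<gamma> \<epsilon> = compose Xt \<delta> \<beta>"
    by (rule deck_eqI[OF deck_compose[OF \<gamma>(1) l(2)] deck_compose[OF \<delta>(1) \<beta>(1)] w(2)])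
      (use e w in \<open>simp add: compose_eq li\<close>)
  show ?thesis
  proof
    fix z' assume "z' \<in> track \<beta> i"
    then obtain y where y: "y \<in> Xt" "p y = fst z'" "\<beta> (hb (y, snd z') i) = y" and t': "snd z' \<in> {0..1}"
      by (auto simp: track_def)
    have "\<gamma> (hb (\<delta> y, snd z') j) = compose Xt \<gamma> \<epsilon> (hb (y, snd z') i)"
      using l(3)[OF y(1) t'] hb_in[OF \<beta>(2) y(1) t'] by (simp add: compose_eq li)
    also have "\<dots> = \<delta> y"
      unfolding comp using hb_in[OF \<beta>(2) y(1) t'] y(3) by (simp add: compose_eq)
    finally show "z' \<in> track \<gamma> j"
      using t' deck_in[OF \<delta>(1) y(1)] deck_p[OF \<delta>(1) y(1)] y(2) by (auto simp: track_def)
  qed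
qed

text \<open>Near z only branch j can meet the diagonal, and its translate by \<gamma> stays in the
  sheet \<open>T\<close> of x. A fixed pair in this range gives two points of \<open>T\<close> over
  one base point, and these coincide. So tracks are open among the fixed pairs.\<close>

lemma fixed_pairs_local:
  assumes z: "z \<in> fixed_pairs"
  shows "\<exists>N \<gamma> j. openin (top_of_set (X \<times> {0..1})) N \<and> z \<in> N \<and> \<gamma> \<in> deck Xt p \<and> j \<in> {1..n} \<and>
    N \<inter> fixed_pairs \<subseteq> track \<gamma> j"
proof -
  have zX: "z \<in> X \<times> {0..1}" and zh: "fst z \<in> h z"
    using z by (auto simp: fixed_pairs_def)
  obtain x where x: "x \<in> Xt" "p x = fst z" and t: "snd z \<in> {0..1}"
    using zX p_image by force
  have hz: "h z = (\<lambda>i. p (hb (x, snd z) i)) ` {1..n}"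
    using h_eq[OF x(1) t] x(2) by simp
  obtain j where j: "j \<in> {1..n}" "p (hb (x, snd z) j) = fst z"
    using zh unfolding hz by auto
  obtain \<gamma> where \<gamma>: "\<gamma> \<in> deck Xt p" "\<gamma> (hb (x, snd z) j) = x"
    using deck_exists[OF hb_in[OF j(1) x(1) t] x(1)] j(2) x(2) by auto
  obtain T U q where T: "x \<in> T" "openin (top_of_set Xt) T" "T \<subseteq> Xt" "homeomorphism T U p q" "q (p x) = x"
     "\<And>y. y \<in> U \<Longrightarrow> q y \<in> T" "\<And>y. y \<in> U \<Longrightarrow> p (q y) = y"
     "p x \<in> U" "openin (top_of_set (X \<times> {0..1::real})) (U \<times> {0..1})"
    by (rule local_section[OF x(1)]) (rule that)
  let ?b = "\<lambda>i w. hb (q (fst w), snd w) i"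
  have cb: "continuous_on (U \<times> {0..1}) (?b i)" if "i \<in> {1..n}" for i
    by (rule section_cont[OF T(4,3) that])
  have bX: "?b i w \<in> Xt" if "i \<in> {1..n}" "w \<in> U \<times> {0..1}" for i w
    by (rule hb_in[OF that(1)]) (use that(2) subsetD[OF T(3) T(6)] in auto)
  have cpb: "continuous_on (U \<times> {0..1}) (\<lambda>w. p (?b i w))" if "i \<in> {1..n}" for i
    by (rule continuous_on_compose2[OF p_cont cb[OF that]]) (use bX[OF that] in auto)
  have cg: "continuous_on (U \<times> {0..1}) (\<lambda>w. \<gamma> (?b j w))"
    by (rule continuous_on_compose2[OF deck_cont[OF \<gamma>(1)] cb[OF j(1)]]) (use bX[OF j(1)] in auto)
  define N where "N = (U \<times> {0..1}) \<inter> (\<lambda>w. \<gamma> (?b j w)) -` T \<inter> {w \<in> U \<times> {0..1}. \<forall>l\<in>{1..n} - {j}. p (?b l w) \<noteq> fst w}"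
  have "openin (top_of_set (U \<times> {0..1})) ((U \<times> {0..1}) \<inter> (\<lambda>w. \<gamma> (?b j w)) -` T)"
    by (rule continuous_openin_preimage[OF cg _ T(2)]) (use bX[OF j(1)] deck_in[OF \<gamma>(1)] in auto)
  moreover have "openin (top_of_set (U \<times> {0..1})) {w \<in> U \<times> {0..1}. \<forall>l\<in>{1..n} - {j}. p (?b l w) \<noteq> fst w}"
    by (intro openin_finite_Ball openin_Collect_neq cpb continuous_intros) auto
  ultimately have "openin (top_of_set (U \<times> {0..1})) N"
    unfolding N_def by (rule openin_Int)
  then have "openin (top_of_set (X \<times> {0..1})) N"
    using T(9) openin_trans by blast
  moreover have "z \<in> N"
  proof -
    have zU: "z \<in> U \<times> {0..1}"
      using T(8) t x(2) by (auto simp: mem_Times_iff)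
    have qz: "q (fst z) = x"
      using T(5) x(2) by simp
    have "p (hb (x, snd z) l) \<noteq> fst z" if "l \<in> {1..n} - {j}" for l
      using hb_inj[OF x(1) t _ j(1), of l] j(2) that by auto
    then show ?thesis
      using zU T(1) \<gamma>(2) by (simp add: N_def qz)
  qed
  moreover have "N \<inter> fixed_pairs \<subseteq> track \<gamma> j"
  proof
    fix w assume w: "w \<in> N \<inter> fixed_pairs"
    then have wU: "w \<in> U \<times> {0..1}"
      by (auto simp: N_def)
    have q: "q (fst w) \<in> T" "q (fst w) \<in> Xt" "p (q (fst w)) = fst w" "snd w \<in> {0..1}"
      using wU T(3,6,7) by auto
    have hw: "h w = (\<lambda>i. p (?b i w)) ` {1..n}"
      using h_eq[OF q(2,4)] q(3) by simp
    have "fst w \<in> h w"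
      using w by (simp add: fixed_pairs_def)
    then obtain l where l: "l \<in> {1..n}" "p (?b l w) = fst w"
      unfolding hw by auto
    moreover have "p (?b l w) \<noteq> fst w" if "l \<in> {1..n} - {j}" for l
      using w that by (auto simp: N_def)
    ultimately have lj: "p (?b j w) = fst w"
      by blast
    have g: "\<gamma> (?b j w) \<in> T"
      using w by (auto simp: N_def)
    have "p (\<gamma> (?b j w)) = p (q (fst w))"
      using deck_p[OF \<gamma>(1) bX[OF j(1) wU]] lj q(3) by simp
    then have "\<gamma> (?b j w) = q (fst w)"
      using homeomorphism_apply1[OF T(4) g] homeomorphism_apply1[OF T(4) q(1)] by simp
    then show "w \<in> track \<gamma> j"
      using q unfolding track_def by blast
  qed
  ultimately show ?thesis
    using \<gamma>(1) j(1) by blast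
qed

lemma openin_not_fixed_pairs: "openin (top_of_set (X \<times> {0..1})) (X \<times> {0..1} - fixed_pairs)"
proof (subst openin_subopen, intro ballI)
  fix z assume z: "z \<in> X \<times> {0..1} - fixed_pairs"
  then have "z \<in> X \<times> {0..1}" by blast
  then obtain N a where N: "openin (top_of_set (X \<times> {0..1})) N" "z \<in> N" "\<And>i. i \<in> {1..n} \<Longrightarrow> continuous_on N (a i)"
      and ha: "\<And>w. w \<in> N \<Longrightarrow> h w = (\<lambda>i. a i w) ` {1..n}"
    by (rule locally_splitsE[OF h_splits]) (rule that)
  define M where "M = {w \<in> N. \<forall>i\<in>{1..n}. a i w \<noteq> fst w}"
  have "openin (top_of_set N) M"
    unfolding M_def by (intro openin_finite_Ball openin_Collect_neq N(3) continuous_intros) auto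
  then have "openin (top_of_set (X \<times> {0..1})) M"
    using N(1) openin_trans by blast
  moreover have M: "w \<in> M \<longleftrightarrow> w \<in> N \<and> fst w \<notin> h w" for w
  proof -
    have "(\<forall>i\<in>{1..n}. a i w \<noteq> fst w) \<longleftrightarrow> fst w \<notin> (\<lambda>i. a i w) ` {1..n}"
      unfolding image_iff by metis
    then show ?thesis
      using ha[of w] by (auto simp only: M_def mem_Collect_eq)
  qed
  moreover have "N \<subseteq> X \<times> {0..1}"
    using N(1) by (rule openin_imp_subset)
  ultimately show "\<exists>T. openin (top_of_set (X \<times> {0..1})) T \<and> z \<in> T \<and> T \<subseteq> X \<times> {0..1} - fixed_pairs"
    using z N(2) by (intro exI[of _ M]) (auto simp: fixed_pairs_def)
qed

lemma compact_product: "compact (X \<times> {0..1::real})"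
  by (intro compact_Times compact_X) simp

text \<open>Fixed pairs form a closed set, each has a neighbourhood whose fixed pairs belong to one
  track, and tracks are equal or disjoint. So a track is closed, hence compact, and open among the
  fixed pairs, hence separated from the other classes.\<close>

lemma
  assumes \<beta>: "\<beta> \<in> deck Xt p" "i \<in> {1..n}"
  shows compact_track: "compact (track \<beta> i)"
    and openin_not_other_tracks: "openin (top_of_set (X \<times> {0..1})) (X \<times> {0..1} - (fixed_pairs - track \<beta> i))"
proof -
  let ?S = "X \<times> {0..1::real}"
  have FS: "fixed_pairs \<subseteq> ?S" and tF: "track \<beta> i \<subseteq> fixed_pairs"
    using track_subset[OF \<beta>] by (auto simp: fixed_pairs_def)
  have "openin (top_of_set ?S) (?S - track \<beta> i)"
  proof (subst openin_subopen, intro ballI)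
    fix z assume z: "z \<in> ?S - track \<beta> i"
    show "\<exists>T. openin (top_of_set ?S) T \<and> z \<in> T \<and> T \<subseteq> ?S - track \<beta> i"
    proof (cases "z \<in> fixed_pairs")
      case True
      then obtain N \<gamma> j where N: "openin (top_of_set ?S) N" "z \<in> N" "\<gamma> \<in> deck Xt p" "j \<in> {1..n}"
        "N \<inter> fixed_pairs \<subseteq> track \<gamma> j"
        using fixed_pairs_local by blast
      have "N \<inter> track \<beta> i = {}"
        using track_eq[OF N(3,4) \<beta>] N(2,5) z True tF by blast
      then show ?thesis
        using N(1,2) openin_imp_subset[OF N(1)] by blast
    next
      case False
      then show ?thesis
        using openin_not_fixed_pairs z tF by blast
    qed
  qed
  then have "closedin (top_of_set ?S) (track \<beta> i)"
    using FS tF by (simp add: closedin_def)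
  then show "compact (track \<beta> i)"
    by (rule closedin_compact[OF compact_product])
  show "openin (top_of_set ?S) (?S - (fixed_pairs - track \<beta> i))"
  proof (subst openin_subopen, intro ballI)
    fix z assume z: "z \<in> ?S - (fixed_pairs - track \<beta> i)"
    show "\<exists>T. openin (top_of_set ?S) T \<and> z \<in> T \<and> T \<subseteq> ?S - (fixed_pairs - track \<beta> i)"
    proof (cases "z \<in> fixed_pairs")
      case True
      then obtain N \<gamma> j where N: "openin (top_of_set ?S) N" "z \<in> N" "\<gamma> \<in> deck Xt p" "j \<in> {1..n}"
        "N \<inter> fixed_pairs \<subseteq> track \<gamma> j"
        using fixed_pairs_local by blast
      have "track \<gamma> j \<subseteq> track \<beta> i"
        using track_eq[OF N(3,4) \<beta>] N(2,5) z True by blast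
      then have "N \<subseteq> ?S - (fixed_pairs - track \<beta> i)"
        using N(5) openin_imp_subset[OF N(1)] by blast
      then show ?thesis
        using N(1,2) by blast
    next
      case False
      then show ?thesis
        using openin_not_fixed_pairs z by blast
    qed
  qed
qed

text \<open>The near-diagonal selection catches all fixed pairs at once; removing the other tracks
  from its domain leaves one compact fixed set, to which invariance for moving domains applies. The
  slices at the two ends are admissible data for the two classes.\<close>

lemma class_index_ends:
  assumes X: "ENR X" and f: "\<And>x. x \<in> X \<Longrightarrow> h (x, 0) = f x \<and> h (x, 1) = f x"
    and \<beta>: "\<beta> \<in> deck Xt p" "i \<in> {1..n}"
  shows "class_index X f (p ` {x \<in> Xt. \<beta> (hb (x, 0) i) = x}) = class_index X f (p ` {x \<in> Xt. \<beta> (hb (x, 1) i) = x})"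
proof -
  let ?S = "X \<times> {0..1::real}"
  obtain \<Omega> \<Phi> where \<Omega>: "openin (top_of_set ?S) \<Omega>" "continuous_on \<Omega> \<Phi>" "\<And>z. z \<in> \<Omega> \<Longrightarrow> \<Phi> z \<in> h z"
    "\<And>z. z \<in> ?S \<Longrightarrow> fst z \<in> h z \<Longrightarrow> z \<in> \<Omega> \<and> \<Phi> z = fst z"
    by (rule near_diagonal_selection[OF h_splits compact_product, of fst]) (auto intro: continuous_intros that)
  define \<Omega>' where "\<Omega>' = \<Omega> \<inter> (?S - (fixed_pairs - track \<beta> i))"
  have \<Omega>': "openin (top_of_set ?S) \<Omega>'"
    unfolding \<Omega>'_def by (intro openin_Int \<Omega> openin_not_other_tracks \<beta>)
  have c\<Phi>: "continuous_on \<Omega>' \<Phi>"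
    by (rule continuous_on_subset[OF \<Omega>(2)]) (auto simp: \<Omega>'_def)
  have \<Omega>'S: "z \<in> ?S" "\<Phi> z \<in> h z" "\<Phi> z \<in> X" if "z \<in> \<Omega>'" for z
  proof -
    show z: "z \<in> ?S" and "\<Phi> z \<in> h z"
      using that \<Omega>(3) by (auto simp: \<Omega>'_def)
    then show "\<Phi> z \<in> X"
      using h_subset by blast
  qed
  have track: "z \<in> track \<beta> i \<longleftrightarrow> z \<in> \<Omega>' \<and> fst z \<in> h z" "z \<in> track \<beta> i \<Longrightarrow> \<Phi> z = fst z" for z
    using track_subset[OF \<beta>] \<Omega>(4)[of z] by (auto simp: fixed_pairs_def \<Omega>'_def)
  have K: "{z \<in> \<Omega>'. \<Phi> z = fst z} = track \<beta> i"
  proof (intro equalityI subsetI)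
    fix z assume "z \<in> {z \<in> \<Omega>'. \<Phi> z = fst z}"
    then show "z \<in> track \<beta> i"
      using \<Omega>'S(2)[of z] track(1)[of z] by simp
  next
    fix z assume "z \<in> track \<beta> i"
    then show "z \<in> {z \<in> \<Omega>'. \<Phi> z = fst z}"
      using track[of z] by simp
  qed
  have "compact {z \<in> \<Omega>'. \<Phi> z = fst z}"
    unfolding K by (rule compact_track[OF \<beta>])
  then obtain k where k: "has_fixed_point_index X {x. (x, 0) \<in> \<Omega>'} (\<lambda>x. \<Phi> (x, 0)) k"
      "has_fixed_point_index X {x. (x, 1) \<in> \<Omega>'} (\<lambda>x. \<Phi> (x, 1)) k"
    by (rule has_fixed_point_index_slices[OF X \<Omega>' c\<Phi>, rotated]) (use \<Omega>'S(3) that in auto)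
  have "class_index X f (p ` {x \<in> Xt. \<beta> (hb (x, t) i) = x}) = k"
    if t: "t \<in> {0..1}" and ft: "\<And>x. x \<in> X \<Longrightarrow> f x = h (x, t)"
      and kt: "has_fixed_point_index X {x. (x, t) \<in> \<Omega>'} (\<lambda>x. \<Phi> (x, t)) k" for t
  proof (rule class_index_eqI[OF locally_splits_slice[OF h_splits t ft] _ _ _ _ _ _ _ kt])
    have C: "p ` {x \<in> Xt. \<beta> (hb (x, t) i) = x} = {x. (x, t) \<in> track \<beta> i}"
      using t by (auto simp: track_def)
    have c: "continuous_on A (\<lambda>x. (x, t))" for A
      by (intro continuous_intros)
    have "{x. (x, t) \<in> \<Omega>'} = X \<inter> (\<lambda>x. (x, t)) -` \<Omega>'"
      using \<Omega>'S(1) by auto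
    then show "openin (top_of_set X) {x. (x, t) \<in> \<Omega>'}"
      using continuous_openin_preimage[OF c[of X] _ \<Omega>'] t by auto
    show "p ` {x \<in> Xt. \<beta> (hb (x, t) i) = x} \<subseteq> {x. (x, t) \<in> \<Omega>'}"
      unfolding C using track(1) by auto
    have "x \<in> Fix X f \<inter> {x. (x, t) \<in> \<Omega>'} \<longleftrightarrow> (x, t) \<in> track \<beta> i" for x
      using track(1)[of "(x, t)"] ft[of x] \<Omega>'S(1)[of "(x, t)"] by (auto simp: Fix_def)
    then show "Fix X f \<inter> {x. (x, t) \<in> \<Omega>'} = p ` {x \<in> Xt. \<beta> (hb (x, t) i) = x}"
      unfolding C by blast
    show "continuous_on {x. (x, t) \<in> \<Omega>'} (\<lambda>x. \<Phi> (x, t))"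
      by (rule continuous_on_compose2[OF c\<Phi> c]) auto
    show "(\<lambda>x. \<Phi> (x, t)) ` {x. (x, t) \<in> \<Omega>'} \<subseteq> X"
      using \<Omega>'S(3) by auto
    show "\<Phi> (x, t) \<in> f x" if "x \<in> {x. (x, t) \<in> \<Omega>'}" for x
      using \<Omega>'S(1,2)[of "(x, t)"] ft[of x] that by auto
    show "\<Phi> (x, t) = x" if "x \<in> p ` {x \<in> Xt. \<beta> (hb (x, t) i) = x}" for x
      using that track(2)[of "(x, t)"] unfolding C by simp
  qed
  from this[OF _ _ k(1)] this[OF _ _ k(2)] show ?thesis
    using f by simp
qed

end

section \<open>Fixed point classes of irreducible maps\<close>

text \<open>The branches assemble into a local lift to the ordered configurations, which the
  quotient map carries back to g. This certifies a constructed submap as a multivalued map.\<close>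

lemma n_valued_map_if_locally_splits:
  fixes X :: "'a::topological_space set"
  assumes g: "locally_splits k S g" and X: "\<And>x. x \<in> S \<Longrightarrow> g x \<subseteq> X"
  shows "n_valued_map k (top_of_set S) (top_of_set X) g"
proof -
  let ?q = "\<lambda>y::nat \<Rightarrow> 'a. y ` {1..k}"
  let ?D = "unordered_conf k (top_of_set X)"
  have local: "\<exists>N. openin (top_of_set S) N \<and> x \<in> N \<and> continuous_map (top_of_set N) ?D g" if x: "x \<in> S" for x
  proof -
    obtain N a where N: "openin (top_of_set S) N" "x \<in> N" "\<And>i. i \<in> {1..k} \<Longrightarrow> continuous_on N (a i)"
      and inj: "\<And>w i j. w \<in> N \<Longrightarrow> i \<in> {1..k} \<Longrightarrow> j \<in> {1..k} \<Longrightarrow> a i w = a j w \<Longrightarrow> i = j"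
      and ga: "\<And>w. w \<in> N \<Longrightarrow> g w = (\<lambda>i. a i w) ` {1..k}"
      by (rule locally_splitsE[OF g x]) (rule that)
    define \<tau> where "\<tau> w = (\<lambda>i\<in>{1..k}. a i w)" for w
    have aX: "a i w \<in> X" if "w \<in> N" "i \<in> {1..k}" for w i
      using X[of w] ga[OF that(1)] that openin_imp_subset[OF N(1)] by blast
    have "continuous_map (top_of_set N) (top_of_set X) (\<lambda>x. \<tau> x i)" if i: "i \<in> {1..k}" for i
      using N(3)[OF i] aX i by (auto simp: \<tau>_def cong: continuous_on_cong)
    then have "continuous_map (top_of_set N) (product_topology (\<lambda>_. top_of_set X) {1..k}) \<tau>"
      by (auto simp: continuous_map_componentwise \<tau>_def)
    moreover have "inj_on (\<tau> w) {1..k}" if "w \<in> N" for w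
      using inj[OF that] by (auto simp: \<tau>_def inj_on_def)
    ultimately have "continuous_map (top_of_set N) (ordered_conf k (top_of_set X)) \<tau>"
      by (auto simp: ordered_conf_def continuous_map_in_subtopology)
    moreover have "continuous_map (ordered_conf k (top_of_set X)) ?D ?q"
      unfolding unordered_conf_def using quotient_map_quotient_topology by (rule quotient_imp_continuous_map)
    ultimately have "continuous_map (top_of_set N) ?D (?q \<circ> \<tau>)"
      by (rule continuous_map_compose)
    then have "continuous_map (top_of_set N) ?D g"
      by (rule continuous_map_eq) (simp add: ga \<tau>_def)
    then show ?thesis
      using N(1,2) by blast
  qed
  show ?thesis
    unfolding n_valued_map_def continuous_map
  proof (intro conjI allI impI)
    show "g ` topspace (top_of_set S) \<subseteq> topspace ?D"
    proof
      fix y assume "y \<in> g ` topspace (top_of_set S)"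
      then obtain x where x: "x \<in> S" "y = g x"
        by auto
      obtain N where "x \<in> N" "continuous_map (top_of_set N) ?D g"
        using local[OF x(1)] by blast
      then show "y \<in> topspace ?D"
        using x(2) by (auto simp: continuous_map)
    qed
    fix V assume V: "openin ?D V"
    show "openin (top_of_set S) {x \<in> topspace (top_of_set S). g x \<in> V}"
    proof (subst openin_subopen, intro ballI)
      fix x assume x: "x \<in> {x \<in> topspace (top_of_set S). g x \<in> V}"
      then obtain N where N: "openin (top_of_set S) N" "x \<in> N" "continuous_map (top_of_set N) ?D g"
        using local[of x] by auto
      have "openin (top_of_set N) {x \<in> topspace (top_of_set N). g x \<in> V}"
        by (rule openin_continuous_map_preimage[OF N(3) V])
      then have "openin (top_of_set S) {x \<in> N. g x \<in> V}"
        using N(1) openin_trans by (metis topspace_euclidean_subtopology)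
      then show "\<exists>T. openin (top_of_set S) T \<and> x \<in> T \<and> T \<subseteq> {x \<in> topspace (top_of_set S). g x \<in> V}"
        using x N(2) openin_imp_subset[OF N(1)] by (intro exI[of _ "{x \<in> N. g x \<in> V}"]) auto
    qed
  qed
qed

section \<open>Maps with a reference lift, and their submaps\<close>

locale reference_lifted_map = universal_cover X Xt p
  for X :: "'a::euclidean_space set" and Xt :: "'b::topological_space set" and p +
  fixes n :: nat and f :: "'a \<Rightarrow> 'a set" and fb :: "'b \<Rightarrow> nat \<Rightarrow> 'b"
  assumes ref: "reference_lift n Xt p f fb"
begin

lemma fb_cont: "i \<in> {1..n} \<Longrightarrow> continuous_on Xt (\<lambda>x. fb x i)"
  and fb_in: "i \<in> {1..n} \<Longrightarrow> x \<in> Xt \<Longrightarrow> fb x i \<in> Xt"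
  and fb_ext: "x \<in> Xt \<Longrightarrow> fb x \<in> extensional {1..n}"
  and fb_inj: "x \<in> Xt \<Longrightarrow> i \<in> {1..n} \<Longrightarrow> j \<in> {1..n} \<Longrightarrow> p (fb x i) = p (fb x j) \<Longrightarrow> i = j"
  and f_eq: "x \<in> Xt \<Longrightarrow> f (p x) = (\<lambda>i. p (fb x i)) ` {1..n}"
proof -
  have c: "continuous_map (top_of_set Xt) (orbit_conf n Xt p) fb"
    and e: "\<And>x. x \<in> Xt \<Longrightarrow> conf_proj n p (fb x) = f (p x)"
    using ref by (simp_all add: reference_lift_def)
  note d = continuous_map_orbit_confD[OF c]
  show "i \<in> {1..n} \<Longrightarrow> continuous_on Xt (\<lambda>x. fb x i)"
    "i \<in> {1..n} \<Longrightarrow> x \<in> Xt \<Longrightarrow> fb x i \<in> Xt" "x \<in> Xt \<Longrightarrow> fb x \<in> extensional {1..n}"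
    by (rule d, assumption+)+
  show "x \<in> Xt \<Longrightarrow> i \<in> {1..n} \<Longrightarrow> j \<in> {1..n} \<Longrightarrow> p (fb x i) = p (fb x j) \<Longrightarrow> i = j"
    using d(4)[of x] by (auto dest: inj_onD)
  show "x \<in> Xt \<Longrightarrow> f (p x) = (\<lambda>i. p (fb x i)) ` {1..n}"
    using e[of x] by (simp add: conf_proj_def comp_def)
qed

lemma fb_deck:
  assumes "\<alpha> \<in> deck Xt p" "i \<in> {1..n}" "x0 \<in> Xt"
  shows "\<exists>j\<in>{1..n}. \<exists>\<epsilon>\<in>deck Xt p. \<forall>x\<in>Xt. fb (\<alpha> x) i = \<epsilon> (fb x j)"
proof (rule multi_lift[OF connected_Xt assms(3)])
  show "continuous_on Xt (\<lambda>x. fb (\<alpha> x) i)"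
    by (rule continuous_on_compose2[OF fb_cont[OF assms(2)] deck_cont[OF assms(1)]]) (use deck_in[OF assms(1)] in auto)
  show "(\<lambda>x. fb (\<alpha> x) i) ` Xt \<subseteq> Xt"
    using fb_in[OF assms(2)] deck_in[OF assms(1)] by auto
  show "\<exists>j\<in>{1..n}. p (fb (\<alpha> x) i) = p (fb x j)" if x: "x \<in> Xt" for x
  proof -
    have "p (fb (\<alpha> x) i) \<in> f (p (\<alpha> x))"
      unfolding f_eq[OF deck_in[OF assms(1) x]] using assms(2) by (rule imageI)
    then show ?thesis
      unfolding deck_p[OF assms(1) x] f_eq[OF x] by auto
  qed
  show "continuous_on Xt (\<lambda>x. fb x j)" if "j \<in> {1..n}" for j
    using that by (rule fb_cont)
  show "(\<lambda>x. fb x j) ` Xt \<subseteq> Xt" if "j \<in> {1..n}" for j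
    using fb_in[OF that] by auto
  show "i = j" if "x \<in> Xt" "i \<in> {1..n}" "j \<in> {1..n}" "p (fb x i) = p (fb x j)" for x i j
    using that by (rule fb_inj)
qed simp

text \<open>Resolves the description in \<open>lift_hom\<close>. Existence is \<open>fb_deck\<close>
  taken coordinatewise. For uniqueness, the coordinates of \<open>fb x0\<close> have distinct
  projections, which fixes the permutation, and covering transformations that agree at a point are
  equal.\<close>

lemma lift_hom:
  assumes \<alpha>: "\<alpha> \<in> deck Xt p" and x0: "x0 \<in> Xt"
  shows "x \<in> Xt \<Longrightarrow> wreath_act n (lift_hom n Xt p fb \<alpha>) (fb x) = fb (\<alpha> x)"
proof -
  have "\<forall>i\<in>{1..n}. \<exists>j. j \<in> {1..n} \<and> (\<exists>\<epsilon>\<in>deck Xt p. \<forall>x\<in>Xt. fb (\<alpha> x) i = \<epsilon> (fb x j))"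
    using fb_deck[OF \<alpha> _ x0] by blast
  from bchoice[OF this] obtain J where J: "\<forall>i\<in>{1..n}. J i \<in> {1..n} \<and> (\<exists>\<epsilon>\<in>deck Xt p. \<forall>x\<in>Xt. fb (\<alpha> x) i = \<epsilon> (fb x (J i)))" ..
  then have "\<forall>i\<in>{1..n}. \<exists>\<epsilon>. \<epsilon> \<in> deck Xt p \<and> (\<forall>x\<in>Xt. fb (\<alpha> x) i = \<epsilon> (fb x (J i)))"
    by blast
  from bchoice[OF this] obtain E where E: "\<And>i. i \<in> {1..n} \<Longrightarrow> E i \<in> deck Xt p"
      "\<And>i x. i \<in> {1..n} \<Longrightarrow> x \<in> Xt \<Longrightarrow> fb (\<alpha> x) i = E i (fb x (J i))"
    by blast
  have Jin: "J i \<in> {1..n}" if "i \<in> {1..n}" for i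
    using J that by blast
  have "inj_on J {1..n}"
  proof (rule inj_onI)
    fix i j assume ij: "i \<in> {1..n}" "j \<in> {1..n}" "J i = J j"
    have "p (fb (\<alpha> x0) l) = p (fb x0 (J l))" if "l \<in> {1..n}" for l
      using E(2)[OF that x0] deck_p[OF E(1)[OF that] fb_in[OF Jin[OF that] x0]] by simp
    then have "p (fb (\<alpha> x0) i) = p (fb (\<alpha> x0) j)"
      using ij by simp
    then show "i = j"
      by (rule fb_inj[OF deck_in[OF \<alpha> x0] ij(1,2)])
  qed
  then have bij: "bij_betw J {1..n} {1..n}"
    using Jin by (simp add: bij_betw_def endo_inj_surj image_subset_iff)
  \<comment> \<open>Extends \<open>J\<close> by the identity, as \<open>permutes\<close> demands.
    The action reads coordinates through the inverse permutation, so the element below carries the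
    inverse of \<sigma>.\<close>
  define \<sigma> where "\<sigma> i = (if i \<in> {1..n} then J i else i)" for i
  have "bij_betw \<sigma> {1..n} {1..n}"
    using bij by (subst bij_betw_cong[of _ _ J]) (auto simp: \<sigma>_def)
  then have \<sigma>: "\<sigma> permutes {1..n}"
    by (rule bij_imp_permutes) (auto simp: \<sigma>_def)
  define g0 where "g0 = (restrict E {1..n}, inv_into UNIV \<sigma>)"
  have ii: "inv_into UNIV (inv_into UNIV \<sigma>) = \<sigma>"
    using \<sigma> by (simp add: permutes_bij inv_inv_eq)
  have act: "wreath_act n g0 (fb x) = fb (\<alpha> x)" if x: "x \<in> Xt" for x
  proof (rule extensionalityI[of _ "{1..n}"])
    show "fb (\<alpha> x) \<in> extensional {1..n}"
      by (rule fb_ext[OF deck_in[OF \<alpha> x]])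
    show "wreath_act n g0 (fb x) i = fb (\<alpha> x) i" if i: "i \<in> {1..n}" for i
      using i E(2)[OF i x] by (simp add: wreath_act_def g0_def ii \<sigma>_def)
  qed (simp add: wreath_act_def)
  have g0: "g0 \<in> wreath n Xt p"
    using E(1) permutes_inv[OF \<sigma>] by (auto simp: wreath_def g0_def)
  have uniq: "g = g0" if g: "g \<in> wreath n Xt p" "\<forall>x\<in>Xt. wreath_act n g (fb x) = fb (\<alpha> x)" for g
  proof -
    obtain A \<eta> where A: "g = (A, \<eta>)" "A \<in> {1..n} \<rightarrow>\<^sub>E deck Xt p" "\<eta> permutes {1..n}"
      using g(1) by (auto simp: wreath_def)
    have Ai: "A i \<in> deck Xt p" if "i \<in> {1..n}" for i
      using A(2) that by auto
    have \<eta>in: "inv_into UNIV \<eta> i \<in> {1..n}" if "i \<in> {1..n}" for i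
      using permutes_in_image[OF permutes_inv[OF A(3)]] that by blast
    have eq: "A i (fb x0 (inv_into UNIV \<eta> i)) = E i (fb x0 (J i))" if i: "i \<in> {1..n}" for i
    proof -
      have "wreath_act n g (fb x0) i = fb (\<alpha> x0) i"
        using bspec[OF g(2) x0] by simp
      then show ?thesis
        using i E(2)[OF i x0] by (simp add: wreath_act_def A(1))
    qed
    have iJ: "inv_into UNIV \<eta> i = J i" if i: "i \<in> {1..n}" for i
    proof (rule fb_inj[OF x0 \<eta>in[OF i] Jin[OF i]])
      show "p (fb x0 (inv_into UNIV \<eta> i)) = p (fb x0 (J i))"
        using arg_cong[OF eq[OF i], of p] deck_p[OF Ai[OF i] fb_in[OF \<eta>in[OF i] x0]]
          deck_p[OF E(1)[OF i] fb_in[OF Jin[OF i] x0]] by simp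
    qed
    have "inv_into UNIV \<eta> = \<sigma>"
    proof
      fix i show "inv_into UNIV \<eta> i = \<sigma> i"
        using iJ permutes_not_in[OF permutes_inv[OF A(3)]] by (auto simp: \<sigma>_def)
    qed
    then have "\<eta> = inv_into UNIV \<sigma>"
      using A(3) by (metis permutes_bij inv_inv_eq)
    moreover have "A = restrict E {1..n}"
    proof (rule extensionalityI[of _ "{1..n}"])
      show "A \<in> extensional {1..n}"
        using A(2) by (auto simp: PiE_def)
      show "A i = restrict E {1..n} i" if i: "i \<in> {1..n}" for i
        using deck_eqI[OF Ai[OF i] E(1)[OF i] fb_in[OF Jin[OF i] x0]] eq[OF i] iJ[OF i] i by simp
    qed simp
    ultimately show ?thesis
      by (simp add: A(1) g0_def)
  qed
  have "lift_hom n Xt p fb \<alpha> = g0"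
    unfolding lift_hom_def
  proof (rule the_equality)
    show "g0 \<in> wreath n Xt p \<and> (\<forall>x\<in>Xt. wreath_act n g0 (fb x) = fb (\<alpha> x))"
      by (intro conjI ballI g0 act)
    show "g = g0" if "g \<in> wreath n Xt p \<and> (\<forall>x\<in>Xt. wreath_act n g (fb x) = fb (\<alpha> x))" for g
      using that by (elim conjE) (rule uniq)
  qed
  then show "x \<in> Xt \<Longrightarrow> wreath_act n (lift_hom n Xt p fb \<alpha>) (fb x) = fb (\<alpha> x)"
    by (simp add: act)
qed

definition lift_class_index :: "('b \<Rightarrow> 'b) \<Rightarrow> nat \<Rightarrow> int" where
  "lift_class_index \<beta> i = class_index X f (p ` {x \<in> Xt. \<beta> (fb x i) = x})"

context
  fixes x0 :: 'b
  assumes x0: "x0 \<in> Xt" and ENR_X: "ENR X"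
    and jiang: "lift_hom n Xt p fb ` deck Xt p \<subseteq> Jiang_subgroup n Xt p X f fb"
begin

lemma class_index_deck:
  assumes \<alpha>: "\<alpha> \<in> deck Xt p" and \<beta>: "\<beta> \<in> deck Xt p" "i \<in> {1..n}"
  shows "lift_class_index \<beta> i = class_index X f (p ` {x \<in> Xt. \<beta> (fb (\<alpha> x) i) = x})"
proof -
  have "lift_hom n Xt p fb \<alpha> \<in> Jiang_subgroup n Xt p X f fb"
    using jiang \<alpha> by blast
  then obtain h hb where h: "cyclic_homotopy n X f h" "lifts_homotopy n Xt p h hb"
      "\<forall>x\<in>Xt. hb (x, 0) = fb x \<and> hb (x, 1) = wreath_act n (lift_hom n Xt p fb \<alpha>) (fb x)"
    unfolding Jiang_subgroup_def by blast
  interpret lifted_homotopy X Xt p n h hb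
    by unfold_locales (rule h(2))
  have ends: "hb (x, 0) = fb x" "hb (x, 1) = fb (\<alpha> x)" if "x \<in> Xt" for x
    using bspec[OF h(3) that] lift_hom[OF \<alpha> x0 that] by simp_all
  have "class_index X f (p ` {x \<in> Xt. \<beta> (hb (x, 0) i) = x}) = class_index X f (p ` {x \<in> Xt. \<beta> (hb (x, 1) i) = x})"
    by (rule class_index_ends[OF ENR_X _ \<beta>]) (use h(1) in \<open>auto simp: cyclic_homotopy_def\<close>)
  moreover have "{x \<in> Xt. \<beta> (hb (x, 0) i) = x} = {x \<in> Xt. \<beta> (fb x i) = x}"
      "{x \<in> Xt. \<beta> (hb (x, 1) i) = x} = {x \<in> Xt. \<beta> (fb (\<alpha> x) i) = x}"
    using ends by auto
  ultimately show ?thesis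
    by (simp add: lift_class_index_def)
qed

lemma lift_class_index_compose:
  assumes \<alpha>: "\<alpha> \<in> deck Xt p" and \<beta>: "\<beta> \<in> deck Xt p" "i \<in> {1..n}"
  shows "lift_class_index (compose Xt \<alpha> \<beta>) i = lift_class_index \<beta> i"
proof -
  have "p ` {x \<in> Xt. \<beta> (fb (\<alpha> x) i) = x} = p ` {x \<in> Xt. compose Xt \<alpha> \<beta> (fb x i) = x}"
  proof (intro equalityI subsetI)
    fix y assume "y \<in> p ` {x \<in> Xt. \<beta> (fb (\<alpha> x) i) = x}"
    then obtain x where x: "x \<in> Xt" "\<beta> (fb (\<alpha> x) i) = x" "y = p x"
      by blast
    have "compose Xt \<alpha> \<beta> (fb (\<alpha> x) i) = \<alpha> x"
      using x(2) fb_in[OF \<beta>(2) deck_in[OF \<alpha> x(1)]] by (simp add: compose_eq)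
    then show "y \<in> p ` {x \<in> Xt. compose Xt \<alpha> \<beta> (fb x i) = x}"
      using deck_in[OF \<alpha> x(1)] deck_p[OF \<alpha> x(1)] x(3) by (intro image_eqI[of _ _ "\<alpha> x"]) auto
  next
    fix y assume "y \<in> p ` {x \<in> Xt. compose Xt \<alpha> \<beta> (fb x i) = x}"
    then obtain x where x: "x \<in> Xt" "compose Xt \<alpha> \<beta> (fb x i) = x" "y = p x"
      by blast
    \<comment> \<open>Inverts x \<mapsto> \<alpha> x on fixed points: the fixed point equation
      itself exhibits x as \<alpha> of this point.\<close>
    let ?w = "\<beta> (fb x i)"
    have w: "?w \<in> Xt" "\<alpha> ?w = x"
      using x(1,2) fb_in[OF \<beta>(2) x(1)] deck_in[OF \<beta>(1)] by (auto simp: compose_eq)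
    then have "\<beta> (fb (\<alpha> ?w) i) = ?w" "p ?w = y"
      using deck_p[OF \<alpha> w(1)] x(3) by simp_all
    then show "y \<in> p ` {x \<in> Xt. \<beta> (fb (\<alpha> x) i) = x}"
      using w(1) by (intro image_eqI[of _ _ ?w]) auto
  qed
  then show ?thesis
    using class_index_deck[OF \<alpha> \<beta>] by (simp add: lift_class_index_def)
qed

text \<open>Left translation is transitive on the group: \<gamma> = (\<gamma> \<circ> \<beta>^-1)
  \<circ> \<beta>, so invariance under left composition reaches every covering
  transformation.\<close>

lemma lift_class_index_cong:
  assumes \<beta>: "\<beta> \<in> deck Xt p" and \<gamma>: "\<gamma> \<in> deck Xt p" and i: "i \<in> {1..n}"
  shows "lift_class_index \<beta> i = lift_class_index \<gamma> i"
proof -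
  obtain \<beta>' where \<beta>': "\<beta>' \<in> deck Xt p" "\<And>x. x \<in> Xt \<Longrightarrow> \<beta>' (\<beta> x) = x"
    using deck_inverse[OF \<beta>] by blast
  have c: "compose Xt \<gamma> \<beta>' \<in> deck Xt p"
    by (rule deck_compose[OF \<gamma> \<beta>'(1)])
  have "compose Xt (compose Xt \<gamma> \<beta>') \<beta> = \<gamma>"
  proof (rule deck_eqI[OF deck_compose[OF c \<beta>] \<gamma> x0])
    show "compose Xt (compose Xt \<gamma> \<beta>') \<beta> x0 = \<gamma> x0"
      using x0 deck_in[OF \<beta> x0] \<beta>'(2) by (simp add: compose_eq)
  qed
  then show ?thesis
    using lift_class_index_compose[OF c \<beta> i] by simp
qed

lemma lift_class_index_permuted:
  assumes \<alpha>: "\<alpha> \<in> deck Xt p" and \<beta>: "\<beta> \<in> deck Xt p" and i: "i \<in> {1..n}" and j: "j \<in> {1..n}"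
    and \<epsilon>: "\<epsilon> \<in> deck Xt p" "\<And>x. x \<in> Xt \<Longrightarrow> fb (\<alpha> x) i = \<epsilon> (fb x j)"
  shows "lift_class_index \<beta> i = lift_class_index \<beta> j"
proof -
  have "{x \<in> Xt. \<beta> (fb (\<alpha> x) i) = x} = {x \<in> Xt. compose Xt \<beta> \<epsilon> (fb x j) = x}"
    using \<epsilon>(2) fb_in[OF j] by (auto simp: compose_eq)
  then have "lift_class_index \<beta> i = lift_class_index (compose Xt \<beta> \<epsilon>) j"
    using class_index_deck[OF \<alpha> \<beta> i] by (simp add: lift_class_index_def)
  also have "\<dots> = lift_class_index \<beta> j"
    by (rule lift_class_index_cong[OF deck_compose[OF \<beta> \<epsilon>(1)] \<beta> j])
  finally show ?thesis .
qed

end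

text \<open>The coordinates in \<open>S\<close> select a subset of f (p x) that might depend on the
  point chosen in the fibre. At another point \<alpha> x of the fibre, coordinate i is \<epsilon>
  applied to some coordinate j at x; invariance puts j in \<open>S\<close>, and p forgets
  \<epsilon>. So the subset descends to X.\<close>

lemma proper_submap:
  assumes S: "S \<subseteq> {1..n}" "S \<noteq> {}" "S \<noteq> {1..n}"
    and inv: "\<And>\<alpha> \<epsilon> i j. \<alpha> \<in> deck Xt p \<Longrightarrow> \<epsilon> \<in> deck Xt p \<Longrightarrow> i \<in> S \<Longrightarrow> j \<in> {1..n} \<Longrightarrow>
      (\<And>x. x \<in> Xt \<Longrightarrow> fb (\<alpha> x) i = \<epsilon> (fb x j)) \<Longrightarrow> j \<in> S"
  shows "\<not> irreducible_map n (top_of_set X) (top_of_set X) f"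
proof -
  define g where "g y = (\<lambda>j. p (fb (SOME x. x \<in> Xt \<and> p x = y) j)) ` S" for y
  have sub: "(\<lambda>j. p (fb x' j)) ` S \<subseteq> (\<lambda>j. p (fb x j)) ` S" if xx: "x \<in> Xt" "x' \<in> Xt" "p x = p x'" for x x'
  proof
    fix y assume "y \<in> (\<lambda>j. p (fb x' j)) ` S"
    then obtain i where i: "i \<in> S" "y = p (fb x' i)"
      by blast
    then have i1: "i \<in> {1..n}" using S(1) by blast
    obtain \<alpha> where \<alpha>: "\<alpha> \<in> deck Xt p" "\<alpha> x = x'"
      using deck_exists[OF xx] by blast
    obtain j \<epsilon> where j: "j \<in> {1..n}" "\<epsilon> \<in> deck Xt p" "\<And>x. x \<in> Xt \<Longrightarrow> fb (\<alpha> x) i = \<epsilon> (fb x j)"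
      using fb_deck[OF \<alpha>(1) i1 xx(1)] by blast
    have "j \<in> S"
      by (rule inv[OF \<alpha>(1) j(2) i(1) j(1) j(3)])
    moreover have "y = p (fb x j)"
      using j(3)[OF xx(1)] \<alpha>(2) deck_p[OF j(2) fb_in[OF j(1) xx(1)]] i(2) by simp
    ultimately show "y \<in> (\<lambda>j. p (fb x j)) ` S"
      by blast
  qed
  have g: "g (p x) = (\<lambda>j. p (fb x j)) ` S" if x: "x \<in> Xt" for x
  proof -
    define s where "s = (SOME x'. x' \<in> Xt \<and> p x' = p x)"
    have s: "s \<in> Xt \<and> p s = p x"
      unfolding s_def by (rule someI[of _ x]) (simp add: x)
    have "(\<lambda>j. p (fb s j)) ` S = (\<lambda>j. p (fb x j)) ` S"
      using sub[of x s] sub[of s x] s x by (intro equalityI) simp_all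
    then show ?thesis
      by (simp add: g_def s_def)
  qed
  have fin: "finite S"
    using S(1) finite_subset by blast
  \<comment> \<open>Renumbers \<open>S\<close>, since the branches of a k-valued map are indexed by
    {1..k}.\<close>
  obtain e where e: "bij_betw e {1..card S} S"
    using ex_bij_betw_nat_finite_1[OF fin] by blast
  have eS: "e l \<in> S" "e l \<in> {1..n}" if "l \<in> {1..card S}" for l
  proof -
    show "e l \<in> S"
      using bij_betw_apply[OF e that] .
    then show "e l \<in> {1..n}"
      using S(1) by (rule rev_subsetD)
  qed
  have gX: "g y \<subseteq> f y" "g y \<subseteq> X" if y: "y \<in> X" for y
  proof -
    obtain x where x: "x \<in> Xt" "p x = y"
      using y p_image by blast
    show "g y \<subseteq> f y"
      unfolding x(2)[symmetric] g[OF x(1)] f_eq[OF x(1)] using S(1) by (rule image_mono)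
    show "g y \<subseteq> X"
      unfolding x(2)[symmetric] g[OF x(1)] using p_in[OF fb_in[OF _ x(1)]] S(1) by blast
  qed
  have "locally_splits (card S) X g"
    unfolding locally_splits_def
  proof
    fix y assume "y \<in> X"
    then obtain x where x: "x \<in> Xt" "p x = y"
      using p_image by blast
    obtain T U q where T: "openin (top_of_set Xt) T" "p x \<in> U" "openin (top_of_set X) U"
      "homeomorphism T U p q"
      by (rule covering_space_local_homeomorphism[OF cov x(1)]) (rule that)
    have q: "continuous_on U q" "q w \<in> Xt" "p (q w) = w" if "w \<in> U" for w
      using T(4) that openin_imp_subset[OF T(1)] by (auto simp: homeomorphism_def)
    show "\<exists>N a. openin (top_of_set X) N \<and> y \<in> N \<and> (\<forall>i\<in>{1..card S}. continuous_on N (a i)) \<and>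
        (\<forall>w\<in>N. inj_on (\<lambda>i. a i w) {1..card S} \<and> g w = (\<lambda>i. a i w) ` {1..card S})"
    proof (intro exI[of _ U] exI[of _ "\<lambda>l w. p (fb (q w) (e l))"] conjI ballI T(3))
      show "y \<in> U"
        using T(2) x(2) by simp
      show "continuous_on U (\<lambda>w. p (fb (q w) (e l)))" if l: "l \<in> {1..card S}" for l
      proof (rule continuous_on_compose2[OF p_cont])
        show "continuous_on U (\<lambda>w. fb (q w) (e l))"
          by (rule continuous_on_compose2[OF fb_cont[OF eS(2)[OF l]] q(1)[OF T(2)]]) (use q(2) in auto)
        show "(\<lambda>w. fb (q w) (e l)) ` U \<subseteq> Xt"
          using fb_in[OF eS(2)[OF l] q(2)] by auto
      qed
      fix w assume w: "w \<in> U"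
      show "inj_on (\<lambda>l. p (fb (q w) (e l))) {1..card S}"
      proof (rule inj_onI)
        fix l m assume lm: "l \<in> {1..card S}" "m \<in> {1..card S}" "p (fb (q w) (e l)) = p (fb (q w) (e m))"
        then have "e l = e m"
          by (intro fb_inj[OF q(2)[OF w] eS(2)[OF lm(1)] eS(2)[OF lm(2)]])
        then show "l = m"
          using bij_betw_imp_inj_on[OF e] lm by (auto dest: inj_onD)
      qed
      have "g w = (\<lambda>j. p (fb (q w) j)) ` S"
        using g[OF q(2)[OF w]] q(3)[OF w] by simp
      moreover have "(\<lambda>l. p (fb (q w) (e l))) ` {1..card S} = (\<lambda>j. p (fb (q w) j)) ` e ` {1..card S}"
        by (simp only: image_image)
      ultimately show "g w = (\<lambda>l. p (fb (q w) (e l))) ` {1..card S}"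
        by (simp only: bij_betw_imp_surj_on[OF e])
    qed
  qed
  then have "n_valued_map (card S) (top_of_set X) (top_of_set X) g"
    by (rule n_valued_map_if_locally_splits) (rule gX(2))
  moreover have "1 \<le> card S"
    using fin S(2) by (simp add: Suc_le_eq card_gt_0_iff)
  moreover have "card S < n"
    using psubset_card_mono[of "{1..n}" S] S by auto
  ultimately show ?thesis
    unfolding irreducible_map_def using gX(1) by auto
qed

end

theorem theorem6p1:
  fixes K :: "'a::euclidean_space set set" and X :: "'a set"
    and Xt :: "'b::topological_space set" and p :: "'b \<Rightarrow> 'a"
    and n :: nat and f :: "'a \<Rightarrow> 'a set" and fb :: "'b \<Rightarrow> nat \<Rightarrow> 'b"
  assumes "simplicial_complex K" and "X = \<Union>K" and "connected X"
    and "universal_covering Xt p X"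
    and "1 \<le> n"
    and "n_valued_map n (top_of_set X) (top_of_set X) f"
    and "reference_lift n Xt p f fb"
    and "lift_hom n Xt p fb ` deck Xt p \<subseteq> Jiang_subgroup n Xt p X f fb"
    and "irreducible_map n (top_of_set X) (top_of_set X) f"
  shows "\<forall>C \<in> fixed_point_classes n Xt p fb. \<forall>C' \<in> fixed_point_classes n Xt p fb.
           class_index X f C = class_index X f C'"
proof (intro ballI)
  have K: "finite K" "\<And>S. S \<in> K \<Longrightarrow> compact S \<and> convex S"
    using assms(1) by (auto simp: simplicial_complex_def intro: compact_simplex convex_simplex)
  \<comment> \<open>A finite union of compact convex sets is a compact Euclidean neighbourhood
    retract, and so locally path connected: this provides the retraction for the index and the local
    hypothesis for lifting.\<close>
  have cX: "compact X" and eX: "ENR X"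
    using K compact_imp_closed unfolding assms(2)
    by (auto intro!: ENR_finite_Union_convex_closed)
  interpret reference_lifted_map X Xt p n f fb
    by unfold_locales (rule assms(4) cX ENR_imp_locally_path_connected[OF eX] assms(7))+
  fix C C' assume C: "C \<in> fixed_point_classes n Xt p fb" "C' \<in> fixed_point_classes n Xt p fb"
  obtain \<alpha> i where \<alpha>: "\<alpha> \<in> deck Xt p" "i \<in> {1..n}" "C = p ` {x \<in> Xt. \<alpha> (fb x i) = x}"
    using C(1) by (auto simp: fixed_point_classes_def)
  obtain \<beta> j where \<beta>: "\<beta> \<in> deck Xt p" "j \<in> {1..n}" "C' = p ` {x \<in> Xt. \<beta> (fb x j) = x}"
    using C(2) by (auto simp: fixed_point_classes_def)
  show "class_index X f C = class_index X f C'"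
  \<comment> \<open>Over an empty covering space both classes are empty; otherwise there is a base
    point at which covering transformations can be compared.\<close>
  proof (cases "Xt = {}")
    case True
    then show ?thesis
      by (simp add: \<alpha>(3) \<beta>(3))
  next
    case False
    then obtain x0 where x0: "x0 \<in> Xt" by blast
    \<comment> \<open>Testing with the single transformation \<alpha> suffices, since the index
      depends only on the coordinate. The set contains i and is closed under the coordinate
      permutations, so irreducibility forces it to be everything.\<close>
    define S where "S = {l \<in> {1..n}. lift_class_index \<alpha> l = lift_class_index \<alpha> i}"
    have "S = {1..n}"
    proof (rule ccontr)
      assume "S \<noteq> {1..n}"
      then have "\<not> irreducible_map n (top_of_set X) (top_of_set X) f"
      proof (rule proper_submap[rotated 2])
        show "l \<in> S" if "\<gamma> \<in> deck Xt p" "\<epsilon> \<in> deck Xt p" "k \<in> S" "l \<in> {1..n}"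
          "\<And>x. x \<in> Xt \<Longrightarrow> fb (\<gamma> x) k = \<epsilon> (fb x l)" for \<gamma> \<epsilon> k l
          using lift_class_index_permuted[OF x0 eX assms(8) that(1) \<alpha>(1) _ that(4,2,5)] that(3,4)
          by (auto simp: S_def)
      qed (use \<alpha>(2) in \<open>auto simp: S_def\<close>)
      with assms(9) show False by simp
    qed
    then have "j \<in> S"
      using \<beta>(2) by simp
    then have "lift_class_index \<alpha> i = lift_class_index \<alpha> j"
      by (simp add: S_def)
    also have "\<dots> = lift_class_index \<beta> j"
      by (rule lift_class_index_cong[OF x0 eX assms(8) \<alpha>(1) \<beta>(1,2)])
    finally show ?thesis
      by (simp add: lift_class_index_def \<alpha>(3) \<beta>(3))
  qed
qed

end
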